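(* The generator $R'$ of the infinitesimal canonical transformation $W\mapsto W+\{W,R'\}'+\hbar\Delta'R'$ induced on the effective BV action $W(\alpha)$ by an infinitesimal change of induction data $(\iota,K)$ has the form $$R'(\alpha)=\sum_{a,i}\alpha_{(2)i}^a\,G^{ia}(\alpha_{(1)}^1,\dots,\alpha_{(1)}^{B_1};\hbar),$$ where $G=\sum_{a,i}G^{ia}\frac{\partial}{\partial\alpha_{(1)}^{ia}}\in(\mathrm{Vect}(\mathfrak g^{B_1})[[\hbar]])^{\mathfrak g}$ is some $\hbar$-dependent vector field on $H^1(\mathcal C,\mathfrak g)[1]\cong\mathfrak g^{B_1}$, equivariant under the diagonal adjoint action of $\mathfrak g$, i.e., with $G^i:=\sum_aT_aG^{ia}$, $$G^i(\alpha_{(1)}^1+[X,\alpha_{(1)}^1],\dots,\alpha_{(1)}^{B_1}+[X,\alpha_{(1)}^{B_1}];\hbar)=G^i(\alpha_{(1)}^1,\dots,\alpha_{(1)}^{B_1};\hbar)+[X,G^i(\alpha_{(1)}^1,\dots,\alpha_{(1)}^{B_1};\hbar)]\mod X^2$$ at first order in $X\in\mathfrak g$, for all $i=1,\dots,B_1$. In terms of the decomposition $W=W_{\mathrm{prod}}+F(\alpha_{(1)}^1,\dots,\alpha_{(1)}^{B_1};\hbar)$, the canonical transformation with generator $R'$ is $$F\mapsto F+G\circ(W_{\mathrm{prod}}^{111}+F)+\hbar\,\mathrm{div}(G),$$ where $G\circ$ denotes the action of the vector field $G$ as a derivation and $\mathrm{div}(G)=\sum_{a,i}\partial G^{ia}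/\partial\alpha_{(1)}^{ia}$.
   Context: **Algebraic data.** $\mathcal C=\mathcal C^0\oplus\mathcal C^1\oplus\mathcal C^2\oplus\mathcal C^3$ ($\mathcal C^k$ in degree $k$) is a finite-dimensional real dg Frobenius algebra: a unital differential graded commutative associative algebra with differential $d$ of degree $+1$, product $m$, and a nondegenerate graded-symmetric pairing $\pi$ with $\pi(a,b)\ne0\Rightarrow|a|+|b|=3$, such that $\pi(da,b)+(-1)^{|a|}\pi(a,db)=0$ and $\pi(a,m(b,c))=\pi(m(a,b),c)$. $B_k=\dim H^k(\mathcal C)$; assume $B_0=B_3=1$. $\mathfrak g$ is a finite-dimensional real Lie algebra with nondegenerate ad-invariant symmetric form $\pi_{\mathfrak g}$ and orthonormal basis $\{T_a\}$. On $\mathfrak g\otimes\mathcal C$ put $d(X\otimes a)=X\otimes da$, $l(X\otimes a,Y\otimes b)=[X,Y]\otimes m(a,b)$, $\pi(X\otimes a,Y\otimes b)=\pi_{\mathfrak g}(X,Y)\pi(a,b)$, extended by the Koszul rule. $\mathrm{Fun}$ of a graded vector space is the graded commutative algebra of (polynomial, completed to formal power series) functions on it. **Fields and action.** $\mathcal F=\mathfrak g\otimes\mathcal C[1]$ with odd symplectic form $\sigma(sA,sB)=(-1)^{|A|}\pi(A,B)$ ($s$ the suspension). $\omega=\sum T_ae_I\omega^{Ia}$ is the canonical element ($\{e_I\}$ a basis of $\mathcal C$, $\omega^{Ia}$ of ghost number $1-|e_I|$), and $S=\tfrac12\pi(\omega,d\omega)+\tfrac16\pi(\omega,l(\omega,\omega))$.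 **Induction data** $(\iota,K)$: $\iota:H^\bullet(\mathcal C)\to\mathcal C^\bullet$ is linear and sends each class to a cocycle representing it; $\iota^T$ is its transpose with respect to $\pi$ and the induced pairing $\pi'=\pi(\iota\cdot,\iota\cdot)$; $K:\mathcal C^\bullet\to\mathcal C^{\bullet-1}$ is linear with $$dK+Kd=\mathrm{id}-\iota\iota^T,\quad\pi(Ka,b)=(-1)^{|a|}\pi(a,Kb),\quad K\iota=0,\quad K^2=0.$$ Then $\mathcal C=\mathrm{im}(\iota)\oplus\mathcal C_{d-ex}\oplus\mathcal C_{K-ex}$ with $\mathcal C_{d-ex}=\mathrm{im}(d)$, $\mathcal C_{K-ex}=\mathrm{im}(K)$. Put $\mathcal L_K=\mathfrak g\otimes\mathcal C_{K-ex}[1]$ and $\mathcal F'=H^\bullet(\mathcal C,\mathfrak g)[1]$. **Effective action.** $W\in\mathrm{Fun}(\mathcal F')[[\hbar]]$ is defined by the formal (perturbative Gaussian) integral $$e^{W(\alpha)/\hbar}=\frac1N\int_{\mathcal L_K}e^{S(\iota(\alpha)+\omega'')/\hbar}\mu_{\mathcal L_K},\qquad N=\int_{\mathcal L_K}e^{\frac1{2\hbar}\pi(\omega'',d\omega'')}\mu_{\mathcal L_K}.$$ **Coordinates on $\mathcal F'$.** Let $e_{(0)}=[1]\in H^0$, $e_{(3)}\in H^3$ with $\pi'(e_{(0)},e_{(3)})=1$, $\{e_{(1)i}\}$ a basis of $H^1$ and $\{e_{(2)}^i\}$ the dual basis of $H^2$ ($\pi'(e_{(1)i},e_{(2)}^j)=\delta_i^j$).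 Then $\alpha=e_{(0)}\alpha_{(0)}+\sum_ie_{(1)i}\alpha_{(1)}^i+\sum_ie_{(2)}^i\alpha_{(2)i}+e_{(3)}\alpha_{(3)}$ with $\mathfrak g$-valued coordinates ($\alpha_{(1)}^i=\sum_aT_a\alpha_{(1)}^{ia}$, etc.) of ghost numbers $1,0,-1,-2$. The BV Laplacian on $\mathrm{Fun}(\mathcal F')$ is $$\Delta'=\sum_a\frac{\partial}{\partial\alpha_{(0)}^a}\frac{\partial}{\partial\alpha_{(3)}^a}+\sum_{a,i}\frac{\partial}{\partial\alpha_{(1)}^{ia}}\frac{\partial}{\partial\alpha_{(2)i}^a},$$ and the anti-bracket is given by $(-1)^{|u|}\{u,w\}'=\Delta'(uw)-(\Delta'u)w-(-1)^{|u|}u\Delta'w$. Put $W_{\mathrm{prod}}(\alpha)=\tfrac16\pi(\iota(\alpha),l(\iota(\alpha),\iota(\alpha)))$ and $W_{\mathrm{prod}}^{111}=\tfrac16\sum_{i,j,k}\mu_{ijk}\,\pi_{\mathfrak g}(\alpha_{(1)}^i,[\alpha_{(1)}^j,\alpha_{(1)}^k])$ with $\mu_{ijk}=\pi(\iota(e_{(1)i}),m(\iota(e_{(1)j}),\iota(e_{(1)k})))$. The effective action always has the form $W=W_{\mathrm{prod}}+F(\alpha_{(1)}^1,\dots,\alpha_{(1)}^{B_1};\hbar)$ with $F$ invariant under the diagonal adjoint action of $\mathfrak g$. **Infinitesimal changes of induction data** are sums of two kinds: - $\iota\mapsto\iota$, $K\mapsto K+[d,\delta\kappa]=K+d\,\delta\kappa-\delta\kappa\,d$,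 with $\delta\kappa:\mathcal C_{d-ex}^\bullet\to\mathcal C_{K-ex}^{\bullet-2}$ linear of degree $-2$ (extended by zero), such that the symmetry condition on $K$ is preserved, i.e. $\pi(\delta\kappa\,a,b)=\pi(a,\delta\kappa\,b)$. - $\iota\mapsto\iota+d\,\delta I$, $K\mapsto K+\iota\,\delta I^T-\delta I\,\iota^T$, with $\delta I:H^\bullet(\mathcal C)\to\mathcal C_{K-ex}^{\bullet-1}$ linear of degree $-1$ and $\delta I^T$ the transpose, with the sign making all conditions on $(\iota,K)$ hold to first order: $\pi'(\delta I^Tb,c)=-(-1)^{|b|}\pi(b,\delta I\,c)$. The generator of the induced infinitesimal canonical transformation $W\mapsto W+\{W,R'\}'+\hbar\Delta'R'$ is the one given by the (perturbative) integral $$R'(\alpha)=e^{-W(\alpha)/\hbar}\,\frac1N\int_{\mathcal L_K}e^{S(\iota(\alpha)+\omega'')/\hbar}\left(\tfrac12\pi(\omega'',d\,\delta\kappa\,d\,\omega'')+\pi(\omega'',d\,\delta I\,\alpha)\right)\mu_{\mathcal L_K}.$$ *)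

theory Defs
  imports
    "HOL-Complex_Analysis.Complex_Analysis"
    "HOL-Library.Multiset"
    "HOL-Library.Countable"
    "HOL-Computational_Algebra.Formal_Laurent_Series"
begin

section \<open>Graded commutative power series with coefficients in \<open>\<real>((\<hbar>))\<close>\<close>

text \<open>
  Coordinates on \<open>\<F>' \<oplus> \<L>\<^sub>K\<close>.  \<open>A0 a\<close>, \<open>A1 i a\<close>, \<open>A2 i a\<close>, \<open>A3 a\<close> are
  \<open>\<alpha>\<^sub>(\<^sub>0\<^sub>)\<^sup>a\<close>, \<open>\<alpha>\<^sub>(\<^sub>1\<^sub>)\<^sup>i\<^sup>a\<close>, \<open>\<alpha>\<^sub>(\<^sub>2\<^sub>)\<^sub>i\<^sup>a\<close>, \<open>\<alpha>\<^sub>(\<^sub>3\<^sub>)\<^sup>a\<close>; \<open>Om k j a\<close> is the coordinate of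
  \<open>\<omega>''\<close> along \<open>T\<^sub>a\<close> times the \<open>j\<close>-th basis vector of the degree \<open>k\<close> part of \<open>im K\<close>.  Indices
  are natural numbers because \<open>B\<^sub>1\<close> and \<open>dim \<gg>\<close> may be \<open>0\<close>.
\<close>

datatype fvar = A0 nat | A1 nat nat | A2 nat nat | A3 nat | Om nat nat nat

instance fvar :: countable
  by countable_datatype

fun ghost :: "fvar \<Rightarrow> int" where
  "ghost (A0 a) = 1"
| "ghost (A1 i a) = 0"
| "ghost (A2 i a) = -1"
| "ghost (A3 a) = -2"
| "ghost (Om k j a) = 1 - int k"

fun colour :: "fvar \<Rightarrow> nat" where
  "colour (A0 a) = a"
| "colour (A1 i a) = a"
| "colour (A2 i a) = a"
| "colour (A3 a) = a"
| "colour (Om k j a) = a"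

abbreviation odd_var :: "fvar \<Rightarrow> bool" where
  "odd_var v \<equiv> odd (ghost v)"

text \<open>
  A multiset stands for the product of its elements in increasing order, for the (arbitrary) order
  of \<open>fvar\<close> given by \<open>to_nat\<close>.  \<open>mono_sign a b\<close> is the sign which reorders the product of the
  monomials \<open>a\<close> and \<open>b\<close>; it is \<open>0\<close> if an odd coordinate is repeated.
\<close>

definition mono_sign :: "fvar multiset \<Rightarrow> fvar multiset \<Rightarrow> int" where
  "mono_sign a b =
    (if \<exists>v. odd_var v \<and> v \<in># a \<and> v \<in># b then 0
     else (-1) ^ card {(v, w). v \<in># a \<and> w \<in># b \<and> odd_var v \<and> odd_var w \<and> to_nat w < to_nat v})"

definition admissible :: "fvar multiset \<Rightarrow> bool" where
  "admissible m \<longleftrightarrow> (\<forall>v. odd_var v \<longrightarrow> count m v \<le> 1)"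

typedef sfun = "{f :: fvar multiset \<Rightarrow> real fls. \<forall>m. \<not> admissible m \<longrightarrow> f m = 0}"
  morphisms coeff Abs_sfun
  by (rule exI[of _ "\<lambda>_. 0"]) simp

setup_lifting type_definition_sfun

lemma sfun_eqI: "(\<And>m. coeff f m = coeff g m) \<Longrightarrow> f = g"
  by (simp add: coeff_inject[symmetric] fun_eq_iff)

lemma finite_msplit: "finite {(a, b). a + b = (m :: 'a multiset)}"
proof (rule finite_subset)
  let ?M = "\<Union>n\<le>size m. multisets_of_size (set_mset m) n"
  have "finite ?M" by (intro finite_UN_I finite_multisets_of_size) auto
  then show "finite (?M \<times> ?M)" by (intro finite_cartesian_product)
  show "{(a, b). a + b = m} \<subseteq> ?M \<times> ?M" by (auto simp: multisets_of_size_def)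
qed

lemma not_admissible_add_mset:
  assumes "\<not> admissible m"
  shows "\<not> admissible (add_mset v m)"
proof -
  from assms obtain w where w: "odd_var w" "1 < count m w" by (auto simp: admissible_def)
  have "count m w \<le> count (add_mset v m) w" by simp
  then have "\<not> count (add_mset v m) w \<le> 1" using w(2) by linarith
  then show ?thesis using w(1) unfolding admissible_def by blast
qed

lemma mono_sign_not_admissible:
  assumes "\<not> admissible (a + b)" "admissible a" "admissible b"
  shows "mono_sign a b = 0"
proof -
  from assms(1) obtain v where v: "odd_var v" "count a v + count b v > 1"
    by (auto simp: admissible_def)
  moreover have "count a v \<le> 1" "count b v \<le> 1"
    using assms(2,3) v(1) by (auto simp: admissible_def)
  ultimately have "v \<in># a" "v \<in># b"
    by (auto simp: count_greater_zero_iff[symmetric] simp del: count_greater_zero_iff)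
  then show ?thesis using v(1) by (auto simp: mono_sign_def)
qed

lemma mono_sign_finite:
  "finite {(v, w). v \<in># a \<and> w \<in># b \<and> odd_var v \<and> odd_var w \<and> to_nat w < to_nat v}"
  by (rule finite_subset[of _ "set_mset a \<times> set_mset b"]) auto

lemma mono_sign_add_left:
  assumes "mono_sign a b \<noteq> 0"
  shows "mono_sign (a + b) c = mono_sign a c * mono_sign b c"
proof (cases "\<exists>v. odd_var v \<and> (v \<in># a \<or> v \<in># b) \<and> v \<in># c")
  case True
  then show ?thesis by (auto simp: mono_sign_def)
next
  case False
  let ?S = "\<lambda>a b. {(v, w). v \<in># a \<and> w \<in># b \<and> odd_var v \<and> odd_var w \<and> to_nat w < to_nat v}"
  have un: "?S (a + b) c = ?S a c \<union> ?S b c" by auto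
  have dis: "?S a c \<inter> ?S b c = {}" using assms by (auto simp: mono_sign_def split: if_splits)
  have "card (?S (a + b) c) = card (?S a c) + card (?S b c)"
    unfolding un by (rule card_Un_disjoint[OF mono_sign_finite mono_sign_finite dis])
  then show ?thesis using False by (auto simp: mono_sign_def power_add)
qed

lemma mono_sign_add_right:
  assumes "mono_sign b c \<noteq> 0"
  shows "mono_sign a (b + c) = mono_sign a b * mono_sign a c"
proof (cases "\<exists>v. odd_var v \<and> (v \<in># b \<or> v \<in># c) \<and> v \<in># a")
  case True
  then show ?thesis by (auto simp: mono_sign_def)
next
  case False
  let ?S = "\<lambda>a b. {(v, w). v \<in># a \<and> w \<in># b \<and> odd_var v \<and> odd_var w \<and> to_nat w < to_nat v}"
  have un: "?S a (b + c) = ?S a b \<union> ?S a c" by auto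
  have dis: "?S a b \<inter> ?S a c = {}" using assms by (auto simp: mono_sign_def split: if_splits)
  have "card (?S a (b + c)) = card (?S a b) + card (?S a c)"
    unfolding un by (rule card_Un_disjoint[OF mono_sign_finite mono_sign_finite dis])
  then show ?thesis using False by (auto simp: mono_sign_def power_add)
qed

lemma mono_sign_cocycle:
  "mono_sign a b * mono_sign (a + b) c = mono_sign b c * mono_sign a (b + c)"
proof (cases "mono_sign a b = 0 \<or> mono_sign b c = 0")
  case True
  then show ?thesis
  proof
    assume ab: "mono_sign a b = 0"
    then obtain v where "odd_var v" "v \<in># a" "v \<in># b" by (auto simp: mono_sign_def split: if_splits)
    then have "mono_sign a (b + c) = 0" by (auto simp: mono_sign_def)
    then show ?thesis using ab by simp
  next
    assume bc: "mono_sign b c = 0"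
    then obtain v where "odd_var v" "v \<in># b" "v \<in># c" by (auto simp: mono_sign_def split: if_splits)
    then have "mono_sign (a + b) c = 0" by (auto simp: mono_sign_def)
    then show ?thesis using bc by simp
  qed
qed (simp add: mono_sign_add_left mono_sign_add_right)

lemma mono_sign_empty [simp]: "mono_sign {#} m = 1" "mono_sign m {#} = 1"
  by (auto simp: mono_sign_def)

instantiation sfun :: ring_1
begin

lift_definition zero_sfun :: sfun is "\<lambda>_. 0" by simp

lift_definition one_sfun :: sfun is "\<lambda>m. if m = {#} then 1 else 0"
  by (auto simp: admissible_def)

lift_definition plus_sfun :: "sfun \<Rightarrow> sfun \<Rightarrow> sfun" is "\<lambda>f g m. f m + g m" by simp

lift_definition minus_sfun :: "sfun \<Rightarrow> sfun \<Rightarrow> sfun" is "\<lambda>f g m. f m - g m" by simp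

lift_definition uminus_sfun :: "sfun \<Rightarrow> sfun" is "\<lambda>f m. - f m" by simp

lift_definition times_sfun :: "sfun \<Rightarrow> sfun \<Rightarrow> sfun" is
  "\<lambda>f g m. \<Sum>(a, b)\<in>{(a, b). a + b = m}. of_int (mono_sign a b) * f a * g b"
proof goal_cases
  case (1 f g m)
  have "of_int (mono_sign a b) * f a * g b = 0" if "a + b = m" for a b
    using 1 that mono_sign_not_admissible[of a b]
    by (cases "admissible a"; cases "admissible b") auto
  then show ?case
    by (auto intro!: sum.neutral)
qed

instance
proof
  fix f g h :: sfun
  show "f * g * h = f * (g * h)"
  proof (rule sfun_eqI)
    fix m
    let ?P = "\<lambda>m. {(a, b). a + b = (m :: fvar multiset)}"
    let ?F = "\<lambda>a b c. of_int (mono_sign a b * mono_sign (a + b) c) *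
        (coeff f a * coeff g b * coeff h c)"
    have "coeff (f * g * h) m = (\<Sum>(x, c)\<in>?P m. \<Sum>(a, b)\<in>?P x. ?F a b c)"
      unfolding times_sfun.rep_eq
      by (auto simp: sum_distrib_left sum_distrib_right mult_ac intro!: sum.cong)
    also have "\<dots> = (\<Sum>(p, q)\<in>(SIGMA p:?P m. ?P (fst p)). ?F (fst q) (snd q) (snd p))"
      unfolding case_prod_beta by (rule sum.Sigma[unfolded case_prod_beta]) (auto simp: finite_msplit[unfolded case_prod_beta])
    also have "\<dots> = (\<Sum>(p, q)\<in>(SIGMA p:?P m. ?P (snd p)). ?F (fst p) (fst q) (snd q))"
      by (rule sum.reindex_bij_witness[where
            i = "\<lambda>(p, q). ((fst p + fst q, snd q), (fst p, fst q))" and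
            j = "\<lambda>(p, q). ((fst q, snd q + snd p), (snd q, snd p))"])
         (auto simp: add_ac)
    also have "\<dots> = (\<Sum>(a, y)\<in>?P m. \<Sum>(b, c)\<in>?P y. ?F a b c)"
      unfolding case_prod_beta
      by (rule sum.Sigma[unfolded case_prod_beta, symmetric]) (auto simp: finite_msplit[unfolded case_prod_beta])
    also have "\<dots> = coeff (f * (g * h)) m"
      unfolding times_sfun.rep_eq mono_sign_cocycle
      by (auto simp: sum_distrib_left sum_distrib_right mult_ac intro!: sum.cong)
    finally show "coeff (f * g * h) m = coeff (f * (g * h)) m" .
  qed
  show "1 * f = f"
  proof (rule sfun_eqI)
    fix m
    have "coeff (1 * f) m = (\<Sum>p\<in>{({#} :: fvar multiset, m)}. coeff f m)"
      unfolding times_sfun.rep_eq one_sfun.rep_eq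
      by (intro sum.mono_neutral_cong_right finite_msplit) (auto split: if_splits)
    then show "coeff (1 * f) m = coeff f m" by simp
  qed
  show "f * 1 = f"
  proof (rule sfun_eqI)
    fix m
    have "coeff (f * 1) m = (\<Sum>p\<in>{(m, {#} :: fvar multiset)}. coeff f m)"
      unfolding times_sfun.rep_eq one_sfun.rep_eq
      by (intro sum.mono_neutral_cong_right finite_msplit) (auto split: if_splits)
    then show "coeff (f * 1) m = coeff f m" by simp
  qed
  show "(f + g) * h = f * h + g * h"
    by (rule sfun_eqI)
      (simp add: times_sfun.rep_eq plus_sfun.rep_eq case_prod_beta sum.distrib algebra_simps)
  show "f * (g + h) = f * g + f * h"
    by (rule sfun_eqI)
      (simp add: times_sfun.rep_eq plus_sfun.rep_eq case_prod_beta sum.distrib algebra_simps)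
  show "(0 :: sfun) \<noteq> 1"
  proof
    assume "(0 :: sfun) = 1"
    then have "coeff 0 {#} = coeff 1 {#}" by simp
    then show False by (simp add: zero_sfun.rep_eq one_sfun.rep_eq)
  qed
  show "f + g + h = f + (g + h)" "f + g = g + f" "0 + f = f"
    by (transfer; simp add: add_ac)+
  show "- f + f = 0" "f - g = f + - g"
    by (transfer; simp)+
qed

end

instantiation sfun :: real_algebra_1
begin

lift_definition scaleR_sfun :: "real \<Rightarrow> sfun \<Rightarrow> sfun" is "\<lambda>r f m. fls_const r * f m" by simp

instance
proof
  fix r s :: real and f g :: sfun
  show "r *\<^sub>R (f + g) = r *\<^sub>R f + r *\<^sub>R g"
    by (rule sfun_eqI) (simp add: scaleR_sfun.rep_eq plus_sfun.rep_eq distrib_left)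
  show "(r + s) *\<^sub>R f = r *\<^sub>R f + s *\<^sub>R f"
    by (rule sfun_eqI)
      (simp only: scaleR_sfun.rep_eq plus_sfun.rep_eq fls_plus_const[symmetric] distrib_right)
  show "r *\<^sub>R s *\<^sub>R f = (r * s) *\<^sub>R f"
    by (rule sfun_eqI)
      (simp only: scaleR_sfun.rep_eq mult.assoc[symmetric] fls_const_mult_const)
  show "1 *\<^sub>R f = f"
    by (rule sfun_eqI) (simp add: scaleR_sfun.rep_eq)
  show "r *\<^sub>R f * g = r *\<^sub>R (f * g)"
    by (rule sfun_eqI, unfold scaleR_sfun.rep_eq times_sfun.rep_eq sum_distrib_left case_prod_beta)
      (intro sum.cong refl, simp only: mult_ac)
  show "f * r *\<^sub>R g = r *\<^sub>R (f * g)"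
    by (rule sfun_eqI, unfold scaleR_sfun.rep_eq times_sfun.rep_eq sum_distrib_left case_prod_beta)
      (intro sum.cong refl, simp only: mult_ac)
qed

end

lift_definition svar :: "fvar \<Rightarrow> sfun" is "\<lambda>v m. if m = {#v#} then 1 else 0"
  by (auto simp: admissible_def split: if_splits)

definition sconst :: "real fls \<Rightarrow> sfun" where
  "sconst c = Abs_sfun (\<lambda>m. if m = {#} then c else 0)"

lemma coeff_sconst: "coeff (sconst c) m = (if m = {#} then c else 0)"
  unfolding sconst_def by (subst Abs_sfun_inverse) (auto simp: admissible_def)

definition hbar :: sfun where "hbar = sconst fls_X"

definition hbar_inv :: sfun where "hbar_inv = sconst fls_X_inv"

text \<open>Left partial derivative: \<open>\<partial>\<^sub>v (v * f) = f + (-1)\<^bsup>|v|\<^esup> v * \<partial>\<^sub>v f\<close>.\<close>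

lift_definition deriv_at :: "fvar \<Rightarrow> sfun \<Rightarrow> sfun" is
  "\<lambda>v f m. of_int (mono_sign {#v#} m) * of_nat (Suc (count m v)) * f (add_mset v m)"
  using not_admissible_add_mset by simp

text \<open>The parity involution \<open>u \<mapsto> (-1)\<^bsup>|u|\<^esup> u\<close>.\<close>

lift_definition parity :: "sfun \<Rightarrow> sfun" is
  "\<lambda>f m. (-1) ^ size (filter_mset odd_var m) * f m" by simp

text \<open>Functions of the coordinates in \<open>V\<close>, over \<open>\<real>((\<hbar>))\<close> and over \<open>\<real>[[\<hbar>]]\<close>.\<close>

definition Fun :: "fvar set \<Rightarrow> sfun set" where
  "Fun V = {f. \<forall>m. coeff f m \<noteq> 0 \<longrightarrow> set_mset m \<subseteq> V}"

definition Fun_hbar :: "fvar set \<Rightarrow> sfun set" where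
  "Fun_hbar V = {f \<in> Fun V. \<forall>m. coeff f m \<in> range fps_to_fls}"

text \<open>
  The exponential series, converging coefficientwise in the \<open>\<hbar>\<close>-adic topology of \<open>\<real>((\<hbar>))\<close>.
\<close>

definition exp_term :: "sfun \<Rightarrow> fvar multiset \<Rightarrow> nat \<Rightarrow> real fls" where
  "exp_term u m n = coeff ((1 / fact n) *\<^sub>R u ^ n) m"

definition exp_sums :: "sfun \<Rightarrow> sfun \<Rightarrow> bool" where
  "exp_sums u z \<longleftrightarrow> (\<forall>m. exp_term u m sums coeff z m)"

lemma coeff_not_admissible: "\<not> admissible m \<Longrightarrow> coeff f m = 0"
  using coeff[of f] by simp

lift_definition sexp :: "sfun \<Rightarrow> sfun" is "\<lambda>u m. suminf (exp_term u m)"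
  by (simp add: exp_term_def[abs_def] coeff_not_admissible)

section \<open>Perturbative Gaussian integrals\<close>

text \<open>
  For \<open>Q = 1/2 \<Sum> q\<^sub>x\<^sub>y x y\<close>, even and quadratic in the coordinates \<open>V\<close>, let \<open>p\<close> be the inverse
  matrix of \<open>q\<close>.  The normalised perturbative integral over \<open>V\<close> is given by Wick's theorem,
    \<open>1/N \<integral> exp(Q/\<hbar>) P = [exp(- \<hbar>/2 \<Sum> p\<^sub>x\<^sub>y \<partial>\<^sub>y \<partial>\<^sub>x) P]\<close> at \<open>V = 0\<close>.
  Signs are those for which total derivatives integrate to zero:
    \<open>\<integral> \<partial>\<^sub>v (exp(Q/\<hbar>) P) = \<integral> exp(Q/\<hbar>) (\<partial>\<^sub>v P + 1/\<hbar> \<partial>\<^sub>v Q P) = 0\<close>, where \<open>\<partial>\<^sub>v Q = \<Sum> q\<^sub>v\<^sub>w w\<close>.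
  The measure cancels against the normalisation \<open>N\<close>.
\<close>

definition hessian :: "sfun \<Rightarrow> fvar \<Rightarrow> fvar \<Rightarrow> real fls" where
  "hessian Q v w = coeff (deriv_at w (deriv_at v Q)) {#}"

definition inverse_hessian :: "fvar set \<Rightarrow> sfun \<Rightarrow> fvar \<Rightarrow> fvar \<Rightarrow> real fls" where
  "inverse_hessian V Q = (THE p.
     (\<forall>u w. u \<notin> V \<or> w \<notin> V \<longrightarrow> p u w = 0) \<and>
     (\<forall>u\<in>V. \<forall>w\<in>V. (\<Sum>v\<in>V. p u v * hessian Q v w) = (if u = w then 1 else 0)))"

definition wick :: "fvar set \<Rightarrow> sfun \<Rightarrow> sfun \<Rightarrow> sfun" where
  "wick V Q P = (- 1 / 2) *\<^sub>R (hbar *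
     (\<Sum>x\<in>V. \<Sum>y\<in>V. sconst (inverse_hessian V Q x y) * deriv_at y (deriv_at x P)))"

lift_definition gauss_mean :: "fvar set \<Rightarrow> sfun \<Rightarrow> sfun \<Rightarrow> sfun" is
  "\<lambda>V Q P m. if set_mset m \<inter> V = {}
     then \<Sum>n. coeff ((1 / fact n) *\<^sub>R (wick V Q ^^ n) P) m else 0"
  by (simp add: coeff_not_admissible)

text \<open>\<open>(1/N) \<integral> exp(S/\<hbar>) O \<mu>\<close> with \<open>N = \<integral> exp(Q/\<hbar>) \<mu>\<close>, where \<open>Q\<close> is the quadratic part of \<open>S\<close>.\<close>

definition formal_integral :: "fvar set \<Rightarrow> sfun \<Rightarrow> sfun \<Rightarrow> sfun \<Rightarrow> sfun" where
  "formal_integral V Q S O' = gauss_mean V Q (sexp (hbar_inv * (S - Q)) * O')"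

section \<open>Algebraic data\<close>

record 'c dgfa =
  grade :: "nat \<Rightarrow> 'c set"
  diff :: "'c \<Rightarrow> 'c"
  prd :: "'c \<Rightarrow> 'c \<Rightarrow> 'c"
  unity :: 'c
  pairing :: "'c \<Rightarrow> 'c \<Rightarrow> real"

locale dg_frobenius_algebra =
  fixes A :: "'c::real_vector dgfa"
  assumes finite_dim: "\<exists>B. finite B \<and> span B = (UNIV :: 'c set)"
    and subspace_grade: "\<And>k. subspace (grade A k)"
    and grade_gt_3: "\<And>k. 3 < k \<Longrightarrow> grade A k = {0}"
    and direct_sum: "\<And>x. \<exists>!y. (\<forall>k. y k \<in> grade A k) \<and> x = (\<Sum>k\<le>3. y k)"
    and linear_diff: "linear (diff A)"
    and diff_grade: "\<And>k a. a \<in> grade A k \<Longrightarrow> diff A a \<in> grade A (Suc k)"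
    and diff_diff: "\<And>a. diff A (diff A a) = 0"
    and bilinear_prd: "bilinear (prd A)"
    and prd_grade: "\<And>j k a b. a \<in> grade A j \<Longrightarrow> b \<in> grade A k \<Longrightarrow> prd A a b \<in> grade A (j + k)"
    and prd_assoc: "\<And>a b c. prd A (prd A a b) c = prd A a (prd A b c)"
    and prd_comm: "\<And>j k a b. a \<in> grade A j \<Longrightarrow> b \<in> grade A k \<Longrightarrow>
        prd A a b = (-1) ^ (j * k) *\<^sub>R prd A b a"
    and unity_grade: "unity A \<in> grade A 0"
    and prd_unity: "\<And>a. prd A (unity A) a = a"
    and leibniz: "\<And>k a b. a \<in> grade A k \<Longrightarrow>
        diff A (prd A a b) = prd A (diff A a) b + (-1) ^ k *\<^sub>R prd A a (diff A b)"
    and bilinear_pairing: "bilinear (pairing A)"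
    and pairing_degree: "\<And>j k a b. a \<in> grade A j \<Longrightarrow> b \<in> grade A k \<Longrightarrow> pairing A a b \<noteq> 0 \<Longrightarrow>
        j + k = 3"
    and pairing_symm: "\<And>j k a b. a \<in> grade A j \<Longrightarrow> b \<in> grade A k \<Longrightarrow>
        pairing A a b = (-1) ^ (j * k) * pairing A b a"
    and pairing_nondegenerate: "\<And>a. (\<forall>b. pairing A a b = 0) \<Longrightarrow> a = 0"
    and pairing_diff: "\<And>k a b. a \<in> grade A k \<Longrightarrow>
        pairing A (diff A a) b + (-1) ^ k * pairing A a (diff A b) = 0"
    and pairing_prd: "\<And>a b c. pairing A a (prd A b c) = pairing A (prd A a b) c"

record 'g lie =
  bracket :: "'g \<Rightarrow> 'g \<Rightarrow> 'g"
  form :: "'g \<Rightarrow> 'g \<Rightarrow> real"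
  ldim :: nat
  lbasis :: "nat \<Rightarrow> 'g"

definition is_basis :: "nat \<Rightarrow> (nat \<Rightarrow> 'a::real_vector) \<Rightarrow> 'a set \<Rightarrow> bool" where
  "is_basis n e S \<longleftrightarrow> inj_on e {..<n} \<and> independent (e ` {..<n}) \<and> span (e ` {..<n}) = S"

locale quadratic_lie_algebra =
  fixes L :: "'g::real_vector lie"
  assumes bilinear_bracket: "bilinear (bracket L)"
    and bracket_self: "\<And>X. bracket L X X = 0"
    and jacobi: "\<And>X Y Z. bracket L X (bracket L Y Z) + bracket L Y (bracket L Z X)
        + bracket L Z (bracket L X Y) = 0"
    and bilinear_form: "bilinear (form L)"
    and form_symm: "\<And>X Y. form L X Y = form L Y X"
    and form_nondegenerate: "\<And>X. (\<forall>Y. form L X Y = 0) \<Longrightarrow> X = 0"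
    and form_invariant: "\<And>X Y Z. form L (bracket L X Y) Z = form L X (bracket L Y Z)"
    and lbasis: "is_basis (ldim L) (lbasis L) UNIV"
    and orthonormal: "\<And>a b. a < ldim L \<Longrightarrow> b < ldim L \<Longrightarrow>
        form L (lbasis L a) (lbasis L b) = (if a = b then 1 else 0)"

section \<open>Cohomology and induction data\<close>

text \<open>
  The cohomology is a vector space \<open>'h\<close> with a surjection \<open>cls\<close> from the cocycles
  whose kernel consists of the coboundaries; \<open>cls\<close> is irrelevant off the cocycles.
  \<open>hty\<close> is the chain homotopy \<open>K\<close>.
\<close>

record ('c, 'h) induction =
  cls :: "'c \<Rightarrow> 'h"
  iota :: "'h \<Rightarrow> 'c"
  hty :: "'c \<Rightarrow> 'c"

definition coh :: "'c dgfa \<Rightarrow> ('c::real_vector, 'h) induction \<Rightarrow> nat \<Rightarrow> 'h set" where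
  "coh A I k = cls I ` {a \<in> grade A k. diff A a = 0}"

definition pairing' :: "'c dgfa \<Rightarrow> ('c, 'h) induction \<Rightarrow> 'h \<Rightarrow> 'h \<Rightarrow> real" where
  "pairing' A I g h = pairing A (iota I g) (iota I h)"

definition iotaT :: "'c dgfa \<Rightarrow> ('c, 'h) induction \<Rightarrow> 'c \<Rightarrow> 'h" where
  "iotaT A I a = (THE h. \<forall>g. pairing' A I h g = pairing A a (iota I g))"

locale cohomology =
  fixes A :: "'c::real_vector dgfa" and I :: "('c, 'h::real_vector) induction"
  assumes cls_add: "\<And>a b. diff A a = 0 \<Longrightarrow> diff A b = 0 \<Longrightarrow> cls I (a + b) = cls I a + cls I b"
    and cls_scale: "\<And>r a. diff A a = 0 \<Longrightarrow> cls I (r *\<^sub>R a) = r *\<^sub>R cls I a"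
    and cls_surj: "cls I ` {a. diff A a = 0} = UNIV"
    and cls_eq_0: "\<And>a. diff A a = 0 \<Longrightarrow> cls I a = 0 \<longleftrightarrow> a \<in> range (diff A)"

locale induction_data = cohomology A I
  for A :: "'c::real_vector dgfa" and I :: "('c, 'h::real_vector) induction" +
  assumes linear_iota: "linear (iota I)"
    and iota_grade: "\<And>k h. h \<in> coh A I k \<Longrightarrow> iota I h \<in> grade A k"
    and diff_iota: "\<And>h. diff A (iota I h) = 0"
    and cls_iota: "\<And>h. cls I (iota I h) = h"
    and linear_hty: "linear (hty I)"
    and hty_grade_0: "\<And>a. a \<in> grade A 0 \<Longrightarrow> hty I a = 0"
    and hty_grade_Suc: "\<And>k a. a \<in> grade A (Suc k) \<Longrightarrow> hty I a \<in> grade A k"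
    and homotopy: "\<And>a. diff A (hty I a) + hty I (diff A a) = a - iota I (iotaT A I a)"
    and hty_symm: "\<And>k a b. a \<in> grade A k \<Longrightarrow>
        pairing A (hty I a) b = (-1) ^ k * pairing A a (hty I b)"
    and hty_iota: "\<And>h. hty I (iota I h) = 0"
    and hty_hty: "\<And>a. hty I (hty I a) = 0"

text \<open>
  The infinitesimal change \<open>\<iota> \<mapsto> \<iota> + d\<iota>\<close>, \<open>K \<mapsto> K + dK\<close> with parameters \<open>d\<kappa> = \<delta>\<kappa>\<close> and \<open>dI = \<delta>I\<close>,
  a sum of one change of each kind.
\<close>

locale induction_change =
  fixes A :: "'c::real_vector dgfa" and I :: "('c, 'h::real_vector) induction"
    and d\<iota> :: "'h \<Rightarrow> 'c" and dK :: "'c \<Rightarrow> 'c" and d\<kappa> :: "'c \<Rightarrow> 'c" and dI :: "'h \<Rightarrow> 'c"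
  assumes linear_d\<kappa>: "linear d\<kappa>"
    and d\<kappa>_grade_low: "\<And>k a. k < 2 \<Longrightarrow> a \<in> grade A k \<Longrightarrow> d\<kappa> a = 0"
    and d\<kappa>_grade: "\<And>k a. a \<in> grade A (k + 2) \<Longrightarrow> d\<kappa> a \<in> grade A k"
    and d\<kappa>_range: "\<And>a. d\<kappa> a \<in> range (hty I)"
    and d\<kappa>_iota: "\<And>h. d\<kappa> (iota I h) = 0"
    and d\<kappa>_hty: "\<And>a. d\<kappa> (hty I a) = 0"
    and d\<kappa>_symm: "\<And>a b. pairing A (d\<kappa> a) b = pairing A a (d\<kappa> b)"
    and linear_dI: "linear dI"
    and dI_grade_0: "\<And>h. h \<in> coh A I 0 \<Longrightarrow> dI h = 0"
    and dI_grade_Suc: "\<And>k h. h \<in> coh A I (Suc k) \<Longrightarrow> dI h \<in> grade A k"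
    and dI_range: "\<And>h. dI h \<in> range (hty I)"
    and d\<iota>_eq: "\<And>h. d\<iota> h = diff A (dI h)"
    and dK_eq: "\<exists>dIT. linear dIT \<and>
        (\<forall>k b c. b \<in> grade A k \<longrightarrow>
           pairing' A I (dIT b) c = - ((-1) ^ k) * pairing A b (dI c)) \<and>
        (\<forall>a. dK a = diff A (d\<kappa> a) - d\<kappa> (diff A a) + iota I (dIT a) - dI (iotaT A I a))"

text \<open>
  Bases: \<open>h1\<close>, \<open>h2\<close>, \<open>h3\<close> of \<open>H\<^sup>1\<close>, \<open>H\<^sup>2\<close>, \<open>H\<^sup>3\<close> (the basis of \<open>H\<^sup>0\<close> is \<open>[1]\<close>), and
  \<open>fK k j\<close>, \<open>j < nK k\<close>, of the degree \<open>k\<close> part of \<open>im K\<close>.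
\<close>

record ('c, 'h) frame =
  b1 :: nat
  h1 :: "nat \<Rightarrow> 'h"
  h2 :: "nat \<Rightarrow> 'h"
  h3 :: 'h
  nK :: "nat \<Rightarrow> nat"
  fK :: "nat \<Rightarrow> nat \<Rightarrow> 'c"

definition h0 :: "'c dgfa \<Rightarrow> ('c, 'h) induction \<Rightarrow> 'h" where
  "h0 A I = cls I (unity A)"

locale adapted_frame =
  fixes A :: "'c::real_vector dgfa" and I :: "('c, 'h::real_vector) induction"
    and E :: "('c, 'h) frame"
  assumes h1: "is_basis (b1 E) (h1 E) (coh A I 1)"
    and h2: "is_basis (b1 E) (h2 E) (coh A I 2)"
    and h1_h2: "\<And>i j. i < b1 E \<Longrightarrow> j < b1 E \<Longrightarrow>
        pairing' A I (h1 E i) (h2 E j) = (if i = j then 1 else 0)"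
    and h3: "h3 E \<in> coh A I 3"
    and h0_h3: "pairing' A I (h0 A I) (h3 E) = 1"
    and fK: "\<And>k. is_basis (nK E k) (fK E k) (range (hty I) \<inter> grade A k)"

section \<open>Fields and actions\<close>

definition vars1 :: "'g lie \<Rightarrow> ('c, 'h) frame \<Rightarrow> fvar set" where
  "vars1 L E = {A1 i a |i a. i < b1 E \<and> a < ldim L}"

definition varsF' :: "'g lie \<Rightarrow> ('c, 'h) frame \<Rightarrow> fvar set" where
  "varsF' L E = {A0 a |a. a < ldim L} \<union> vars1 L E \<union>
     {A2 i a |i a. i < b1 E \<and> a < ldim L} \<union> {A3 a |a. a < ldim L}"

definition varsK :: "'g lie \<Rightarrow> ('c, 'h) frame \<Rightarrow> fvar set" where
  "varsK L E = {Om k j a |k j a. k < 3 \<and> j < nK E k \<and> a < ldim L}"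

definition vars :: "'g lie \<Rightarrow> ('c, 'h) frame \<Rightarrow> fvar set" where
  "vars L E = varsF' L E \<union> varsK L E"

text \<open>
  A function \<open>\<phi> :: fvar \<Rightarrow> 'c\<close> stands for the superfield \<open>\<Sum>v. T\<^sub>c \<phi>(v) v\<close> with \<open>c = colour v\<close>,
  the coordinate \<open>v\<close> being written to the right.
\<close>

fun alpha :: "'c dgfa \<Rightarrow> ('c, 'h::zero) induction \<Rightarrow> ('c, 'h) frame \<Rightarrow> fvar \<Rightarrow> 'h" where
  "alpha A I E (A0 a) = h0 A I"
| "alpha A I E (A1 i a) = h1 E i"
| "alpha A I E (A2 i a) = h2 E i"
| "alpha A I E (A3 a) = h3 E"
| "alpha A I E (Om k j a) = 0"

fun omega'' :: "('c::zero, 'h) frame \<Rightarrow> fvar \<Rightarrow> 'c" where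
  "omega'' E (Om k j a) = fK E k j"
| "omega'' E (A0 a) = 0"
| "omega'' E (A1 i a) = 0"
| "omega'' E (A2 i a) = 0"
| "omega'' E (A3 a) = 0"

text \<open>Degree of a homogeneous element; its value for \<open>0\<close> and inhomogeneous elements is irrelevant.\<close>

definition degree_of :: "'c dgfa \<Rightarrow> 'c \<Rightarrow> int" where
  "degree_of A a = int (LEAST k. a \<in> grade A k)"

definition koszul :: "int \<Rightarrow> int \<Rightarrow> real" where
  "koszul p q = (if odd p \<and> odd q then - 1 else 1)"

text \<open>
  \<open>\<pi>(\<phi>, \<psi>)\<close> and \<open>\<pi>(\<phi>, l(\<psi>, \<theta>))\<close> for superfields: moving the coordinates to the right past
  elements of the algebra produces the Koszul signs.
\<close>

definition spair ::
    "'c dgfa \<Rightarrow> 'g lie \<Rightarrow> fvar set \<Rightarrow> (fvar \<Rightarrow> 'c) \<Rightarrow> (fvar \<Rightarrow> 'c) \<Rightarrow> sfun" where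
  "spair A L V \<phi> \<psi> = (\<Sum>v\<in>V. \<Sum>w\<in>V.
     (koszul (ghost v) (degree_of A (\<psi> w))
       * form L (lbasis L (colour v)) (lbasis L (colour w)) * pairing A (\<phi> v) (\<psi> w))
     *\<^sub>R (svar v * svar w))"

definition spair_l ::
    "'c dgfa \<Rightarrow> 'g lie \<Rightarrow> fvar set \<Rightarrow> (fvar \<Rightarrow> 'c) \<Rightarrow> (fvar \<Rightarrow> 'c) \<Rightarrow> (fvar \<Rightarrow> 'c) \<Rightarrow> sfun" where
  "spair_l A L V \<phi> \<psi> \<theta> = (\<Sum>u\<in>V. \<Sum>v\<in>V. \<Sum>w\<in>V.
     (koszul (ghost v) (degree_of A (\<theta> w))
       * koszul (ghost u) (degree_of A (\<psi> v) + degree_of A (\<theta> w))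
       * form L (lbasis L (colour u)) (bracket L (lbasis L (colour v)) (lbasis L (colour w)))
       * pairing A (\<phi> u) (prd A (\<psi> v) (\<theta> w)))
     *\<^sub>R (svar u * svar v * svar w))"

definition action :: "'c dgfa \<Rightarrow> 'g lie \<Rightarrow> fvar set \<Rightarrow> (fvar \<Rightarrow> 'c) \<Rightarrow> sfun" where
  "action A L V \<phi> = (1 / 2) *\<^sub>R spair A L V \<phi> (diff A \<circ> \<phi>) + (1 / 6) *\<^sub>R spair_l A L V \<phi> \<phi> \<phi>"

definition free_action :: "'c::zero dgfa \<Rightarrow> 'g lie \<Rightarrow> ('c, 'h) frame \<Rightarrow> sfun" where
  "free_action A L E = (1 / 2) *\<^sub>R spair A L (vars L E) (omega'' E) (diff A \<circ> omega'' E)"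

text \<open>\<open>(1/N) \<integral> exp(S(\<iota>(\<alpha>) + \<omega>'')/\<hbar>) O \<mu>\<close> over \<open>\<L>\<^sub>K\<close>.\<close>

definition fibre_integral ::
    "'c::real_vector dgfa \<Rightarrow> 'g lie \<Rightarrow> ('c, 'h::zero) induction \<Rightarrow> ('c, 'h) frame \<Rightarrow> sfun \<Rightarrow> sfun" where
  "fibre_integral A L I E O' = formal_integral (varsK L E) (free_action A L E)
     (action A L (vars L E) (\<lambda>v. iota I (alpha A I E v) + omega'' E v)) O'"

text \<open>
  \<open>exp(W/\<hbar>)\<close> is required to converge \<open>\<hbar>\<close>-adically, which fixes the constant term of \<open>W\<close>
  to be divisible by \<open>\<hbar>\<^sup>2\<close>.
\<close>

definition effective_action ::
    "'c::real_vector dgfa \<Rightarrow> 'g lie \<Rightarrow> ('c, 'h::zero) induction \<Rightarrow> ('c, 'h) frame \<Rightarrow> sfun \<Rightarrow> bool" where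
  "effective_action A L I E W \<longleftrightarrow> W \<in> Fun_hbar (varsF' L E) \<and>
     exp_sums (hbar_inv * W) (fibre_integral A L I E 1)"

definition generator ::
    "'c::real_vector dgfa \<Rightarrow> 'g lie \<Rightarrow> ('c, 'h::zero) induction \<Rightarrow> ('c, 'h) frame \<Rightarrow>
     ('c \<Rightarrow> 'c) \<Rightarrow> ('h \<Rightarrow> 'c) \<Rightarrow> sfun \<Rightarrow> sfun" where
  "generator A L I E d\<kappa> dI W = sexp (- (hbar_inv * W)) * fibre_integral A L I E
     ((1 / 2) *\<^sub>R spair A L (vars L E) (omega'' E) (diff A \<circ> d\<kappa> \<circ> diff A \<circ> omega'' E)
      + spair A L (vars L E) (omega'' E) (diff A \<circ> dI \<circ> alpha A I E))"

definition W_prod ::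
    "'c::real_vector dgfa \<Rightarrow> 'g lie \<Rightarrow> ('c, 'h::zero) induction \<Rightarrow> ('c, 'h) frame \<Rightarrow> sfun" where
  "W_prod A L I E = (1 / 6) *\<^sub>R spair_l A L (varsF' L E)
     (iota I \<circ> alpha A I E) (iota I \<circ> alpha A I E) (iota I \<circ> alpha A I E)"

definition W_prod_111 ::
    "'c dgfa \<Rightarrow> 'g lie \<Rightarrow> ('c, 'h) induction \<Rightarrow> ('c, 'h) frame \<Rightarrow> sfun" where
  "W_prod_111 A L I E = (1 / 6) *\<^sub>R (\<Sum>i<b1 E. \<Sum>j<b1 E. \<Sum>k<b1 E.
     \<Sum>a<ldim L. \<Sum>b<ldim L. \<Sum>c<ldim L.
     (pairing A (iota I (h1 E i)) (prd A (iota I (h1 E j)) (iota I (h1 E k)))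
       * form L (lbasis L a) (bracket L (lbasis L b) (lbasis L c)))
     *\<^sub>R (svar (A1 i a) * svar (A1 j b) * svar (A1 k c)))"

section \<open>BV structure and vector fields\<close>

definition BV_laplacian :: "'g lie \<Rightarrow> ('c, 'h) frame \<Rightarrow> sfun \<Rightarrow> sfun" where
  "BV_laplacian L E f = (\<Sum>a<ldim L. deriv_at (A0 a) (deriv_at (A3 a) f))
     + (\<Sum>a<ldim L. \<Sum>i<b1 E. deriv_at (A1 i a) (deriv_at (A2 i a) f))"

text \<open>
  \<open>(-1)\<^bsup>|u|\<^esup> {u, w}' = \<Delta>'(u w) - (\<Delta>' u) w - (-1)\<^bsup>|u|\<^esup> u \<Delta>' w\<close>, extended linearly to all \<open>u\<close>.
\<close>

definition antibracket :: "'g lie \<Rightarrow> ('c, 'h) frame \<Rightarrow> sfun \<Rightarrow> sfun \<Rightarrow> sfun" where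
  "antibracket L E u w = BV_laplacian L E (parity u * w)
     - BV_laplacian L E (parity u) * w - u * BV_laplacian L E w"

text \<open>A vector field \<open>G\<close> on \<open>\<gg>\<^bsup>B\<^sub>1\<^esup>\<close> has components \<open>G i a\<close> along \<open>\<partial>/\<partial>\<alpha>\<^sub>(\<^sub>1\<^sub>)\<^sup>i\<^sup>a\<close>.\<close>

definition vf_apply :: "'g lie \<Rightarrow> ('c, 'h) frame \<Rightarrow> (nat \<Rightarrow> nat \<Rightarrow> sfun) \<Rightarrow> sfun \<Rightarrow> sfun" where
  "vf_apply L E G f = (\<Sum>i<b1 E. \<Sum>a<ldim L. G i a * deriv_at (A1 i a) f)"

definition vf_div :: "'g lie \<Rightarrow> ('c, 'h) frame \<Rightarrow> (nat \<Rightarrow> nat \<Rightarrow> sfun) \<Rightarrow> sfun" where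
  "vf_div L E G = (\<Sum>i<b1 E. \<Sum>a<ldim L. deriv_at (A1 i a) (G i a))"

text \<open>Components of \<open>[X, Y]\<close> for \<open>Y = \<Sum>a. T\<^sub>a Y\<^sup>a\<close>.\<close>

definition ad :: "'g lie \<Rightarrow> 'g \<Rightarrow> (nat \<Rightarrow> sfun) \<Rightarrow> nat \<Rightarrow> sfun" where
  "ad L X Y a = (\<Sum>c<ldim L. form L (lbasis L a) (bracket L X (lbasis L c)) *\<^sub>R Y c)"

text \<open>
  \<open>f(\<alpha>\<^sub>(\<^sub>1\<^sub>) + \<epsilon>)\<close> modulo terms quadratic in \<open>\<epsilon>\<close>, for \<open>f\<close> a function of the even coordinates
  \<open>\<alpha>\<^sub>(\<^sub>1\<^sub>)\<close>, i.e. the Taylor expansion truncated after the linear term.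
\<close>

definition shift1 :: "'g lie \<Rightarrow> ('c, 'h) frame \<Rightarrow> (nat \<Rightarrow> nat \<Rightarrow> sfun) \<Rightarrow> sfun \<Rightarrow> sfun" where
  "shift1 L E \<epsilon> f = f + (\<Sum>j<b1 E. \<Sum>b<ldim L. \<epsilon> j b * deriv_at (A1 j b) f)"

definition equivariant_vf :: "'g lie \<Rightarrow> ('c, 'h) frame \<Rightarrow> (nat \<Rightarrow> nat \<Rightarrow> sfun) \<Rightarrow> bool" where
  "equivariant_vf L E G \<longleftrightarrow> (\<forall>X. \<forall>i<b1 E. \<forall>a<ldim L.
     shift1 L E (\<lambda>j. ad L X (\<lambda>b. svar (A1 j b))) (G i a) = G i a + ad L X (G i) a)"

end

theory Submission
  imports Defs
begin

text \<open>
  The interaction \<open>U\<close>, i.e. the action minus its quadratic part, splits as \<open>U\<^sub>0 + U\<^sub>1\<close>, where \<open>U\<^sub>0\<close>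
  collects the terms containing \<open>\<alpha>\<^sub>(\<^sub>0\<^sub>)\<close>.  Since \<open>\<alpha>\<^sub>(\<^sub>0\<^sub>)\<close> multiplies the unit and \<open>im K\<close> is orthogonal to
  \<open>im K \<oplus> im \<iota>\<close>, \<open>U\<^sub>0\<close> does not involve \<open>\<omega>''\<close> and \<open>e\<^bsup>U\<^sub>0/\<hbar>\<^esup>\<close> comes out of the fibre integrals.  What
  remains does not involve \<open>\<alpha>\<^sub>(\<^sub>0\<^sub>)\<close>, so its ghost number (0 for \<open>W - U\<^sub>0\<close>, -1 for \<open>R'\<close>) leaves only
  functions of \<open>\<alpha>\<^sub>(\<^sub>1\<^sub>)\<close>, respectively \<open>\<alpha>\<^sub>(\<^sub>2\<^sub>)\<close> times such functions.  Instead of an expansion into connected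
  graphs, the Schwinger--Dyson equation shows that \<open>R'\<close>, a normalised mean of a quadratic function,
  has no negative powers of \<open>\<hbar>\<close>.  Infinitesimal rotations of the colour indices preserve the
  interaction, the observable and the propagator, hence \<open>R'\<close>; this is the equivariance of \<open>G\<close>.  The
  terms of \<open>{W, R'}'\<close> which contain \<open>\<alpha>\<^sub>(\<^sub>0\<^sub>)\<close> assemble into the rotation of \<open>R'\<close> by \<open>\<alpha>\<^sub>(\<^sub>0\<^sub>)\<close> and vanish.
\<close>

section \<open>Convergence of formal Laurent series\<close>

unbundle fps_syntax

text \<open>Ghost numbers fix the shape of \<open>W\<close> and \<open>R'\<close> because
  \<open>A0\<close> is the only external coordinate of positive ghost number: without it, ghost
  number 0 allows only \<open>A1\<close>, and -1 forces exactly one \<open>A2\<close>. The obstacle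
  is analytic. The fibre integrals live over the field of Laurent series in \<hbar>, with no common
  bound on the negative powers, and \<open>W\<close> is known only through its exponential. Support
  statements are therefore proved for exponentials and brought down to the exponent by induction on
  monomials. \<open>R'\<close> is a quotient of two series with poles, and the cancellation of the
  poles is not visible term by term. In the Schwinger-Dyson equation, however, the \<hbar> of the
  propagator absorbs the 1/\<hbar> that comes from differentiating the exponential. Normalised means
  of real polynomials thus obey a recursion free of negative powers. This recursion lowers degrees
  and raises weights, but need not stop; it is run up to an arbitrary weight \<open>N\<close>, and
  integrality follows by letting \<open>N\<close> vary.\<close>

definition fls_ge :: "int \<Rightarrow> real fls \<Rightarrow> bool" where
  "fls_ge N x \<longleftrightarrow> (\<forall>k<N. x $$ k = 0)"

lemma fls_ge_0 [simp]: "fls_ge N 0"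
  by (simp add: fls_ge_def)

lemma fls_ge_mono: "fls_ge N x \<Longrightarrow> M \<le> N \<Longrightarrow> fls_ge M x"
  by (auto simp: fls_ge_def)

lemma fls_ge_add: "fls_ge N x \<Longrightarrow> fls_ge N y \<Longrightarrow> fls_ge N (x + y)"
  by (auto simp: fls_ge_def)

lemma fls_ge_diff: "fls_ge N x \<Longrightarrow> fls_ge N y \<Longrightarrow> fls_ge N (x - y)"
  by (auto simp: fls_ge_def)

lemma fls_ge_sum: "(\<And>i. i \<in> S \<Longrightarrow> fls_ge N (x i)) \<Longrightarrow> fls_ge N (sum x S)"
  by (induction S rule: infinite_finite_induct) (auto intro: fls_ge_add)

lemma fls_ge_subdegree: "fls_ge (fls_subdegree x) x"
  by (auto simp: fls_ge_def)

lemma fls_ge_iff: "fls_ge N x \<longleftrightarrow> x = 0 \<or> N \<le> fls_subdegree x"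
  by (auto simp: fls_ge_def intro: fls_subdegree_geI)

lemma fls_ge_mult: "fls_ge M x \<Longrightarrow> fls_ge N y \<Longrightarrow> fls_ge (M + N) (x * y)"
  by (cases "x * y = 0") (auto simp: fls_ge_iff)

lemma fls_ge_const: "fls_ge 0 (fls_const c)"
  by (auto simp: fls_ge_def)

lemma fls_ge_X: "fls_ge 1 fls_X"
  by (auto simp: fls_ge_def)

lemma fls_ge_X_inv: "fls_ge (- 1) fls_X_inv"
  by (auto simp: fls_ge_def)

lemma fls_ge_0_iff: "fls_ge 0 x \<longleftrightarrow> x \<in> range fps_to_fls"
proof
  assume "fls_ge 0 x"
  then have "x = fps_to_fls (fls_regpart x)"
    by (intro fls_eqI) (auto simp: fls_ge_def)
  then show "x \<in> range fps_to_fls" by blast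
next
  assume "x \<in> range fps_to_fls"
  then show "fls_ge 0 x" by (auto simp: fls_ge_def)
qed

lemma fls_ge_of_int: "fls_ge 0 (of_int n)"
  by (simp add: fls_ge_def fls_of_int)

lemma fls_ge_of_nat: "fls_ge 0 (of_nat n)"
  by (simp add: fls_ge_def fls_of_nat)

text \<open>For nonnegative subdegree of the difference, the distance of distinct series is 2 to the
  power of minus that subdegree, so the strict inequality gains one order. For negative subdegree
  the distance is at least 1 and both sides fail.\<close>

lemma fls_dist_less_iff: "dist x y < inverse (2 ^ N) \<longleftrightarrow> fls_ge (int N + 1) (x - y)" for x y :: "real fls"
proof (cases "x = y")
  case False
  show ?thesis
  proof (cases "fls_subdegree (x - y) \<ge> 0")
    case True
    then show ?thesis using False
      by (auto simp: dist_fls_def fls_ge_iff nat_less_iff zless_nat_eq_int_zless)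
  next
    case F2: False
    have "1 \<le> (2::real) ^ nat (- fls_subdegree (x - y))" by simp
    moreover have "inverse (2 ^ N) \<le> (1::real)" by (simp add: inverse_le_1_iff)
    ultimately show ?thesis using False F2
      by (auto simp: dist_fls_def fls_ge_iff simp del: one_le_power)
  qed
qed simp

lemma fls_tendsto_iff:
  fixes x :: "nat \<Rightarrow> real fls"
  shows "x \<longlonglongrightarrow> s \<longleftrightarrow> (\<forall>N. \<forall>\<^sub>F n in sequentially. fls_ge N (x n - s))"
proof
  assume lim: "x \<longlonglongrightarrow> s"
  show "\<forall>N. \<forall>\<^sub>F n in sequentially. fls_ge N (x n - s)"
  proof
    fix N :: int
    have "\<forall>\<^sub>F n in sequentially. dist (x n) s < inverse (2 ^ nat N)"
      using lim by (auto simp: tendsto_iff)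
    then show "\<forall>\<^sub>F n in sequentially. fls_ge N (x n - s)"
      by (rule eventually_mono) (auto simp: fls_dist_less_iff intro: fls_ge_mono)
  qed
next
  assume *: "\<forall>N. \<forall>\<^sub>F n in sequentially. fls_ge N (x n - s)"
  show "x \<longlonglongrightarrow> s"
  proof (rule tendstoI)
    fix e :: real
    assume "0 < e"
    then obtain N where N: "inverse (2 ^ N) < e"
      using real_arch_pow_inv[of e "1/2"] by (auto simp: power_one_over inverse_eq_divide)
    have "\<forall>\<^sub>F n in sequentially. fls_ge (int N + 1) (x n - s)" using * by blast
    then show "\<forall>\<^sub>F n in sequentially. dist (x n) s < e"
      by (rule eventually_mono) (use N in \<open>auto simp flip: fls_dist_less_iff\<close>)
  qed
qed

definition fls_null :: "(nat \<Rightarrow> real fls) \<Rightarrow> bool" where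
  "fls_null x \<longleftrightarrow> (\<forall>N. \<exists>n0. \<forall>n\<ge>n0. fls_ge N (x n))"

lemma fls_sums_iff:
  fixes x :: "nat \<Rightarrow> real fls"
  shows "x sums s \<longleftrightarrow> (\<forall>N. \<exists>n0. \<forall>n\<ge>n0. fls_ge N ((\<Sum>i<n. x i) - s))"
  by (simp add: sums_def fls_tendsto_iff eventually_sequentially)

lemma fls_sums_imp_null:
  assumes "x sums s"
  shows "fls_null x"
  unfolding fls_null_def
proof
  fix N
  obtain n0 where "\<forall>n\<ge>n0. fls_ge N ((\<Sum>i<n. x i) - s)" using assms by (auto simp: fls_sums_iff)
  then have "fls_ge N (((\<Sum>i<Suc n. x i) - s) - ((\<Sum>i<n. x i) - s))" if "n \<ge> n0" for n
    using that by (intro fls_ge_diff[of N "_ - s" "_ - s"]) (metis le_SucI, metis)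
  then show "\<exists>n0. \<forall>n\<ge>n0. fls_ge N (x n)" by (auto intro!: exI[of _ n0])
qed

text \<open>In the complete ultrametric \<hbar>-adic topology null terms suffice: each coefficient
  of the partial sums is eventually constant, and the limit collects these constants.\<close>

lemma fls_null_sums:
  assumes "fls_null x"
  obtains s where "x sums s"
proof -
  from assms obtain n0 where n0: "\<And>N n. n \<ge> n0 N \<Longrightarrow> fls_ge N (x n)"
    unfolding fls_null_def by metis
  define p where "p n = (\<Sum>i<n. x i)" for n
  have stable: "fls_ge N (p n - p m)" if "m \<ge> n0 N" "n \<ge> m" for N n m
  proof -
    have "p n - p m = sum x {m..<n}"
      unfolding p_def using that(2) by (simp add: lessThan_atLeast0 sum_diff_nat_ivl)
    then show ?thesis using n0 that by (auto intro!: fls_ge_sum)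
  qed
  \<comment> \<open>From \<open>n0 (k + 1)\<close> on, coefficient \<open>k\<close> no longer
    changes. The maximum with \<open>n0 0\<close> keeps the chosen partial sums where
    \<open>N0\<close> bounds them from below, as \<open>Abs_fls\<close> requires.\<close>
  define m0 where "m0 k = max (n0 0) (n0 (k + 1))" for k
  define N0 where "N0 = min 0 (fls_subdegree (p (n0 0)))"
  have below: "fls_ge N0 (p n)" if "n \<ge> n0 0" for n
  proof -
    have "fls_ge N0 (p n - p (n0 0) + p (n0 0))"
      by (intro fls_ge_add fls_ge_mono[OF stable[of 0]] fls_ge_mono[OF fls_ge_subdegree])
         (use that in \<open>auto simp: N0_def\<close>)
    then show ?thesis by simp
  qed
  define s where "s = Abs_fls (\<lambda>k. p (m0 k) $$ k)"
  have "\<forall>\<^sub>\<infinity>n. p (m0 (- int n)) $$ (- int n) = 0"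
    unfolding MOST_nat
    using below by (intro exI[of _ "nat (- N0)"]) (auto simp: fls_ge_def m0_def)
  then have s: "s $$ k = p (m0 k) $$ k" for k
    unfolding s_def by (subst nth_Abs_fls) auto
  \<comment> \<open>Below \<open>N0\<close> both series vanish, so only the finitely many degrees
    from \<open>N0\<close> to \<open>N\<close> must have stabilised.\<close>
  have "fls_ge N (p n - s)" if n: "n \<ge> Max ((\<lambda>k. m0 k) ` {N0..N})" "n \<ge> n0 0" for N n
    unfolding fls_ge_def
  proof (intro allI impI)
    fix k assume "k < N"
    show "(p n - s) $$ k = 0"
    proof (cases "k < N0")
      case True
      then show ?thesis using below n(2) by (auto simp: s fls_ge_def m0_def)
    next
      case False
      then have "m0 k \<le> n" using n(1) \<open>k < N\<close> by (subst (asm) Max_le_iff) auto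
      then have "fls_ge (k + 1) (p n - p (m0 k))" by (intro stable) (auto simp: m0_def)
      then show ?thesis by (auto simp: s fls_ge_def)
    qed
  qed
  then have "x sums s"
    unfolding fls_sums_iff p_def
    by (intro allI, rule_tac x = "max (Max (m0 ` {N0..N})) (n0 0)" in exI) auto
  then show ?thesis by (rule that)
qed

lemma fls_null_imp_suminf: "fls_null x \<Longrightarrow> x sums suminf x"
  by (metis fls_null_sums sums_iff)

lemma fls_sums_add:
  fixes x y :: "nat \<Rightarrow> real fls"
  assumes "x sums s" "y sums t"
  shows "(\<lambda>n. x n + y n) sums (s + t)"
  unfolding fls_sums_iff
proof
  fix N
  obtain m n where "\<And>i. i \<ge> m \<Longrightarrow> fls_ge N ((\<Sum>i<i. x i) - s)" "\<And>i. i \<ge> n \<Longrightarrow> fls_ge N ((\<Sum>i<i. y i) - t)"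
    using assms unfolding fls_sums_iff by metis
  then have "fls_ge N (((\<Sum>i<k. x i) - s) + ((\<Sum>i<k. y i) - t))" if "k \<ge> max m n" for k
    using that by (intro fls_ge_add) auto
  moreover have "((\<Sum>i<k. x i) - s) + ((\<Sum>i<k. y i) - t) = (\<Sum>i<k. x i + y i) - (s + t)" for k
    by (simp add: sum.distrib)
  ultimately show "\<exists>n0. \<forall>n\<ge>n0. fls_ge N ((\<Sum>i<n. x i + y i) - (s + t))"
    by metis
qed

lemma fls_sums_mult:
  fixes x :: "nat \<Rightarrow> real fls"
  assumes "x sums s"
  shows "(\<lambda>n. c * x n) sums (c * s)"
  unfolding fls_sums_iff
proof
  fix N
  obtain m where m: "\<And>i. i \<ge> m \<Longrightarrow> fls_ge (N - fls_subdegree c) ((\<Sum>i<i. x i) - s)"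
    using assms unfolding fls_sums_iff by metis
  have "fls_ge N (c * ((\<Sum>i<i. x i) - s))" if "i \<ge> m" for i
    using fls_ge_mult[OF fls_ge_subdegree[of c] m[OF that]] by simp
  then show "\<exists>n0. \<forall>n\<ge>n0. fls_ge N ((\<Sum>i<n. c * x i) - c * s)"
    by (auto simp: sum_distrib_left right_diff_distrib)
qed

lemma fls_sums_sum:
  fixes x :: "'i \<Rightarrow> nat \<Rightarrow> real fls"
  assumes "\<And>i. i \<in> S \<Longrightarrow> x i sums s i"
  shows "(\<lambda>n. \<Sum>i\<in>S. x i n) sums (\<Sum>i\<in>S. s i)"
  using assms by (induction S rule: infinite_finite_induct) (auto intro: fls_sums_add)

lemma fls_ge_sums:
  assumes "x sums s" "\<And>n. fls_ge N (x n)"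
  shows "fls_ge N s"
proof -
  obtain n0 where "\<forall>n\<ge>n0. fls_ge N ((\<Sum>i<n. x i) - s)" using assms(1) unfolding fls_sums_iff by metis
  then have "fls_ge N ((\<Sum>i<n0. x i) - s)" by simp
  then have "fls_ge N ((\<Sum>i<n0. x i) - ((\<Sum>i<n0. x i) - s))"
    using assms(2) by (intro fls_ge_diff[of N _ "_ - s"] fls_ge_sum) auto
  then show ?thesis by simp
qed

lemma fls_null_bounded:
  assumes "fls_null x"
  obtains B where "B \<le> 0" "\<And>n. fls_ge B (x n)"
proof -
  obtain n0 where n0: "\<And>n. n \<ge> n0 \<Longrightarrow> fls_ge 0 (x n)" using assms unfolding fls_null_def by metis
  define B where "B = Min (insert 0 ((\<lambda>n. fls_subdegree (x n)) ` {..<n0}))"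
  have "B \<le> 0" unfolding B_def by (rule Min_le) auto
  moreover have "fls_ge B (x n)" for n
  proof (cases "n \<ge> n0")
    case True
    then show ?thesis using n0 \<open>B \<le> 0\<close> fls_ge_mono by blast
  next
    case False
    then have "B \<le> fls_subdegree (x n)" unfolding B_def by (intro Min_le) auto
    then show ?thesis using fls_ge_mono fls_ge_subdegree by blast
  qed
  ultimately show ?thesis using that by blast
qed

text \<open>No absolute convergence is needed. A pair in the square but outside the triangle has a
  large \<open>i\<close> or a large \<open>j\<close>; there one factor has high order, while the
  order of the other is at least \<open>C\<close> or \<open>B\<close>. The shifts
  \<open>N - C\<close> and \<open>N - B\<close> compensate for this.\<close>

lemma fls_sums_Cauchy_product:
  fixes x y :: "nat \<Rightarrow> real fls"
  assumes "x sums s" "y sums t"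
  shows "(\<lambda>n. \<Sum>i\<le>n. x i * y (n - i)) sums (s * t)"
  unfolding fls_sums_iff
proof
  fix N :: int
  obtain B where B: "B \<le> 0" "\<And>n. fls_ge B (x n)"
    using fls_null_bounded[OF fls_sums_imp_null[OF assms(1)]] by metis
  obtain C where C: "C \<le> 0" "\<And>n. fls_ge C (y n)"
    using fls_null_bounded[OF fls_sums_imp_null[OF assms(2)]] by metis
  let ?X = "\<lambda>n. \<Sum>i<n. x i" and ?Y = "\<lambda>n. \<Sum>i<n. y i"
  obtain n1 where n1: "\<And>n. n \<ge> n1 \<Longrightarrow> fls_ge (N - C) (x n)"
    using fls_sums_imp_null[OF assms(1)] unfolding fls_null_def by metis
  obtain n2 where n2: "\<And>n. n \<ge> n2 \<Longrightarrow> fls_ge (N - B) (y n)"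
    using fls_sums_imp_null[OF assms(2)] unfolding fls_null_def by metis
  obtain n3 where n3: "\<And>n. n \<ge> n3 \<Longrightarrow> fls_ge (N - C) (?X n - s)"
    using assms(1) unfolding fls_sums_iff by metis
  obtain n4 where n4: "\<And>n. n \<ge> n4 \<Longrightarrow> fls_ge (N - B) (?Y n - t)"
    using assms(2) unfolding fls_sums_iff by metis
  have X: "fls_ge B s" by (rule fls_ge_sums[OF assms(1) B(2)])
  have "fls_ge N ((\<Sum>n<n. \<Sum>i\<le>n. x i * y (n - i)) - s * t)" if n: "n \<ge> n1 + n2 + n3 + n4" for n
  proof -
    let ?T = "{(i, j). i + j < n}"
    have fin: "finite ?T" by (rule finite_subset[of _ "{..<n} \<times> {..<n}"]) auto
    have 1: "(\<Sum>n<n. \<Sum>i\<le>n. x i * y (n - i)) = (\<Sum>(i, j)\<in>?T. x i * y j)"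
      by (rule sum.triangle_reindex[symmetric])
    have 2: "?X n * ?Y n = (\<Sum>(i, j)\<in>{..<n} \<times> {..<n}. x i * y j)"
      by (simp add: sum_product sum.cartesian_product)
    have 3: "(\<Sum>(i, j)\<in>{..<n} \<times> {..<n}. x i * y j)
      = (\<Sum>(i, j)\<in>({..<n} \<times> {..<n} - ?T). x i * y j) + (\<Sum>(i, j)\<in>?T. x i * y j)"
      by (rule sum.subset_diff) auto
    have "fls_ge N (x i * y j)" if "(i, j) \<in> {..<n} \<times> {..<n} - ?T" for i j
    proof (cases "i \<ge> n1")
      case True
      then show ?thesis using fls_ge_mult[OF n1 C(2), of i j] by simp
    next
      case False
      then have "j \<ge> n2" using that n by auto
      then show ?thesis using fls_ge_mult[OF B(2) n2, of j i] by (simp add: add.commute)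
    qed
    then have 4: "fls_ge N (\<Sum>(i, j)\<in>({..<n} \<times> {..<n} - ?T). x i * y j)"
      by (auto intro!: fls_ge_sum)
    have 5: "fls_ge N ((?X n - s) * ?Y n)"
      using fls_ge_mult[OF n3[of n] fls_ge_sum[of "{..<n}", OF C(2)]] n by simp
    have 6: "fls_ge N (s * (?Y n - t))"
      using fls_ge_mult[OF X n4[of n]] n by simp
    have "(\<Sum>n<n. \<Sum>i\<le>n. x i * y (n - i)) - s * t =
      (?X n - s) * ?Y n + s * (?Y n - t) - (\<Sum>(i, j)\<in>({..<n} \<times> {..<n} - ?T). x i * y j)"
      using 1 2 3 by (simp add: algebra_simps)
    then show ?thesis using 4 5 6 by (simp add: fls_ge_add fls_ge_diff)
  qed
  then show "\<exists>n0. \<forall>n\<ge>n0. fls_ge N ((\<Sum>n<n. \<Sum>i\<le>n. x i * y (n - i)) - s * t)"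
    by blast
qed

unbundle no fps_syntax

section \<open>Graded commutative power series\<close>

lemma coeff_0 [simp]: "coeff 0 m = 0" by (simp add: zero_sfun.rep_eq)
lemma coeff_add [simp]: "coeff (f + g) m = coeff f m + coeff g m" by (simp add: plus_sfun.rep_eq)
lemma coeff_diff [simp]: "coeff (f - g) m = coeff f m - coeff g m" by (simp add: minus_sfun.rep_eq)
lemma coeff_uminus [simp]: "coeff (- f) m = - coeff f m" by (simp add: uminus_sfun.rep_eq)
lemma coeff_scaleR [simp]: "coeff (r *\<^sub>R f) m = fls_const r * coeff f m" by (simp add: scaleR_sfun.rep_eq)
lemma coeff_sum [simp]: "coeff (sum f S) m = (\<Sum>i\<in>S. coeff (f i) m)"
  by (induction S rule: infinite_finite_induct) auto
lemma coeff_1: "coeff 1 m = (if m = {#} then 1 else 0)" by (simp add: one_sfun.rep_eq)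
lemma coeff_svar: "coeff (svar v) m = (if m = {#v#} then 1 else 0)" by (simp add: svar.rep_eq)

definition splits :: "'a multiset \<Rightarrow> ('a multiset \<times> 'a multiset) set" where
  "splits m = {(a, b). a + b = m}"

lemma finite_splits [simp]: "finite (splits m)"
  unfolding splits_def by (rule finite_msplit)

lemma in_splits [simp]: "(a, b) \<in> splits m \<longleftrightarrow> a + b = m"
  by (simp add: splits_def)

lemma coeff_mult:
  "coeff (f * g) m = (\<Sum>(a, b)\<in>splits m. of_int (mono_sign a b) * coeff f a * coeff g b)"
  by (simp add: times_sfun.rep_eq splits_def)

lemma splits_empty [simp]: "splits {#} = {({#}, {#})}"
  by (auto simp: splits_def)

lemma coeff_mult_empty: "coeff (f * g) {#} = coeff f {#} * coeff g {#}"
  by (simp add: coeff_mult)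

text \<open>Removing one \<open>v\<close> from the left part is a bijection from the splittings with
  \<open>v\<close> on the left to the splittings of \<open>m\<close>. In the Leibniz rule the factor
  \<open>count a v\<close> kills all other splittings.\<close>

lemma sum_splits_left:
  assumes "\<And>a b. a + b = add_mset v m \<Longrightarrow> v \<notin># a \<Longrightarrow> h a b = 0"
  shows "(\<Sum>(a, b)\<in>splits (add_mset v m). h a b) = (\<Sum>(a, b)\<in>splits m. h (add_mset v a) b)"
proof -
  have "(\<Sum>(a, b)\<in>splits (add_mset v m). h a b) = (\<Sum>(a, b)\<in>{(a, b)\<in>splits (add_mset v m). v \<in># a}. h a b)"
    by (rule sum.mono_neutral_right) (use assms in fastforce)+
  also have "\<dots> = (\<Sum>(a, b)\<in>splits m. h (add_mset v a) b)"
    by (rule sum.reindex_bij_witness[where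
          i = "\<lambda>(a, b). (add_mset v a, b)" and j = "\<lambda>(a, b). (a - {#v#}, b)"])
       (auto dest!: multi_member_split)
  finally show ?thesis .
qed

lemma sum_splits_swap: "(\<Sum>(a, b)\<in>splits m. h a b) = (\<Sum>(a, b)\<in>splits m. h b a)"
  by (rule sum.reindex_bij_witness[where i = prod.swap and j = prod.swap]) (auto simp: add.commute)

lemma sum_splits_right:
  assumes "\<And>a b. a + b = add_mset v m \<Longrightarrow> v \<notin># b \<Longrightarrow> h a b = 0"
  shows "(\<Sum>(a, b)\<in>splits (add_mset v m). h a b) = (\<Sum>(a, b)\<in>splits m. h a (add_mset v b))"
proof -
  have "(\<Sum>(a, b)\<in>splits (add_mset v m). h a b) = (\<Sum>(a, b)\<in>splits (add_mset v m). h b a)"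
    by (rule sum_splits_swap)
  also have "\<dots> = (\<Sum>(a, b)\<in>splits m. h b (add_mset v a))"
    by (rule sum_splits_left) (use assms in \<open>auto simp: add.commute\<close>)
  also have "\<dots> = (\<Sum>(a, b)\<in>splits m. h a (add_mset v b))"
    by (rule sum_splits_swap)
  finally show ?thesis .
qed

lemma coeff_svar_mult:
  "coeff (svar v * f) m =
    (if v \<in># m then of_int (mono_sign {#v#} (m - {#v#})) * coeff f (m - {#v#}) else 0)"
proof (cases "v \<in># m")
  case True
  then obtain n where m: "m = add_mset v n" by (blast dest: multi_member_split)
  have "coeff (svar v * f) m = (\<Sum>(a, b)\<in>splits n. of_int (mono_sign (add_mset v a) b) * coeff (svar v) (add_mset v a) * coeff f b)"
    unfolding coeff_mult m by (rule sum_splits_left) (auto simp: coeff_svar)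
  also have "\<dots> = (\<Sum>p\<in>{({#} :: fvar multiset, n)}. of_int (mono_sign {#v#} n) * coeff f n)"
    by (rule sum.mono_neutral_cong_right) (auto simp: coeff_svar split: if_splits)
  finally show ?thesis by (simp add: m)
next
  case False
  then have "coeff (svar v * f) m = (\<Sum>(a, b)\<in>splits m. 0)"
    unfolding coeff_mult by (intro sum.cong) (auto simp: coeff_svar)
  then show ?thesis using False by simp
qed

lemma coeff_sconst_mult: "coeff (sconst c * f) m = c * coeff f m"
proof -
  have "coeff (sconst c * f) m = (\<Sum>p\<in>{({#} :: fvar multiset, m)}. c * coeff f m)"
    unfolding coeff_mult by (rule sum.mono_neutral_cong_right) (auto simp: coeff_sconst split: if_splits)
  then show ?thesis by simp
qed

lemma coeff_mult_sconst: "coeff (f * sconst c) m = coeff f m * c"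
proof -
  have "coeff (f * sconst c) m = (\<Sum>p\<in>{(m, {#} :: fvar multiset)}. coeff f m * c)"
    unfolding coeff_mult by (rule sum.mono_neutral_cong_right) (auto simp: coeff_sconst split: if_splits)
  then show ?thesis by simp
qed

lemma sconst_commute: "f * sconst c = sconst c * f"
  by (rule sfun_eqI) (simp add: coeff_sconst_mult coeff_mult_sconst)

lemma sconst_mult: "sconst c * sconst d = sconst (c * d)"
  by (rule sfun_eqI) (simp add: coeff_sconst_mult coeff_sconst)

lemma sconst_fls_const: "sconst (fls_const r) * f = r *\<^sub>R f"
  by (rule sfun_eqI) (simp add: coeff_sconst_mult)

lemma sconst_0 [simp]: "sconst 0 = 0"
  by (rule sfun_eqI) (simp add: coeff_sconst)

lemma sconst_1 [simp]: "sconst 1 = 1"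
  by (rule sfun_eqI) (simp add: coeff_sconst coeff_1)

lemma hbar_hbar_inv [simp]: "hbar * hbar_inv = 1" "hbar_inv * hbar = 1"
  by (simp_all add: hbar_def hbar_inv_def sconst_mult fls_X_times_conv_shift fls_X_inv_times_conv_shift)

lemma hbar_hbar_inv_mult [simp]: "hbar * (hbar_inv * f) = f" "hbar_inv * (hbar * f) = f"
  by (simp_all flip: mult.assoc)

section \<open>Parity and graded commutation\<close>

definition oddn :: "fvar multiset \<Rightarrow> nat" where
  "oddn m = size (filter_mset odd_var m)"

lemma oddn_add [simp]: "oddn (a + b) = oddn a + oddn b"
  by (simp add: oddn_def)

lemma oddn_empty [simp]: "oddn {#} = 0"
  by (simp add: oddn_def)

lemma oddn_add_mset: "oddn (add_mset v m) = oddn m + (if odd_var v then 1 else 0)"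
  by (simp add: oddn_def)

lemma oddn_card:
  assumes "admissible m"
  shows "oddn m = card {v. v \<in># m \<and> odd_var v}"
proof -
  have "oddn m = (\<Sum>v\<in>set_mset (filter_mset odd_var m). count (filter_mset odd_var m) v)"
    by (simp add: oddn_def size_multiset_overloaded_eq)
  also have "\<dots> = (\<Sum>v\<in>set_mset (filter_mset odd_var m). 1)"
  proof (rule sum.cong)
    fix v assume "v \<in># filter_mset odd_var m"
    then have "count m v > 0" "count m v \<le> 1" "odd_var v" using assms by (auto simp: admissible_def)
    then show "count (filter_mset odd_var m) v = 1" by (simp del: count_greater_zero_iff)
  qed simp
  also have "\<dots> = card {v. v \<in># m \<and> odd_var v}" by simp
  finally show ?thesis .
qed

lemma coeff_parity: "coeff (parity f) m = (-1) ^ oddn m * coeff f m"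
  by (simp add: parity.rep_eq oddn_def)

text \<open>Each pair of an odd coordinate from \<open>a\<close> and one from \<open>b\<close> is
  inverted in exactly one of the two orders, so the two numbers of inversions add up to
  \<open>oddn a * oddn b\<close>.\<close>

lemma mono_sign_commute:
  assumes "admissible a" "admissible b"
  shows "mono_sign a b = (-1) ^ (oddn a * oddn b) * mono_sign b a"
proof (cases "\<exists>v. odd_var v \<and> v \<in># a \<and> v \<in># b")
  case True
  then show ?thesis by (auto simp: mono_sign_def)
next
  case False
  let ?S = "\<lambda>a b. {(v, w). v \<in># a \<and> w \<in># b \<and> odd_var v \<and> odd_var w \<and> to_nat w < to_nat v}"
  let ?A = "{v. v \<in># a \<and> odd_var v}" and ?B = "{v. v \<in># b \<and> odd_var v}"
  have "?A \<times> ?B = ?S a b \<union> prod.swap ` ?S b a"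
  proof (intro equalityI subsetI)
    fix p assume p: "p \<in> ?A \<times> ?B"
    then have "fst p \<noteq> snd p" using False by auto
    then have "to_nat (snd p) < to_nat (fst p) \<or> to_nat (fst p) < to_nat (snd p)"
      by (meson linorder_neqE_nat inj_to_nat injD)
    then show "p \<in> ?S a b \<union> prod.swap ` ?S b a"
      using p by (auto simp: image_iff prod_eq_iff)
  qed auto
  moreover have "?S a b \<inter> prod.swap ` ?S b a = {}" by auto
  ultimately have "card (?A \<times> ?B) = card (?S a b) + card (?S b a)"
    by (simp add: card_Un_disjoint mono_sign_finite card_image)
  then have *: "oddn a * oddn b = card (?S a b) + card (?S b a)"
    by (simp add: oddn_card assms card_cartesian_product)
  have "mono_sign a b = (-1) ^ card (?S a b)" "mono_sign b a = (-1) ^ card (?S b a)"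
    using False by (auto simp: mono_sign_def)
  moreover have "(-1::int) ^ card (?S a b) = (-1) ^ (card (?S a b) + card (?S b a)) * (-1) ^ card (?S b a)"
    by (simp add: power_add mult.assoc)
  ultimately show ?thesis by (simp only: *)
qed

lemma parity_mult: "parity (f * g) = parity f * parity g"
proof (rule sfun_eqI)
  fix m
  show "coeff (parity (f * g)) m = coeff (parity f * parity g) m"
    unfolding coeff_parity coeff_mult sum_distrib_left
    by (rule sum.cong) (auto simp: power_add mult_ac)
qed

lemma parity_add [simp]: "parity (f + g) = parity f + parity g"
  by (rule sfun_eqI) (simp add: coeff_parity distrib_left)

lemma parity_diff [simp]: "parity (f - g) = parity f - parity g"
  by (rule sfun_eqI) (simp add: coeff_parity right_diff_distrib)

lemma parity_minus [simp]: "parity (- f) = - parity f"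
  by (rule sfun_eqI) (simp add: coeff_parity)

lemma parity_0 [simp]: "parity 0 = 0"
  by (rule sfun_eqI) (simp add: coeff_parity)

lemma parity_1 [simp]: "parity 1 = 1"
  by (rule sfun_eqI) (simp add: coeff_parity coeff_1)

lemma parity_sconst [simp]: "parity (sconst c) = sconst c"
  by (rule sfun_eqI) (simp add: coeff_parity coeff_sconst)

lemma parity_scaleR [simp]: "parity (r *\<^sub>R f) = r *\<^sub>R parity f"
  by (rule sfun_eqI) (simp add: coeff_parity)

lemma parity_parity [simp]: "parity (parity f) = f"
  by (rule sfun_eqI) (simp add: coeff_parity flip: mult.assoc power_add mult_2)

lemma parity_svar: "parity (svar v) = (if odd_var v then - svar v else svar v)"
  by (rule sfun_eqI) (auto simp: coeff_parity coeff_svar oddn_add_mset)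

lemma even_commute:
  assumes "parity f = f"
  shows "f * g = g * f"
proof (rule sfun_eqI)
  fix m
  have "of_int (mono_sign a b) * coeff f a * coeff g b = of_int (mono_sign b a) * coeff g b * coeff f a" for a b
  proof (cases "coeff f a = 0 \<or> coeff g b = 0")
    case False
    have "(-1) ^ oddn a * coeff f a = coeff f a" 
      using arg_cong[OF assms, of "\<lambda>f. coeff f a"] by (simp add: coeff_parity)
    then have "even (oddn a)" using False by (cases "even (oddn a)") auto
    moreover have "admissible a" "admissible b" using False coeff_not_admissible by blast+
    ultimately have "mono_sign a b = mono_sign b a" by (simp add: mono_sign_commute[of a b] power_mult)
    then show ?thesis by simp
  qed auto
  then have "coeff (f * g) m = (\<Sum>(a, b)\<in>splits m. of_int (mono_sign b a) * coeff g b * coeff f a)"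
    unfolding coeff_mult by (simp only:)
  also have "\<dots> = coeff (g * f) m"
    unfolding coeff_mult by (rule sum_splits_swap)
  finally show "coeff (f * g) m = coeff (g * f) m" .
qed

lemma odd_commute:
  assumes "parity f = - f"
  shows "f * g = parity g * f"
proof (rule sfun_eqI)
  fix m
  have "of_int (mono_sign a b) * coeff f a * coeff g b
    = of_int (mono_sign b a) * coeff (parity g) b * coeff f a" for a b
  proof (cases "coeff f a = 0 \<or> coeff g b = 0")
    case False
    have "(-1) ^ oddn a * coeff f a = - coeff f a" 
      using arg_cong[OF assms, of "\<lambda>f. coeff f a"] by (simp add: coeff_parity)
    then have "odd (oddn a)" using False by (cases "even (oddn a)") auto
    moreover have "admissible a" "admissible b" using False coeff_not_admissible by blast+
    ultimately have "mono_sign a b = (-1) ^ oddn b * mono_sign b a"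
      by (simp add: mono_sign_commute[of a b] power_mult)
    then show ?thesis by (simp add: coeff_parity)
  qed (auto simp: coeff_parity)
  then have "coeff (f * g) m = (\<Sum>(a, b)\<in>splits m. of_int (mono_sign b a) * coeff (parity g) b * coeff f a)"
    unfolding coeff_mult by (simp only:)
  also have "\<dots> = coeff (parity g * f) m"
    unfolding coeff_mult by (rule sum_splits_swap)
  finally show "coeff (f * g) m = coeff (parity g * f) m" .
qed

definition vsgn :: "fvar \<Rightarrow> fvar \<Rightarrow> real" where
  "vsgn v w = (if odd_var v \<and> odd_var w then - 1 else 1)"

lemma vsgn_square [simp]: "vsgn v w * vsgn v w = 1"
  by (auto simp: vsgn_def)

text \<open>The sign produced when something of the parity of \<open>v\<close> passes
  \<open>f\<close>, taken monomial by monomial so that \<open>f\<close> may be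
  inhomogeneous.\<close>

definition twist :: "fvar \<Rightarrow> sfun \<Rightarrow> sfun" where
  "twist v f = (if odd_var v then parity f else f)"

lemma svar_commute: "svar v * f = twist v f * svar v"
  using even_commute[of "svar v" f] odd_commute[of "svar v" f] by (auto simp: twist_def parity_svar)

lemma twist_svar: "twist v (svar w) = vsgn v w *\<^sub>R svar w"
  by (auto simp: twist_def vsgn_def parity_svar)

lemma twist_even: "parity f = f \<Longrightarrow> twist v f = f"
  by (simp add: twist_def)

lemma svar_svar: "svar v * svar w = vsgn v w *\<^sub>R (svar w * svar v)"
  by (simp add: svar_commute[of v "svar w"] twist_svar)

section \<open>Left partial derivatives and the graded Leibniz rule\<close>

lemma coeff_deriv_at:
  "coeff (deriv_at v f) m = of_int (mono_sign {#v#} m) * of_nat (Suc (count m v)) * coeff f (add_mset v m)"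
  by (simp add: deriv_at.rep_eq)

lemma mono_sign_single_even:
  assumes "\<not> odd_var v"
  shows "mono_sign {#v#} m = 1"
proof -
  have "{(x, w). x \<in># {#v#} \<and> w \<in># m \<and> odd_var x \<and> odd_var w \<and> to_nat w < to_nat x} = {}"
    using assms by auto
  then show ?thesis using assms unfolding mono_sign_def by (simp only: card.empty) auto
qed

lemma mono_sign_add_mset_even:
  assumes "\<not> odd_var v"
  shows "mono_sign (add_mset v a) b = mono_sign a b" "mono_sign a (add_mset v b) = mono_sign a b"
proof -
  have "{(x, w). x \<in># add_mset v a \<and> w \<in># b \<and> odd_var x \<and> odd_var w \<and> to_nat w < to_nat x}
    = {(x, w). x \<in># a \<and> w \<in># b \<and> odd_var x \<and> odd_var w \<and> to_nat w < to_nat x}" using assms by auto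
  then show "mono_sign (add_mset v a) b = mono_sign a b"
    using assms by (auto simp: mono_sign_def)
  have "{(x, w). x \<in># a \<and> w \<in># add_mset v b \<and> odd_var x \<and> odd_var w \<and> to_nat w < to_nat x}
    = {(x, w). x \<in># a \<and> w \<in># b \<and> odd_var x \<and> odd_var w \<and> to_nat w < to_nat x}" using assms by auto
  then show "mono_sign a (add_mset v b) = mono_sign a b"
    using assms by (auto simp: mono_sign_def)
qed

lemma mono_sign_single_odd:
  assumes "odd_var v" "v \<notin># m"
  shows "mono_sign {#v#} m * mono_sign {#v#} m = 1" "mono_sign {#v#} m \<noteq> 0"
  using assms by (auto simp: mono_sign_def simp flip: power_add mult_2)

lemma mono_sign_single_0: "odd_var v \<Longrightarrow> v \<in># m \<Longrightarrow> mono_sign {#v#} m = 0"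
  by (auto simp: mono_sign_def)

lemma admissible_single [simp]: "admissible {#v#}"
  by (auto simp: admissible_def)

lemma admissible_add_mset: "admissible (add_mset v m) \<longleftrightarrow> admissible m \<and> (odd_var v \<longrightarrow> v \<notin># m)"
  by (auto simp: admissible_def not_in_iff le_Suc_eq)

lemma mono_sign_add_mset_odd_left:
  assumes "odd_var v" "v \<notin># a"
  shows "mono_sign (add_mset v a) b = mono_sign {#v#} b * mono_sign a b"
  using mono_sign_add_left[of "{#v#}" a b] mono_sign_single_odd(2)[OF assms] by simp

lemma mono_sign_add_mset_odd_right:
  assumes "odd_var v" "v \<notin># b" "admissible a"
  shows "mono_sign a (add_mset v b) = (-1) ^ oddn a * mono_sign {#v#} a * mono_sign a b"
  using mono_sign_add_right[of "{#v#}" b a] mono_sign_single_odd(2)[OF assms(1,2)] assms(1)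
  by (simp add: mono_sign_commute[OF assms(3) admissible_single] oddn_add_mset)

lemma mult_rearrange1:
  fixes s :: "'a::comm_monoid_mult"
  assumes "s * t = p * q"
  shows "n * (s * t * f * g) = p * (q * n * f) * g"
proof -
  have "n * (s * t * f * g) = (s * t) * (n * f * g)" by (simp only: mult_ac)
  also have "\<dots> = (p * q) * (n * f * g)" by (simp only: assms)
  also have "\<dots> = p * (q * n * f) * g" by (simp only: mult_ac)
  finally show ?thesis .
qed

lemma mult_rearrange2:
  fixes s :: "'a::comm_monoid_mult"
  assumes "s * t = e * p * q"
  shows "n * (s * t * f * g) = p * (e * f) * (q * n * g)"
proof -
  have "n * (s * t * f * g) = (s * t) * (n * f * g)" by (simp only: mult_ac)
  also have "\<dots> = (e * p * q) * (n * f * g)" by (simp only: assms)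
  also have "\<dots> = p * (e * f) * (q * n * g)" by (simp only: mult_ac)
  finally show ?thesis .
qed

lemma mult_cancel_square:
  fixes s :: int
  assumes "s * s = 1"
  shows "e * s * t * s = e * t"
proof -
  have "e * s * t * s = (s * s) * (e * t)" by (simp only: mult_ac)
  then show ?thesis by (simp add: assms)
qed

text \<open>The multiplicity of \<open>v\<close> in a product monomial is the sum of its
  multiplicities in the two factors. This splits the left side into two sums, which the reindexing
  by removal of one \<open>v\<close> matches with the two terms on the right.\<close>

lemma deriv_at_mult: "deriv_at v (f * g) = deriv_at v f * g + twist v f * deriv_at v g"
proof (rule sfun_eqI)
  fix m
  let ?\<sigma> = "\<lambda>a b. of_int (mono_sign a b) :: real fls"
  let ?f = "coeff f" and ?g = "coeff g"
  have "coeff (deriv_at v (f * g)) m =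
      (\<Sum>(a, b)\<in>splits (add_mset v m). of_nat (count a v) * (?\<sigma> {#v#} m * ?\<sigma> a b * ?f a * ?g b)
        + of_nat (count b v) * (?\<sigma> {#v#} m * ?\<sigma> a b * ?f a * ?g b))"
    unfolding coeff_deriv_at coeff_mult sum_distrib_left
  proof (rule sum.cong, goal_cases)
    case (2 p)
    obtain a b where p: "p = (a, b)" by fastforce
    then have "Suc (count m v) = count a v + count b v" using 2
      by (metis count_add_mset count_union in_splits)
    then have *: "of_nat (Suc (count m v)) = (of_nat (count a v) + of_nat (count b v) :: real fls)"
      by (metis of_nat_add)
    show ?case unfolding p case_prod_conv * by (simp only: distrib_left distrib_right mult_ac)
  qed simp
  also have "\<dots> = (\<Sum>(a, b)\<in>splits (add_mset v m). of_nat (count a v) * (?\<sigma> {#v#} m * ?\<sigma> a b * ?f a * ?g b))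
      + (\<Sum>(a, b)\<in>splits (add_mset v m). of_nat (count b v) * (?\<sigma> {#v#} m * ?\<sigma> a b * ?f a * ?g b))"
    by (simp add: sum.distrib case_prod_beta)
  also have "(\<Sum>(a, b)\<in>splits (add_mset v m). of_nat (count a v) * (?\<sigma> {#v#} m * ?\<sigma> a b * ?f a * ?g b))
    = (\<Sum>(a, b)\<in>splits m. of_nat (Suc (count a v)) * (?\<sigma> {#v#} m * ?\<sigma> (add_mset v a) b * ?f (add_mset v a) * ?g b))"
    by (subst sum_splits_left) (auto simp: not_in_iff)
  also have "(\<Sum>(a, b)\<in>splits (add_mset v m). of_nat (count b v) * (?\<sigma> {#v#} m * ?\<sigma> a b * ?f a * ?g b))
    = (\<Sum>(a, b)\<in>splits m. of_nat (Suc (count b v)) * (?\<sigma> {#v#} m * ?\<sigma> a (add_mset v b) * ?f a * ?g (add_mset v b)))"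
    by (subst sum_splits_right) (auto simp: not_in_iff)
  finally have L: "coeff (deriv_at v (f * g)) m =
     (\<Sum>(a, b)\<in>splits m. of_nat (Suc (count a v)) * (?\<sigma> {#v#} m * ?\<sigma> (add_mset v a) b * ?f (add_mset v a) * ?g b))
     + (\<Sum>(a, b)\<in>splits m. of_nat (Suc (count b v)) * (?\<sigma> {#v#} m * ?\<sigma> a (add_mset v b) * ?f a * ?g (add_mset v b)))" .
  let ?R1 = "\<lambda>a b. ?\<sigma> a b * (?\<sigma> {#v#} a * of_nat (Suc (count a v)) * ?f (add_mset v a)) * ?g b"
  let ?R2 = "\<lambda>a b. ?\<sigma> a b * ((if odd_var v then (-1) ^ oddn a else 1) * ?f a) *
      (?\<sigma> {#v#} b * of_nat (Suc (count b v)) * ?g (add_mset v b))"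
  have R: "coeff (deriv_at v f * g + twist v f * deriv_at v g) m =
     (\<Sum>(a, b)\<in>splits m. ?R1 a b) + (\<Sum>(a, b)\<in>splits m. ?R2 a b)"
    by (simp add: coeff_mult coeff_deriv_at twist_def coeff_parity)
  consider "\<not> odd_var v" | "odd_var v" "v \<notin># m" | "odd_var v" "v \<in># m" by blast
  then show "coeff (deriv_at v (f * g)) m = coeff (deriv_at v f * g + twist v f * deriv_at v g) m"
  proof cases
    case 1
    then show ?thesis unfolding L R
      by (intro arg_cong2[of _ _ _ _ "(+)"] sum.cong)
         (auto simp: mono_sign_single_even mono_sign_add_mset_even)
  next
    case 2
    have [simp]: "?\<sigma> {#v#} b * (?\<sigma> {#v#} b * x) = x" if "v \<notin># b" for b x
    proof -
      from that have "?\<sigma> {#v#} b * ?\<sigma> {#v#} b = 1"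
        using mono_sign_single_odd(1)[OF 2(1), of b] by (metis of_int_1 of_int_mult)
      then show ?thesis by (simp flip: mult.assoc)
    qed
    have m: "?\<sigma> {#v#} m = ?\<sigma> {#v#} a * ?\<sigma> {#v#} b" if "a + b = m" "mono_sign a b \<noteq> 0" for a b
      using mono_sign_add_right[OF that(2), of "{#v#}"] that(1) by simp
    show ?thesis unfolding L R
    proof (intro arg_cong2[of _ _ _ _ "(+)"] sum.cong refl, goal_cases)
      case (1 p)
      obtain a b where p: "p = (a, b)" by fastforce
      then have ab: "a + b = m" "v \<notin># a" "v \<notin># b" using 1 2 by auto
      show ?case
      proof (cases "mono_sign a b = 0")
        case False
        have *: "?\<sigma> {#v#} m * ?\<sigma> (add_mset v a) b = ?\<sigma> a b * ?\<sigma> {#v#} a"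
          using ab(3) unfolding m[OF ab(1) False] mono_sign_add_mset_odd_left[OF \<open>odd_var v\<close> ab(2)]
          by (simp add: mult.assoc)
        show ?thesis unfolding p case_prod_conv by (rule mult_rearrange1[OF *])
      qed (simp add: p mono_sign_add_mset_odd_left[OF 2(1) ab(2)])
    next
      case (2 p)
      obtain a b where p: "p = (a, b)" by fastforce
      then have ab: "a + b = m" "v \<notin># a" "v \<notin># b" using 2 \<open>v \<notin># m\<close> by auto
      show ?case
      proof (cases "mono_sign a b = 0 \<or> ?f a = 0")
        case True
        then show ?thesis
          using mono_sign_add_mset_odd_right[OF \<open>odd_var v\<close> ab(3), of a] coeff_not_admissible[of a f]
          by (cases "admissible a") (auto simp: p)
      next
        case False
        then have "admissible a" using coeff_not_admissible by blast
        have False': "mono_sign a b \<noteq> 0" using False by blast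
        have *: "?\<sigma> {#v#} m * ?\<sigma> a (add_mset v b) = (-1) ^ oddn a * ?\<sigma> a b * ?\<sigma> {#v#} b"
          using ab(2) False unfolding m[OF ab(1) False']
            mono_sign_add_mset_odd_right[OF \<open>odd_var v\<close> ab(3) \<open>admissible a\<close>]
          by (simp add: mult.assoc)
        have "(if odd_var v then (-1) ^ oddn a else 1 :: real fls) = (-1) ^ oddn a"
          using \<open>odd_var v\<close> by (rule if_P)
        then show ?thesis unfolding p case_prod_conv using mult_rearrange2[OF *] by (simp only:)
      qed
    qed
  next
    \<comment> \<open>The left side vanishes because \<open>v\<close> is odd and already occurs in
      \<open>m\<close>. On the right neither term need vanish: in one the \<open>v\<close> of
      \<open>m\<close> sits in the second factor, in the other in the first, and the two cancel
      pairwise.\<close>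
    case 3
    then obtain n where m: "m = add_mset v n" by (blast dest: multi_member_split)
    have "(\<Sum>(a, b)\<in>splits m. ?R1 a b) = (\<Sum>(a, b)\<in>splits n. ?R1 a (add_mset v b))"
      unfolding m
    proof (rule sum_splits_right, goal_cases)
      case (1 a b)
      then have "v \<in># a" by (metis union_iff union_single_eq_member)
      then show ?case using 3 by (simp add: mono_sign_single_0)
    qed
    moreover have "(\<Sum>(a, b)\<in>splits m. ?R2 a b) = (\<Sum>(a, b)\<in>splits n. ?R2 (add_mset v a) b)"
      unfolding m
    proof (rule sum_splits_left, goal_cases)
      case (1 a b)
      then have "v \<in># b" by (metis union_iff union_single_eq_member)
      then show ?case using 3 by (simp add: mono_sign_single_0)
    qed
    moreover have "?R1 a (add_mset v b) + ?R2 (add_mset v a) b = 0" for a b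
    proof (cases "?f (add_mset v a) = 0 \<or> ?g (add_mset v b) = 0")
      case False
      then have "admissible (add_mset v a)" "admissible (add_mset v b)" using coeff_not_admissible by blast+
      then have ab: "admissible a" "v \<notin># a" "v \<notin># b" using 3 by (auto simp: admissible_add_mset)
      have "mono_sign a (add_mset v b) * mono_sign {#v#} a = (-1) ^ oddn a * mono_sign a b"
        unfolding mono_sign_add_mset_odd_right[OF 3(1) ab(3,1)]
        by (rule mult_cancel_square[OF mono_sign_single_odd(1)[OF 3(1) ab(2)]])
      from this[THEN arg_cong, of "of_int :: int \<Rightarrow> real fls"]
      have 1: "?\<sigma> a (add_mset v b) * ?\<sigma> {#v#} a = (-1) ^ oddn a * ?\<sigma> a b"
        by simp
      have "mono_sign (add_mset v a) b * mono_sign {#v#} b = mono_sign a b"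
        unfolding mono_sign_add_mset_odd_left[OF 3(1) ab(2)]
        using mult_cancel_square[OF mono_sign_single_odd(1)[OF 3(1) ab(3)], of 1] by simp
      from this[THEN arg_cong, of "of_int :: int \<Rightarrow> real fls"]
      have 2: "?\<sigma> (add_mset v a) b * ?\<sigma> {#v#} b = ?\<sigma> a b"
        by simp
      have c: "count a v = 0" "count b v = 0" "oddn (add_mset v a) = Suc (oddn a)"
        using ab 3 by (simp_all add: not_in_iff oddn_add_mset)
      have "?R1 a (add_mset v b) = (?\<sigma> a (add_mset v b) * ?\<sigma> {#v#} a) * (?f (add_mset v a) * ?g (add_mset v b))"
        unfolding c by (simp only: of_nat_1 One_nat_def[symmetric] mult_1_left mult_1_right mult_ac)
      moreover have "?R2 (add_mset v a) b = - ((-1) ^ oddn a * (?\<sigma> (add_mset v a) b * ?\<sigma> {#v#} b) * (?f (add_mset v a) * ?g (add_mset v b)))"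
      proof -
        have "(if odd_var v then (-1) ^ oddn (add_mset v a) else 1 :: real fls) = - ((-1) ^ oddn a)"
          unfolding c using 3(1) by simp
        then show ?thesis unfolding c
          by (simp only: of_nat_1 One_nat_def[symmetric] mult_1_left mult_1_right mult_minus_left mult_minus_right mult_ac)
      qed
      ultimately have "?R1 a (add_mset v b) = - ?R2 (add_mset v a) b"
        unfolding 1 2 by (simp only: minus_minus)
      then show ?thesis by simp
    qed auto
    ultimately have "(\<Sum>(a, b)\<in>splits m. ?R1 a b) + (\<Sum>(a, b)\<in>splits m. ?R2 a b) = 0"
      by (simp add: case_prod_beta flip: sum.distrib)
    then show ?thesis unfolding R by (simp add: coeff_deriv_at mono_sign_single_0 3)
  qed
qed

lemma deriv_at_add [simp]: "deriv_at v (f + g) = deriv_at v f + deriv_at v g"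
  by (rule sfun_eqI) (simp add: coeff_deriv_at distrib_left)

lemma deriv_at_diff [simp]: "deriv_at v (f - g) = deriv_at v f - deriv_at v g"
  by (rule sfun_eqI) (simp add: coeff_deriv_at right_diff_distrib)

lemma deriv_at_minus [simp]: "deriv_at v (- f) = - deriv_at v f"
  by (rule sfun_eqI) (simp add: coeff_deriv_at)

lemma deriv_at_0 [simp]: "deriv_at v 0 = 0"
  by (rule sfun_eqI) (simp add: coeff_deriv_at)

lemma deriv_at_scaleR [simp]: "deriv_at v (r *\<^sub>R f) = r *\<^sub>R deriv_at v f"
  by (rule sfun_eqI) (simp add: coeff_deriv_at mult_ac)

lemma deriv_at_sum: "deriv_at v (sum f S) = (\<Sum>i\<in>S. deriv_at v (f i))"
  by (induction S rule: infinite_finite_induct) auto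

lemma deriv_at_sconst_mult [simp]: "deriv_at v (sconst c * f) = sconst c * deriv_at v f"
  by (rule sfun_eqI) (simp add: coeff_deriv_at coeff_sconst_mult mult_ac)

lemma deriv_at_sconst [simp]: "deriv_at v (sconst c) = 0"
  by (rule sfun_eqI) (simp add: coeff_deriv_at coeff_sconst)

lemma deriv_at_1 [simp]: "deriv_at v 1 = 0"
  using deriv_at_sconst[of v 1] by simp

lemma deriv_at_svar: "deriv_at v (svar w) = (if v = w then 1 else 0)"
  by (rule sfun_eqI) (auto simp: coeff_deriv_at coeff_svar coeff_1)

lemma deriv_at_svar_mult:
  "deriv_at v (svar w * f) = (if v = w then f else 0) + vsgn v w *\<^sub>R (svar w * deriv_at v f)"
  by (simp add: deriv_at_mult deriv_at_svar twist_svar)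

text \<open>Both orders remove the same two coordinates, and the cocycle law reduces the comparison
  to the sign of exchanging them. For \<open>v = w\<close> odd both sides are 0, since a repeated
  odd coordinate is not admissible.\<close>

lemma deriv_at_commute: "deriv_at v (deriv_at w f) = vsgn v w *\<^sub>R deriv_at w (deriv_at v f)"
proof (rule sfun_eqI)
  fix m
  let ?s = "\<lambda>v w. mono_sign {#v#} m * mono_sign {#w#} (add_mset v m)"
  have *: "?s v w = (if odd_var v \<and> odd_var w then - 1 else 1) * ?s w v" if "v \<noteq> w"
  proof -
    have "mono_sign {#v#} m * mono_sign {#w#} (add_mset v m) = mono_sign {#w#} {#v#} * mono_sign ({#w#} + {#v#}) m"
      using mono_sign_cocycle[of "{#w#}" "{#v#}" m] by simp
    moreover have "mono_sign {#w#} m * mono_sign {#v#} (add_mset w m) = mono_sign {#v#} {#w#} * mono_sign ({#v#} + {#w#}) m"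
      using mono_sign_cocycle[of "{#v#}" "{#w#}" m] by simp
    moreover have "mono_sign {#w#} {#v#} = (if odd_var v \<and> odd_var w then - 1 else 1) * mono_sign {#v#} {#w#}"
      using mono_sign_commute[of "{#w#}" "{#v#}"] by (auto simp: oddn_add_mset)
    ultimately show ?thesis by (simp add: add_mset_commute)
  qed
  show "coeff (deriv_at v (deriv_at w f)) m = coeff (vsgn v w *\<^sub>R deriv_at w (deriv_at v f)) m"
  proof (cases "v = w")
    case True
    then show ?thesis
      using coeff_not_admissible[of "add_mset w (add_mset v m)" f]
      by (auto simp: coeff_deriv_at vsgn_def admissible_add_mset)
  next
    case False
    have "coeff (deriv_at v (deriv_at w f)) m = of_int (?s v w) *
      (of_nat (Suc (count m v)) * of_nat (Suc (count m w)) * coeff f (add_mset v (add_mset w m)))"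
      using False by (simp add: coeff_deriv_at add_mset_commute mult_ac)
    also have "?s v w = (if odd_var v \<and> odd_var w then - 1 else 1) * ?s w v" by (rule *[OF False])
    also have "of_int \<dots> * (of_nat (Suc (count m v)) * of_nat (Suc (count m w)) * coeff f (add_mset v (add_mset w m)))
      = coeff (vsgn v w *\<^sub>R deriv_at w (deriv_at v f)) m"
      using False by (simp add: coeff_deriv_at vsgn_def add_mset_commute mult_ac)
    finally show ?thesis .
  qed
qed

lemma deriv_at_parity: "deriv_at v (parity f) = parity (if odd_var v then - deriv_at v f else deriv_at v f)"
  by (rule sfun_eqI) (simp add: coeff_deriv_at coeff_parity oddn_add_mset)

lemma deriv_at_twist: "deriv_at v (twist w f) = vsgn v w *\<^sub>R twist w (deriv_at v f)"
  by (auto simp: twist_def vsgn_def deriv_at_parity)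

text \<open>The Euler operator of a single coordinate. The sign of the derivative and that of the
  multiplication are equal and square to 1. It later recovers \<open>gen\<close> from its
  derivatives.\<close>

lemma coeff_svar_deriv_at: "coeff (svar v * deriv_at v f) m = of_nat (count m v) * coeff f m"
proof (cases "v \<in># m")
  case True
  then obtain n where m: "m = add_mset v n" by (blast dest: multi_member_split)
  show ?thesis
  proof (cases "odd_var v \<and> v \<in># n")
    case True
    then show ?thesis using coeff_not_admissible[of m f]
      by (simp add: coeff_svar_mult coeff_deriv_at m admissible_add_mset)
  next
    case False
    then have "mono_sign {#v#} n * mono_sign {#v#} n = 1"
      using mono_sign_single_odd mono_sign_single_even by (cases "odd_var v") auto
    then have "of_int (mono_sign {#v#} n) * of_int (mono_sign {#v#} n) = (1 :: real fls)"
      by (metis of_int_1 of_int_mult)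
    then show ?thesis by (simp add: coeff_svar_mult coeff_deriv_at m flip: mult.assoc)
  qed
qed (simp add: coeff_svar_mult, simp add: not_in_iff)

section \<open>Series and exponentials\<close>

definition ssums :: "(nat \<Rightarrow> sfun) \<Rightarrow> sfun \<Rightarrow> bool" where
  "ssums x s \<longleftrightarrow> (\<forall>m. (\<lambda>n. coeff (x n) m) sums coeff s m)"

lemma ssums_unique: "ssums x s \<Longrightarrow> ssums x t \<Longrightarrow> s = t"
  unfolding ssums_def by (blast intro: sfun_eqI sums_unique2)

lemma ssums_add: "ssums x s \<Longrightarrow> ssums y t \<Longrightarrow> ssums (\<lambda>n. x n + y n) (s + t)"
  by (simp add: ssums_def fls_sums_add)

lemma fls_sums_Suc:
  fixes x :: "nat \<Rightarrow> real fls"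
  assumes "x sums s" "x 0 = 0"
  shows "(\<lambda>n. x (Suc n)) sums s"
proof -
  have "(\<lambda>n. \<Sum>i<Suc n. x i) \<longlonglongrightarrow> s"
    using assms(1) unfolding sums_def by (rule LIMSEQ_Suc)
  then show ?thesis
    by (simp add: sums_def sum.lessThan_Suc_shift assms(2) del: sum.lessThan_Suc)
qed

lemma ssums_Suc: "ssums x s \<Longrightarrow> x 0 = 0 \<Longrightarrow> ssums (\<lambda>n. x (Suc n)) s"
  unfolding ssums_def by (auto intro: fls_sums_Suc[of "\<lambda>n. coeff (x n) m" for m])

text \<open>Maps that are linear over the Laurent series and for which every coefficient of the
  image depends on finitely many coefficients of the argument. Such maps commute with
  \<open>ssums\<close>, which is how all infinite series are handled.\<close>

definition finlin :: "(sfun \<Rightarrow> sfun) \<Rightarrow> bool" where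
  "finlin T \<longleftrightarrow> (\<forall>m. \<exists>S c. finite S \<and> (\<forall>f. coeff (T f) m = (\<Sum>a\<in>S. c a * coeff f a)))"

lemma ssums_finlin:
  assumes "finlin T" "ssums x s"
  shows "ssums (\<lambda>n. T (x n)) (T s)"
  unfolding ssums_def
proof
  fix m
  obtain S c where "\<And>f. coeff (T f) m = (\<Sum>a\<in>S. c a * coeff f a)"
    using assms(1) unfolding finlin_def by metis
  then show "(\<lambda>n. coeff (T (x n)) m) sums coeff (T s) m"
    using assms(2) by (simp add: fls_sums_sum fls_sums_mult ssums_def)
qed

lemma finlinI:
  assumes "\<And>m. finite (S m)" "\<And>f m. coeff (T f) m = (\<Sum>a\<in>S m. c m a * coeff f a)"
  shows "finlin T"
  using assms unfolding finlin_def by metis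

lemma finlin_diagonal:
  assumes "\<And>f m. coeff (T f) m = c m * coeff f m"
  shows "finlin T"
  by (rule finlinI[of "\<lambda>m. {m}" _ "\<lambda>m _. c m"]) (auto simp: assms)

lemma finlin_id: "finlin (\<lambda>f. f)"
  by (rule finlin_diagonal[of _ "\<lambda>_. 1"]) auto

lemma finlin_deriv_at: "finlin (deriv_at v)"
  by (rule finlinI[of "\<lambda>m. {add_mset v m}" _
        "\<lambda>m _. of_int (mono_sign {#v#} m) * of_nat (Suc (count m v))"])
     (auto simp: coeff_deriv_at)

text \<open>A multiset has finitely many splittings, so \<open>g\<close> may be an arbitrary
  infinite series.\<close>

lemma finlin_mult_left: "finlin (\<lambda>f. g * f)"
proof (rule finlinI[of "\<lambda>m. snd ` splits m" _ "\<lambda>m b. of_int (mono_sign (m - b) b) * coeff g (m - b)"])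
  fix f m
  have "coeff (g * f) m = (\<Sum>p\<in>splits m. of_int (mono_sign (m - snd p) (snd p)) * coeff g (m - snd p) * coeff f (snd p))"
    unfolding coeff_mult by (rule sum.cong) auto
  also have "\<dots> = (\<Sum>b\<in>snd ` splits m. of_int (mono_sign (m - b) b) * coeff g (m - b) * coeff f b)"
    by (subst sum.reindex) (auto simp: inj_on_def o_def)
  finally show "coeff (g * f) m = (\<Sum>b\<in>snd ` splits m. of_int (mono_sign (m - b) b) * coeff g (m - b) * coeff f b)" .
qed auto

lemma finlin_add:
  assumes "finlin T" "finlin U"
  shows "finlin (\<lambda>f. T f + U f)"
  unfolding finlin_def
proof
  fix m
  obtain S c where S: "finite S" "\<And>f. coeff (T f) m = (\<Sum>a\<in>S. c a * coeff f a)"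
    using assms(1) unfolding finlin_def by metis
  obtain S' c' where S': "finite S'" "\<And>f. coeff (U f) m = (\<Sum>a\<in>S'. c' a * coeff f a)"
    using assms(2) unfolding finlin_def by metis
  let ?d = "\<lambda>a. (if a \<in> S then c a else 0) + (if a \<in> S' then c' a else 0)"
  have "coeff (T f + U f) m = (\<Sum>a\<in>S \<union> S'. ?d a * coeff f a)" for f
  proof -
    have "(\<Sum>a\<in>S. c a * coeff f a) = (\<Sum>a\<in>S \<union> S'. (if a \<in> S then c a else 0) * coeff f a)"
      using S S' by (intro sum.mono_neutral_cong_left) auto
    moreover have "(\<Sum>a\<in>S'. c' a * coeff f a) = (\<Sum>a\<in>S \<union> S'. (if a \<in> S' then c' a else 0) * coeff f a)"
      using S S' by (intro sum.mono_neutral_cong_left) auto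
    ultimately show ?thesis by (simp add: S S' distrib_right sum.distrib)
  qed
  then show "\<exists>S c. finite S \<and> (\<forall>f. coeff (T f + U f) m = (\<Sum>a\<in>S. c a * coeff f a))"
    using S S' by (intro exI[of _ "S \<union> S'"] exI[of _ ?d]) auto
qed

lemma finlin_compose:
  assumes "finlin T" "finlin U"
  shows "finlin (\<lambda>f. T (U f))"
  unfolding finlin_def
proof
  fix m
  obtain S c where S: "finite S" "\<And>f. coeff (T f) m = (\<Sum>a\<in>S. c a * coeff f a)"
    using assms(1) unfolding finlin_def by metis
  obtain S' c' where S': "\<And>a. finite (S' a)" "\<And>a f. coeff (U f) a = (\<Sum>b\<in>S' a. c' a b * coeff f b)"
    using assms(2) unfolding finlin_def by metis
  let ?B = "\<Union>a\<in>S. S' a"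
  let ?d = "\<lambda>b. \<Sum>a\<in>S. c a * (if b \<in> S' a then c' a b else 0)"
  have "coeff (T (U f)) m = (\<Sum>b\<in>?B. ?d b * coeff f b)" for f
  proof -
    have "(\<Sum>b\<in>S' a. c' a b * coeff f b) = (\<Sum>b\<in>?B. (if b \<in> S' a then c' a b else 0) * coeff f b)"
      if "a \<in> S" for a
      using S S' that by (intro sum.mono_neutral_cong_left) auto
    then have "coeff (T (U f)) m = (\<Sum>a\<in>S. c a * (\<Sum>b\<in>?B. (if b \<in> S' a then c' a b else 0) * coeff f b))"
      by (simp add: S S')
    also have "\<dots> = (\<Sum>b\<in>?B. ?d b * coeff f b)"
      by (simp only: sum_distrib_left sum_distrib_right mult.assoc) (rule sum.swap)
    finally show ?thesis .
  qed
  then show "\<exists>S c. finite S \<and> (\<forall>f. coeff (T (U f)) m = (\<Sum>a\<in>S. c a * coeff f a))"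
    using S S' by (intro exI[of _ ?B] exI[of _ ?d]) auto
qed

lemma finlin_0: "finlin (\<lambda>f. 0)"
  by (rule finlin_diagonal[of _ "\<lambda>_. 0"]) auto

lemma finlin_sum: "(\<And>i. i \<in> S \<Longrightarrow> finlin (T i)) \<Longrightarrow> finlin (\<lambda>f. \<Sum>i\<in>S. T i f)"
  by (induction S rule: infinite_finite_induct) (auto simp: finlin_0 intro: finlin_add)

lemma finlin_scaleR: "finlin (\<lambda>f. r *\<^sub>R f)"
  by (rule finlin_diagonal[of _ "\<lambda>_. fls_const r"]) auto

lemma ssums_Cauchy_product:
  assumes "ssums x s" "ssums y t"
  shows "ssums (\<lambda>n. \<Sum>i\<le>n. x i * y (n - i)) (s * t)"
  unfolding ssums_def
proof
  fix m
  have "(\<lambda>n. \<Sum>(a, b)\<in>splits m. of_int (mono_sign a b) * (\<Sum>i\<le>n. coeff (x i) a * coeff (y (n - i)) b))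
    sums (\<Sum>(a, b)\<in>splits m. of_int (mono_sign a b) * (coeff s a * coeff t b))"
    unfolding case_prod_beta
    by (intro fls_sums_sum fls_sums_mult fls_sums_Cauchy_product) (use assms in \<open>auto simp: ssums_def\<close>)
  also have "(\<lambda>n. \<Sum>(a, b)\<in>splits m. of_int (mono_sign a b) * (\<Sum>i\<le>n. coeff (x i) a * coeff (y (n - i)) b))
     = (\<lambda>n. coeff (\<Sum>i\<le>n. x i * y (n - i)) m)"
    unfolding coeff_sum coeff_mult case_prod_beta sum_distrib_left mult.assoc
    by (rule ext, rule sum.swap)
  finally show "(\<lambda>n. coeff (\<Sum>i\<le>n. x i * y (n - i)) m) sums coeff (s * t) m"
    by (simp add: coeff_mult mult.assoc)
qed

section \<open>Support conditions: coordinates, parity and ghost number as sets of monomials\<close>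

definition supp :: "fvar multiset set \<Rightarrow> sfun set" where
  "supp S = {f. \<forall>m. coeff f m \<noteq> 0 \<longrightarrow> m \<in> S}"

lemma suppI: "(\<And>m. m \<notin> S \<Longrightarrow> coeff f m = 0) \<Longrightarrow> f \<in> supp S"
  by (auto simp: supp_def)

lemma suppD: "f \<in> supp S \<Longrightarrow> m \<notin> S \<Longrightarrow> coeff f m = 0"
  by (auto simp: supp_def)

lemma supp_mono: "f \<in> supp S \<Longrightarrow> S \<subseteq> T \<Longrightarrow> f \<in> supp T"
  by (auto simp: supp_def)

lemma supp_Int: "f \<in> supp S \<Longrightarrow> f \<in> supp T \<Longrightarrow> f \<in> supp (S \<inter> T)"
  by (auto simp: supp_def)

lemma supp_0 [simp]: "0 \<in> supp S"
  by (auto simp: supp_def)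

lemma supp_add: "f \<in> supp S \<Longrightarrow> g \<in> supp S \<Longrightarrow> f + g \<in> supp S"
  by (rule suppI) (simp add: suppD)

lemma supp_diff: "f \<in> supp S \<Longrightarrow> g \<in> supp S \<Longrightarrow> f - g \<in> supp S"
  by (rule suppI) (simp add: suppD)

lemma supp_uminus: "f \<in> supp S \<Longrightarrow> - f \<in> supp S"
  by (rule suppI) (simp add: suppD)

lemma supp_scaleR: "f \<in> supp S \<Longrightarrow> r *\<^sub>R f \<in> supp S"
  by (rule suppI) (simp add: suppD)

lemma supp_sconst_mult: "f \<in> supp S \<Longrightarrow> sconst c * f \<in> supp S"
  by (rule suppI) (simp add: suppD coeff_sconst_mult)

lemma supp_sum: "(\<And>i. i \<in> J \<Longrightarrow> f i \<in> supp S) \<Longrightarrow> sum f J \<in> supp S"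
  by (induction J rule: infinite_finite_induct) (auto intro: supp_add)

lemma supp_mult:
  assumes "f \<in> supp S" "g \<in> supp T" "\<And>a b. a \<in> S \<Longrightarrow> b \<in> T \<Longrightarrow> a + b \<in> U"
  shows "f * g \<in> supp U"
proof (rule suppI)
  fix m assume "m \<notin> U"
  then have "coeff f a = 0 \<or> coeff g b = 0" if "(a, b) \<in> splits m" for a b
    using assms that by (auto simp: supp_def)
  then show "coeff (f * g) m = 0" unfolding coeff_mult by (intro sum.neutral) fastforce
qed

lemma supp_ssums: "ssums x s \<Longrightarrow> (\<And>n. x n \<in> supp S) \<Longrightarrow> s \<in> supp S"
proof (rule suppI)
  fix m assume s: "ssums x s" "\<And>n. x n \<in> supp S" "m \<notin> S"
  then have "(\<lambda>n. coeff (x n) m) = (\<lambda>n. 0)" using suppD by blast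
  moreover have "(\<lambda>n. coeff (x n) m) sums coeff s m" using s(1) by (simp add: ssums_def)
  ultimately show "coeff s m = 0" using sums_0 sums_unique2 by metis
qed

text \<open>Submonoids of the monomials. For these the series supported in \<open>S\<close> form a
  subalgebra, stable under convergent exponentials and, by \<open>supp_log\<close>, under
  logarithms.\<close>

definition add_closed :: "fvar multiset set \<Rightarrow> bool" where
  "add_closed S \<longleftrightarrow> {#} \<in> S \<and> (\<forall>a\<in>S. \<forall>b\<in>S. a + b \<in> S)"

lemma supp_1: "add_closed S \<Longrightarrow> 1 \<in> supp S"
  by (auto simp: supp_def add_closed_def coeff_1)

lemma supp_closed_mult: "add_closed S \<Longrightarrow> f \<in> supp S \<Longrightarrow> g \<in> supp S \<Longrightarrow> f * g \<in> supp S"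
  by (rule supp_mult) (auto simp: add_closed_def)

lemma supp_power: "add_closed S \<Longrightarrow> f \<in> supp S \<Longrightarrow> f ^ n \<in> supp S"
  by (induction n) (auto simp: supp_1 supp_closed_mult)

definition evens :: "fvar multiset set" where
  "evens = {m. even (oddn m)}"

lemma even_iff: "parity f = f \<longleftrightarrow> f \<in> supp evens"
proof
  assume f: "parity f = f"
  show "f \<in> supp evens"
  proof (rule suppI)
    fix m assume "m \<notin> evens"
    then show "coeff f m = 0"
      using arg_cong[OF f, of "\<lambda>f. coeff f m"] by (simp add: coeff_parity evens_def)
  qed
next
  assume f: "f \<in> supp evens"
  show "parity f = f"
  proof (rule sfun_eqI)
    fix m
    show "coeff (parity f) m = coeff f m"
      using suppD[OF f, of m] by (cases "m \<in> evens") (auto simp: coeff_parity evens_def)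
  qed
qed

definition ghosts :: "fvar multiset \<Rightarrow> int" where
  "ghosts m = sum_mset (image_mset ghost m)"

lemma ghosts_simps [simp]:
  "ghosts {#} = 0" "ghosts (add_mset v m) = ghost v + ghosts m" "ghosts (a + b) = ghosts a + ghosts b"
  by (simp_all add: ghosts_def)

lemma even_ghosts: "even (ghosts m) \<longleftrightarrow> even (oddn m)"
  by (induction m) (auto simp: oddn_add_mset)

definition gr :: "int \<Rightarrow> fvar multiset set" where
  "gr g = {m. ghosts m = g}"

lemma add_closed_gr: "add_closed (gr 0)"
  by (auto simp: add_closed_def gr_def)

lemma gr_0_even: "f \<in> supp (gr 0) \<Longrightarrow> parity f = f"
  unfolding even_iff by (erule supp_mono) (auto simp: gr_def evens_def simp flip: even_ghosts)

definition over :: "fvar set \<Rightarrow> fvar multiset set" where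
  "over V = {m. set_mset m \<subseteq> V}"

lemma add_closed_over: "add_closed (over V)"
  by (auto simp: add_closed_def over_def)

lemma Fun_supp: "Fun V = supp (over V)"
  by (auto simp: Fun_def supp_def over_def)

lemma add_closed_Int: "add_closed S \<Longrightarrow> add_closed T \<Longrightarrow> add_closed (S \<inter> T)"
  by (auto simp: add_closed_def)

lemma supp_deriv_at:
  assumes "f \<in> supp S" "\<And>m. add_mset v m \<in> S \<Longrightarrow> m \<in> T"
  shows "deriv_at v f \<in> supp T"
  using assms by (intro suppI) (auto simp: coeff_deriv_at supp_def)

lemma deriv_at_eq_0:
  assumes "f \<in> Fun V" "v \<notin> V"
  shows "deriv_at v f = 0"
proof -
  have "deriv_at v f \<in> supp {}"
    by (rule supp_deriv_at[of _ "over V"]) (use assms in \<open>auto simp: Fun_supp over_def\<close>)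
  then show ?thesis by (intro sfun_eqI) (simp add: suppD)
qed

lemma supp_svar: "{#v#} \<in> S \<Longrightarrow> svar v \<in> supp S"
  by (auto simp: supp_def coeff_svar)

section \<open>Exponentials and logarithms\<close>

lemma exp_sums_ssums: "exp_sums u z \<longleftrightarrow> ssums (\<lambda>n. (1 / fact n) *\<^sub>R u ^ n) z"
  by (simp add: exp_sums_def ssums_def exp_term_def[abs_def])

text \<open>\<open>sexp\<close> is built from \<open>suminf\<close> and is meaningful only under
  this condition. Null terms are enough by \<open>fls_null_sums\<close>.\<close>

definition exp_conv :: "sfun \<Rightarrow> bool" where
  "exp_conv u \<longleftrightarrow> (\<forall>m. fls_null (exp_term u m))"

lemma exp_conv_sums: "exp_conv u \<Longrightarrow> exp_sums u (sexp u)"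
  by (simp add: exp_conv_def exp_sums_def sexp.rep_eq fls_null_imp_suminf)

lemma exp_sums_conv: "exp_sums u z \<Longrightarrow> exp_conv u"
  by (auto simp: exp_conv_def exp_sums_def intro: fls_sums_imp_null)

lemma exp_sums_eq: "exp_sums u z \<Longrightarrow> z = sexp u"
  using exp_conv_sums exp_sums_conv ssums_unique unfolding exp_sums_ssums by blast

lemma exp_conv_ssums: "exp_conv u \<Longrightarrow> ssums (\<lambda>n. (1 / fact n) *\<^sub>R u ^ n) (sexp u)"
  using exp_conv_sums by (simp add: exp_sums_ssums)

lemma exp_conv_uminus: "exp_conv u \<Longrightarrow> exp_conv (- u)"
proof -
  assume u: "exp_conv u"
  have "fls_ge N (exp_term (- u) m n) \<longleftrightarrow> fls_ge N (exp_term u m n)" for N m n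
    by (cases "even n") (auto simp: exp_term_def fls_ge_def)
  then show ?thesis using u by (simp add: exp_conv_def fls_null_def)
qed

lemma power_coeff_eq_0:
  assumes "coeff u {#} = 0" "size m < n"
  shows "coeff (u ^ n) m = 0"
  using assms(2)
proof (induction n arbitrary: m)
  case (Suc n)
  have "coeff u a * coeff (u ^ n) b = 0" if "(a, b) \<in> splits m" for a b
  proof (cases "a = {#}")
    case False
    then have "size a \<noteq> 0" by auto
    moreover have "size m = size a + size b" using that by (metis in_splits size_union)
    ultimately have "size b < n" using Suc.prems by linarith
    then show ?thesis using Suc.IH by simp
  qed (use assms in auto)
  then show ?case by (auto simp: coeff_mult mult.assoc intro!: sum.neutral)
qed simp

text \<open>\<open>u ^ n\<close> starts in polynomial degree \<open>n\<close>, so each coefficient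
  of the exponential is a finite sum, whatever powers of 1/\<hbar> occur in
  \<open>u\<close>.\<close>

lemma exp_conv_no_const:
  assumes "coeff u {#} = 0"
  shows "exp_conv u"
  unfolding exp_conv_def fls_null_def
proof (intro allI)
  fix m N
  show "\<exists>n0. \<forall>n\<ge>n0. fls_ge N (exp_term u m n)"
    by (rule exI[of _ "Suc (size m)"]) (simp add: exp_term_def power_coeff_eq_0[OF assms])
qed

text \<open>The binomial theorem with the factorials divided out. Only \<open>x\<close> and
  \<open>y\<close> are assumed to commute, since odd functions make the ambient algebra
  noncommutative.\<close>

lemma exp_term_add_commuting:
  fixes x y :: "'a::real_algebra_1"
  assumes "x * y = y * x"
  shows "(1 / fact n) *\<^sub>R (x + y) ^ n = (\<Sum>i\<le>n. ((1 / fact i) *\<^sub>R x ^ i) * ((1 / fact (n - i)) *\<^sub>R y ^ (n - i)))"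
proof (induction n)
  case (Suc n)
  define t where "t i j = ((1 / fact i) *\<^sub>R x ^ i) * ((1 / fact j) *\<^sub>R y ^ j)" for i j :: nat
  have yx: "y * x ^ i = x ^ i * y" for i
    using power_commuting_commutes[OF assms, of i] by simp
  have x: "x * t i j = real (Suc i) *\<^sub>R t (Suc i) j" for i j
    by (simp add: t_def mult.assoc del: of_nat_Suc)
  have y: "y * t i j = real (Suc j) *\<^sub>R t i (Suc j)" for i j
  proof -
    have "y * t i j = ((1 / fact i) *\<^sub>R x ^ i) * ((1 / fact j) *\<^sub>R y ^ Suc j)"
      using yx[of i] by (simp add: t_def flip: mult.assoc)
    then show ?thesis by (simp add: t_def del: of_nat_Suc)
  qed
  \<comment> \<open>Writing \<open>Suc n = i + (Suc n - i)\<close> and absorbing each weight into a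
    factorial exhibits the sum as \<open>(x + y)\<close> times the sum for \<open>n\<close>.\<close>
  have "real (Suc n) *\<^sub>R (\<Sum>i\<le>Suc n. t i (Suc n - i))
      = (\<Sum>i\<le>Suc n. real i *\<^sub>R t i (Suc n - i)) + (\<Sum>i\<le>Suc n. real (Suc n - i) *\<^sub>R t i (Suc n - i))"
    unfolding scaleR_sum_right sum.distrib[symmetric] scaleR_add_left[symmetric]
    by (rule sum.cong) (auto simp flip: of_nat_add)
  also have "(\<Sum>i\<le>Suc n. real i *\<^sub>R t i (Suc n - i)) = x * (\<Sum>i\<le>n. t i (n - i))"
    by (simp add: sum.atMost_Suc_shift sum_distrib_left x del: sum.atMost_Suc of_nat_Suc)
  also have "(\<Sum>i\<le>Suc n. real (Suc n - i) *\<^sub>R t i (Suc n - i)) = y * (\<Sum>i\<le>n. t i (n - i))"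
  proof -
    have "(\<Sum>i\<le>Suc n. real (Suc n - i) *\<^sub>R t i (Suc n - i)) = (\<Sum>i\<le>n. real (Suc n - i) *\<^sub>R t i (Suc n - i))"
      by (simp only: sum.atMost_Suc diff_self_eq_0 of_nat_0 scaleR_zero_left add_0_right)
    also have "\<dots> = (\<Sum>i\<le>n. y * t i (n - i))"
      by (rule sum.cong) (simp_all only: y Suc_diff_le atMost_iff)
    finally show ?thesis by (simp only: sum_distrib_left)
  qed
  also have "x * (\<Sum>i\<le>n. t i (n - i)) + y * (\<Sum>i\<le>n. t i (n - i)) = (1 / fact n) *\<^sub>R (x + y) ^ Suc n"
    unfolding t_def Suc.IH[symmetric] by (simp add: distrib_right scaleR_add_right)
  finally have "(1 / real (Suc n)) *\<^sub>R (real (Suc n) *\<^sub>R (\<Sum>i\<le>Suc n. t i (Suc n - i)))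
      = (1 / fact (Suc n)) *\<^sub>R (x + y) ^ Suc n"
    by (simp del: of_nat_Suc power_Suc sum.atMost_Suc)
  then show ?case by (simp add: t_def del: of_nat_Suc power_Suc sum.atMost_Suc)
qed simp

lemma exp_sums_add:
  assumes "exp_conv u" "exp_conv v" "u * v = v * u"
  shows "exp_sums (u + v) (sexp u * sexp v)"
proof -
  have "(\<Sum>i\<le>n. ((1 / fact i) *\<^sub>R u ^ i) * ((1 / fact (n - i)) *\<^sub>R v ^ (n - i))) = (1 / fact n) *\<^sub>R (u + v) ^ n" for n
    using exp_term_add_commuting[OF assms(3), of n] by simp
  then show ?thesis
    using ssums_Cauchy_product[OF exp_conv_ssums[OF assms(1)] exp_conv_ssums[OF assms(2)]]
    by (simp add: exp_sums_ssums)
qed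

lemma sexp_add: "exp_conv u \<Longrightarrow> exp_conv v \<Longrightarrow> u * v = v * u \<Longrightarrow> sexp (u + v) = sexp u * sexp v"
  using exp_sums_add exp_sums_eq by metis

lemma sexp_0 [simp]: "sexp 0 = 1"
proof -
  have "ssums (\<lambda>n. (1 / fact n) *\<^sub>R 0 ^ n) (1 :: sfun)"
    unfolding ssums_def
  proof
    fix m
    have "(\<lambda>n. coeff ((1 / fact n) *\<^sub>R (0 :: sfun) ^ n) m) = (\<lambda>n. if n = 0 then coeff 1 m else 0)"
      by (auto simp: power_0_left)
    then show "(\<lambda>n. coeff ((1 / fact n) *\<^sub>R (0 :: sfun) ^ n) m) sums coeff 1 m"
      using sums_single[of 0 "\<lambda>_. coeff 1 m"] by simp
  qed
  then show ?thesis using exp_sums_eq exp_sums_ssums by metis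
qed

lemma sexp_minus_mult: "exp_conv u \<Longrightarrow> sexp (- u) * sexp u = 1"
  using sexp_add[of "- u" u] by (simp add: exp_conv_uminus)

lemma supp_sexp:
  assumes "exp_conv u" "add_closed S" "u \<in> supp S"
  shows "sexp u \<in> supp S"
  by (rule supp_ssums[OF exp_conv_ssums[OF assms(1)]]) (intro supp_scaleR supp_power assms)

text \<open>A splitting of \<open>m\<close> has a part outside the monoid \<open>S\<close>. If both
  parts are proper, the coefficient at that part vanishes, so only the two trivial splittings
  contribute. The other two claims carry the induction.\<close>

lemma power_coeff_const:
  assumes "\<And>a. a \<subset># m \<Longrightarrow> a \<noteq> {#} \<Longrightarrow> a \<notin> S \<Longrightarrow> coeff u a = 0" "add_closed S" "m \<notin> S"
  shows "coeff (u ^ n) m = of_nat n * coeff u {#} ^ (n - 1) * coeff u m \<and>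
    (\<forall>a. a \<subset># m \<longrightarrow> a \<noteq> {#} \<longrightarrow> a \<notin> S \<longrightarrow> coeff (u ^ n) a = 0) \<and>
    coeff (u ^ n) {#} = coeff u {#} ^ n"
proof -
  have m: "m \<noteq> {#}" using assms by (auto simp: add_closed_def)
  have S: "{#} \<in> S" "\<And>a b. a \<in> S \<Longrightarrow> b \<in> S \<Longrightarrow> a + b \<in> S" using assms(2) by (auto simp: add_closed_def)
  show ?thesis
  proof (induction n)
    case 0
    then show ?case using m by (auto simp: coeff_1)
  next
    case (Suc n)
    have 1: "coeff (u ^ Suc n) m = coeff u {#} * coeff (u ^ n) m + coeff u m * coeff (u ^ n) {#}"
    proof -
      have "coeff (u ^ Suc n) m = (\<Sum>(a, b)\<in>{({#}, m), (m, {#})}. of_int (mono_sign a b) * coeff u a * coeff (u ^ n) b)"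
        unfolding power_Suc coeff_mult
      proof (rule sum.mono_neutral_right)
        show "\<forall>p\<in>splits m - {({#}, m), (m, {#})}.
            (case p of (a, b) \<Rightarrow> of_int (mono_sign a b) * coeff u a * coeff (u ^ n) b) = 0"
        proof
          fix p assume p: "p \<in> splits m - {({#}, m), (m, {#})}"
          obtain a b where ab: "p = (a, b)" by fastforce
          then have *: "a + b = m" "a \<noteq> {#}" "b \<noteq> {#}" using p by auto
          then have "a \<subset># m" "b \<subset># m" by (auto simp: subset_mset_def)
          moreover have "a \<notin> S \<or> b \<notin> S" using S(2) * assms(3) by blast
          ultimately have "coeff u a = 0 \<or> coeff (u ^ n) b = 0" using assms(1) Suc.IH * by blast
          then show "(case p of (a, b) \<Rightarrow> of_int (mono_sign a b) * coeff u a * coeff (u ^ n) b) = 0"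
            by (auto simp: ab)
        qed
      qed auto
      then show ?thesis using m by simp
    qed
    have 2: "coeff (u ^ Suc n) c = 0" if c: "c \<subset># m" "c \<noteq> {#}" "c \<notin> S" for c
      unfolding power_Suc coeff_mult
    proof (rule sum.neutral, clarify)
      fix a b assume "(a, b) \<in> splits c"
      then have ab: "a + b = c" by simp
      then have "a \<subseteq># c" "b \<subseteq># c" by auto
      then have sub: "a \<subset># m" "b \<subset># m" using c(1) subset_mset.le_less_trans by blast+
      have "a \<notin> S \<or> b \<notin> S" using S(2) ab c(3) by blast
      then have "coeff u a = 0 \<or> coeff (u ^ n) b = 0"
        using S(1) assms(1) Suc.IH sub by metis
      then show "of_int (mono_sign a b) * coeff u a * coeff (u ^ n) b = 0" by auto
    qed
    have 3: "coeff (u ^ Suc n) {#} = coeff u {#} ^ Suc n"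
      using Suc.IH by (simp add: coeff_mult_empty)
    have "coeff (u ^ Suc n) m = of_nat (Suc n) * coeff u {#} ^ n * coeff u m"
      unfolding 1 using Suc.IH by (cases n) (auto simp: algebra_simps)
    then show ?case using 2 3 by (metis diff_Suc_1)
  qed
qed

text \<open>In degree \<open>m\<close>, the only contributions to \<open>exp u\<close> not built from coefficients of \<open>u\<close>
  of smaller degree are those with one factor \<open>u\<^sub>m\<close>, which add up to \<open>e\<^bsup>u\<^sub>0\<^esup> u\<^sub>m\<close>.\<close>

lemma supp_log:
  assumes "exp_sums u z" "add_closed S" "z \<in> supp S"
  shows "u \<in> supp S"
proof (rule suppI)
  have conv: "exp_conv u" using assms(1) by (rule exp_sums_conv)
  fix m assume "m \<notin> S"
  then show "coeff u m = 0"
  proof (induction m rule: measure_induct_rule[of size])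
    case (less m)
    let ?c = "coeff u {#}"
    have small: "a \<subset># m \<Longrightarrow> a \<noteq> {#} \<Longrightarrow> a \<notin> S \<Longrightarrow> coeff u a = 0" for a
      using less.IH mset_subset_size by blast
    note pow = power_coeff_const[OF this assms(2) less.prems]
    have em: "exp_term u m n = fls_const (1 / fact n) * (of_nat n * ?c ^ (n - 1)) * coeff u m" for n
      using pow[of n] by (simp add: exp_term_def mult.assoc)
    have e0: "exp_term u {#} n = fls_const (1 / fact n) * ?c ^ n" for n
      using pow[of n] by (simp add: exp_term_def)
    have em_Suc: "exp_term u m (Suc n) = coeff u m * exp_term u {#} n" for n
    proof -
      have "fls_const (1 / fact (Suc n)) * of_nat (Suc n) = (fls_const (1 / fact n) :: real fls)"
        unfolding fls_of_nat fls_const_mult_const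
        by (rule arg_cong[of _ _ fls_const]) (simp del: of_nat_Suc)
      moreover have "exp_term u m (Suc n) = (fls_const (1 / fact (Suc n)) * of_nat (Suc n)) * (?c ^ n * coeff u m)"
        unfolding em by (simp only: diff_Suc_1 mult.assoc)
      ultimately show ?thesis unfolding e0 by (simp only: mult_ac)
    qed
    have "m \<noteq> {#}" using assms(2) less.prems by (auto simp: add_closed_def)
    then have "exp_term u m 0 = 0" by (simp add: exp_term_def coeff_1)
    moreover have "exp_term u m sums coeff z m" using assms(1) by (simp add: exp_sums_def)
    ultimately have "(\<lambda>n. exp_term u m (Suc n)) sums 0"
      using fls_sums_Suc suppD[OF assms(3) less.prems] by metis
    moreover have "(\<lambda>n. exp_term u m (Suc n)) sums (coeff u m * coeff z {#})"
      unfolding em_Suc by (rule fls_sums_mult) (use assms(1) in \<open>simp add: exp_sums_def\<close>)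
    ultimately have "coeff u m * coeff z {#} = 0" using sums_unique2 by metis
    \<comment> \<open>The constant term of \<open>z\<close> can be cancelled because
      \<open>exp (- u)\<close> converges as well and inverts it.\<close>
    moreover have "coeff (sexp (- u)) {#} * coeff z {#} = 1"
      using arg_cong[OF sexp_minus_mult[OF conv], of "\<lambda>f. coeff f {#}"] exp_sums_eq[OF assms(1)]
      by (simp add: coeff_mult_empty coeff_1)
    ultimately show ?case by auto
  qed
qed

section \<open>Gaussian means\<close>

lemma finlin_map_add: "finlin T \<Longrightarrow> T (f + g) = T f + T g"
proof (rule sfun_eqI)
  fix m assume "finlin T"
  then obtain S c where "\<And>f. coeff (T f) m = (\<Sum>a\<in>S. c a * coeff f a)"
    unfolding finlin_def by metis
  then show "coeff (T (f + g)) m = coeff (T f + T g) m"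
    by (simp add: distrib_left sum.distrib)
qed

lemma finlin_map_sconst: "finlin T \<Longrightarrow> T (sconst c * f) = sconst c * T f"
proof (rule sfun_eqI)
  fix m assume "finlin T"
  then obtain S d where "\<And>f. coeff (T f) m = (\<Sum>a\<in>S. d a * coeff f a)"
    unfolding finlin_def by metis
  then show "coeff (T (sconst c * f)) m = coeff (sconst c * T f) m"
    by (simp add: coeff_sconst_mult sum_distrib_left mult.left_commute)
qed

lemma finlin_map_scaleR: "finlin T \<Longrightarrow> T (r *\<^sub>R f) = r *\<^sub>R T f"
  using finlin_map_sconst[of T "fls_const r"] by (simp add: sconst_fls_const)

lemma finlin_map_0: "finlin T \<Longrightarrow> T 0 = 0"
  using finlin_map_scaleR[of T 0 0] by simp

lemma finlin_map_sum: "finlin T \<Longrightarrow> T (sum f S) = (\<Sum>i\<in>S. T (f i))"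
  by (induction S rule: infinite_finite_induct) (auto simp: finlin_map_0 finlin_map_add)

lemma hbar_commute: "f * hbar = hbar * f" "f * hbar_inv = hbar_inv * f"
  by (simp_all add: hbar_def hbar_inv_def sconst_commute)

lemma hbar_left_commute: "f * (hbar * g) = hbar * (f * g)" "f * (hbar_inv * g) = hbar_inv * (f * g)"
  by (metis hbar_commute(1) mult.assoc, metis hbar_commute(2) mult.assoc)

lemma finlin_map_hbar: "finlin T \<Longrightarrow> T (hbar * f) = hbar * T f" "finlin T \<Longrightarrow> T (hbar_inv * f) = hbar_inv * T f"
  by (simp_all add: hbar_def hbar_inv_def finlin_map_sconst)

lemma parity_hbar: "parity (hbar * f) = hbar * parity f" "parity (hbar_inv * f) = hbar_inv * parity f"
  by (simp_all add: hbar_def hbar_inv_def parity_mult)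

text \<open>The chain rule, using the Leibniz rule only for a left factor \<open>u\<close>. Since
  \<open>u\<close> is even, graded partial derivatives satisfy it without signs, so the lemma serves
  both these and the colour rotations.\<close>

lemma deriv_sexp:
  assumes "finlin D" "D 1 = 0" "\<And>f. D (u * f) = D u * f + u * D f" "parity u = u" "exp_conv u"
  shows "D (sexp u) = D u * sexp u"
proof -
  have comm: "u * f = f * u" for f using even_commute[OF assms(4)] .
  have pow: "D (u ^ Suc n) = real (Suc n) *\<^sub>R (D u * u ^ n)" for n
  proof (induction n)
    case 0
    then show ?case using assms(3)[of 1] by (simp add: assms(2))
  next
    case (Suc n)
    have "D (u ^ Suc (Suc n)) = D u * u ^ Suc n + u * D (u ^ Suc n)"
      unfolding power_Suc[of u "Suc n"] by (rule assms(3))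
    also have "u * D (u ^ Suc n) = real (Suc n) *\<^sub>R (u * D u * u ^ n)"
      unfolding Suc.IH by (simp add: mult.assoc)
    also have "u * D u * u ^ n = D u * u ^ Suc n"
      unfolding comm[of "D u"] by (simp add: mult.assoc)
    moreover have "real (Suc (Suc n)) = 1 + real (Suc n)" by simp
    ultimately show ?case by (simp only: scaleR_add_left scaleR_one)
  qed
  have "ssums (\<lambda>n. D ((1 / fact n) *\<^sub>R u ^ n)) (D (sexp u))"
    by (rule ssums_finlin[OF assms(1) exp_conv_ssums[OF assms(5)]])
  then have "ssums (\<lambda>n. D ((1 / fact (Suc n)) *\<^sub>R u ^ Suc n)) (D (sexp u))"
    by (rule ssums_Suc) (simp add: assms(2))
  moreover have "D ((1 / fact (Suc n)) *\<^sub>R u ^ Suc n) = D u * ((1 / fact n) *\<^sub>R u ^ n)" for n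
    by (simp add: finlin_map_scaleR[OF assms(1)] pow del: power_Suc of_nat_Suc)
  moreover have "ssums (\<lambda>n. D u * ((1 / fact n) *\<^sub>R u ^ n)) (D u * sexp u)"
    by (rule ssums_finlin[OF finlin_mult_left exp_conv_ssums[OF assms(5)]])
  ultimately show ?thesis using ssums_unique by simp
qed

text \<open>A coordinate has weight 2 and \<open>\<hbar>\<close> has weight 5, so that both \<open>1/\<hbar>\<close> times a cubic function and
  \<open>\<hbar>\<close> times a second derivative raise the weight: every perturbative series converges in the
  weight filtration.\<close>

definition wdeg :: "int \<Rightarrow> fvar multiset \<Rightarrow> int" where
  "wdeg N m = (N - 2 * int (size m) + 4) div 5"

definition wt :: "int \<Rightarrow> sfun \<Rightarrow> bool" where
  "wt N f \<longleftrightarrow> (\<forall>m. fls_ge (wdeg N m) (coeff f m))"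

lemma wdeg_mono: "M \<le> N \<Longrightarrow> wdeg M m \<le> wdeg N m"
  by (auto simp: wdeg_def intro!: zdiv_mono1)

text \<open>\<open>wdeg N m\<close> is \<open>(N - 2 * size m) / 5\<close> rounded up, the least
  power of \<hbar> that lifts the monomial \<open>m\<close> to weight \<open>N\<close>, and rounding
  up is subadditive.\<close>

lemma wdeg_add: "wdeg (M + N) (a + b) \<le> wdeg M a + wdeg N b"
proof -
  have "(x + y + 4) div 5 \<le> (x + 4) div 5 + (y + 4) div 5" for x y :: int by presburger
  from this[of "M - 2 * int (size a)" "N - 2 * int (size b)"] show ?thesis
    by (simp add: wdeg_def algebra_simps)
qed

lemma wt_mono: "wt N f \<Longrightarrow> M \<le> N \<Longrightarrow> wt M f"
  unfolding wt_def using fls_ge_mono wdeg_mono by blast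

lemma wt_0 [simp]: "wt N 0" by (simp add: wt_def)

lemma wt_add: "wt N f \<Longrightarrow> wt N g \<Longrightarrow> wt N (f + g)"
  by (simp add: wt_def fls_ge_add)

lemma wt_sum: "(\<And>i. i \<in> S \<Longrightarrow> wt N (f i)) \<Longrightarrow> wt N (sum f S)"
  by (induction S rule: infinite_finite_induct) (auto intro: wt_add)

lemma wt_scaleR: "wt N f \<Longrightarrow> wt N (r *\<^sub>R f)"
  using fls_ge_mult[OF fls_ge_const] by (fastforce simp: wt_def)

lemma wt_coeff_mult:
  assumes "\<And>a. a \<subseteq># m \<Longrightarrow> fls_ge (wdeg M a) (coeff f a)" "\<And>b. b \<subseteq># m \<Longrightarrow> fls_ge (wdeg N b) (coeff g b)"
  shows "fls_ge (wdeg (M + N) m) (coeff (f * g) m)"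
  unfolding coeff_mult
proof (rule fls_ge_sum)
  fix p assume p: "p \<in> splits m"
  obtain a b where ab: "p = (a, b)" by fastforce
  then have m: "a + b = m" using p by simp
  have "fls_ge (wdeg M a + wdeg N b) (coeff f a * coeff g b)"
    using m by (intro fls_ge_mult assms) auto
  then have "fls_ge (wdeg (M + N) m) (coeff f a * coeff g b)"
    using wdeg_add[of M N a b] m fls_ge_mono by blast
  from fls_ge_mult[OF fls_ge_of_int this] show
    "fls_ge (wdeg (M + N) m) (case p of (a, b) \<Rightarrow> of_int (mono_sign a b) * coeff f a * coeff g b)"
    by (simp add: ab mult.assoc)
qed

lemma wt_mult: "wt M f \<Longrightarrow> wt N g \<Longrightarrow> wt (M + N) (f * g)"
  using wt_coeff_mult unfolding wt_def by blast

lemma wt_1: "wt 0 1"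
  by (auto simp: wt_def wdeg_def coeff_1 fls_ge_def)

lemma wt_power: "wt 0 f \<Longrightarrow> wt 0 (f ^ n)"
  by (induction n) (auto simp: wt_1 dest: wt_mult)

lemma wt_svar: "wt 2 (svar v)"
  by (auto simp: wt_def wdeg_def coeff_svar fls_ge_def)

lemma wt_hbar: "wt 5 hbar"
  by (auto simp: wt_def wdeg_def hbar_def coeff_sconst fls_ge_X)

lemma wt_hbar_inv: "wt (- 5) hbar_inv"
  by (auto simp: wt_def wdeg_def hbar_inv_def coeff_sconst intro: fls_ge_mono[OF fls_ge_X_inv])

lemma wt_hbar_mult: "wt N f \<Longrightarrow> wt (N + 5) (hbar * f)"
  using wt_mult[OF wt_hbar] by (simp add: add.commute)

lemma wt_hbar_inv_mult: "wt N f \<Longrightarrow> wt (N - 5) (hbar_inv * f)"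
  using wt_mult[OF wt_hbar_inv, of N f] by simp

lemma wt_deriv_at:
  assumes "wt N f"
  shows "wt (N - 2) (deriv_at v f)"
  unfolding wt_def
proof
  fix m
  have "fls_ge (wdeg N (add_mset v m)) (coeff f (add_mset v m))" using assms by (simp add: wt_def)
  then have "fls_ge (wdeg (N - 2) m) (coeff f (add_mset v m))" by (simp add: wdeg_def algebra_simps)
  from fls_ge_mult[OF fls_ge_mult[OF fls_ge_of_int fls_ge_of_nat] this]
  show "fls_ge (wdeg (N - 2) m) (coeff (deriv_at v f) m)" by (simp only: coeff_deriv_at add_0)
qed

lemma wt_ssums: "ssums x s \<Longrightarrow> (\<And>n. wt N (x n)) \<Longrightarrow> wt N s"
  unfolding wt_def ssums_def using fls_ge_sums by blast

lemma wt_sexp: "exp_conv u \<Longrightarrow> wt 0 u \<Longrightarrow> wt 0 (sexp u)"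
  by (rule wt_ssums[OF exp_conv_ssums]) (auto intro: wt_scaleR wt_power)

lemma ssums_single: "ssums (\<lambda>n. if n = 0 then f else 0) f"
  unfolding ssums_def
proof
  fix m
  have "(\<lambda>n :: nat. coeff (if n = 0 then f else 0) m) = (\<lambda>n. if n = 0 then coeff f m else 0)" by auto
  then show "(\<lambda>n. coeff (if n = 0 then f else 0) m) sums coeff f m"
    using sums_single[of 0 "\<lambda>_. coeff f m"] by (simp only:)
qed

lemma wt_sexp_minus_1:
  assumes "exp_conv u" "wt 1 u"
  shows "wt 1 (sexp u - 1)"
proof -
  have "ssums (\<lambda>n. (1 / fact n) *\<^sub>R u ^ n + (if n = 0 then - 1 else 0)) (sexp u + - 1)"
    by (intro ssums_add exp_conv_ssums ssums_single assms)
  moreover have "wt 1 ((1 / fact n) *\<^sub>R u ^ n + (if n = 0 then - 1 else 0))" for n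
  proof (cases n)
    case (Suc k)
    have "wt (1 + 0) (u * u ^ k)"
      using assms(2) by (intro wt_mult wt_power) (auto intro: wt_mono)
    then show ?thesis by (simp add: Suc wt_scaleR)
  qed simp
  ultimately have "wt 1 (sexp u + - 1)" by (rule wt_ssums)
  then show ?thesis by simp
qed

lemma finite_subseteq_mset: "finite {a. a \<subseteq># m}"
proof (rule finite_subset)
  show "{a. a \<subseteq># m} \<subseteq> fst ` splits m"
  proof
    fix a assume "a \<in> {a. a \<subseteq># m}"
    then have "(a, m - a) \<in> splits m" by simp
    then show "a \<in> fst ` splits m" by (metis fst_conv imageI)
  qed
qed simp

text \<open>As \<open>y = 1 - y * (z - 1)\<close>, a bound \<open>N\<close> on the weight of
  \<open>y\<close> improves to \<open>min 0 (N + 1)\<close>. No bound for all of \<open>y\<close> is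
  known at the start, so the iteration runs on the finitely many submultisets of one
  \<open>m\<close>.\<close>

lemma wt_inverse:
  assumes "y * z = 1" "wt 1 (z - 1)"
  shows "wt 0 y"
  unfolding wt_def
proof
  fix m
  let ?P = "\<lambda>N. \<forall>a. a \<subseteq># m \<longrightarrow> fls_ge (wdeg N a) (coeff y a)"
  have y: "y = 1 - y * (z - 1)" using assms(1) by (simp add: right_diff_distrib)
  have step: "?P (min 0 (N + 1))" if "?P N" for N
  proof (intro allI impI)
    fix a assume a: "a \<subseteq># m"
    have "fls_ge (wdeg (N + 1) a) (coeff (y * (z - 1)) a)"
    proof (rule wt_coeff_mult)
      fix b assume "b \<subseteq># a"
      then show "fls_ge (wdeg N b) (coeff y b)" using that a subset_mset.trans by blast
    qed (use assms(2) in \<open>simp add: wt_def\<close>)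
    moreover have "fls_ge (wdeg 0 a) (coeff 1 a)" using wt_1 by (simp add: wt_def)
    ultimately have "fls_ge (wdeg (min 0 (N + 1)) a) (coeff 1 a - coeff (y * (z - 1)) a)"
      by (intro fls_ge_diff) (metis fls_ge_mono wdeg_mono min.cobounded1 min.cobounded2)+
    then show "fls_ge (wdeg (min 0 (N + 1)) a) (coeff y a)"
      by (subst y) simp
  qed
  \<comment> \<open>The shift by 4 absorbs the rounding in \<open>wdeg\<close>, so that
    \<open>wdeg N0 a\<close> is at most the order of the coefficient of \<open>y\<close> at
    \<open>a\<close>.\<close>
  define N0 where "N0 = Min ((\<lambda>a. 5 * fls_subdegree (coeff y a) + 2 * int (size a) - 4) ` {a. a \<subseteq># m})"
  have N0: "?P N0"
  proof (intro allI impI)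
    fix a assume "a \<subseteq># m"
    then have "N0 \<le> 5 * fls_subdegree (coeff y a) + 2 * int (size a) - 4"
      unfolding N0_def by (intro Min_le finite_imageI finite_subseteq_mset) auto
    then have "wdeg N0 a \<le> fls_subdegree (coeff y a)"
      unfolding wdeg_def by simp
    then show "fls_ge (wdeg N0 a) (coeff y a)" using fls_ge_mono fls_ge_subdegree by blast
  qed
  have "?P (min 0 (min 0 N0 + int n))" for n
  proof (induction n)
    case 0
    have "min 0 (min 0 N0 + int 0) \<le> N0" by simp
    then show ?case using N0 fls_ge_mono wdeg_mono by blast
  next
    case (Suc n)
    have "min 0 (min 0 (min 0 N0 + int n) + 1) = min 0 (min 0 N0 + int (Suc n))" by auto
    then show ?case using step[OF Suc.IH] by simp
  qed
  from this[of "nat (- N0)"] show "fls_ge (wdeg 0 m) (coeff y m)"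
    by (cases "N0 \<le> 0") auto
qed

text \<open>Negative powers of \<hbar> occur only in terms of weight at least \<open>N\<close>, i.e.
  \<open>f\<close> is integral up to weight \<open>N\<close>. Unlike full integrality this holds
  trivially for small \<open>N\<close> and can be proved by induction.\<close>

definition integ :: "int \<Rightarrow> sfun \<Rightarrow> bool" where
  "integ N f \<longleftrightarrow> (\<forall>m. fls_ge (min 0 (wdeg N m)) (coeff f m))"

lemma wt_integ: "wt N f \<Longrightarrow> integ N f"
  unfolding wt_def integ_def by (auto intro: fls_ge_mono)

lemma integ_0 [simp]: "integ N 0" by (simp add: integ_def)

lemma integ_add: "integ N f \<Longrightarrow> integ N g \<Longrightarrow> integ N (f + g)"
  by (simp add: integ_def fls_ge_add)

lemma integ_sum: "(\<And>i. i \<in> S \<Longrightarrow> integ N (f i)) \<Longrightarrow> integ N (sum f S)"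
  by (induction S rule: infinite_finite_induct) (auto intro: integ_add)

lemma integ_scaleR: "integ N f \<Longrightarrow> integ N (r *\<^sub>R f)"
  using fls_ge_mult[OF fls_ge_const] by (fastforce simp: integ_def)

lemma integ_hbar: "integ N f \<Longrightarrow> integ (N + 5) (hbar * f)"
  unfolding integ_def
proof
  fix m
  assume "\<forall>m. fls_ge (min 0 (wdeg N m)) (coeff f m)"
  then have "fls_ge (1 + min 0 (wdeg N m)) (coeff (hbar * f) m)"
    unfolding hbar_def coeff_sconst_mult using fls_ge_mult[OF fls_ge_X] by blast
  then show "fls_ge (min 0 (wdeg (N + 5) m)) (coeff (hbar * f) m)"
    by (rule fls_ge_mono) (simp add: wdeg_def)
qed

lemma integ_svar: "integ N f \<Longrightarrow> integ (N + 2) (svar v * f)"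
  unfolding integ_def
proof
  fix m
  assume f: "\<forall>m. fls_ge (min 0 (wdeg N m)) (coeff f m)"
  show "fls_ge (min 0 (wdeg (N + 2) m)) (coeff (svar v * f) m)"
  proof (cases "v \<in># m")
    case True
    then obtain n where m: "m = add_mset v n" by (blast dest: multi_member_split)
    have "fls_ge (0 + min 0 (wdeg N n)) (of_int (mono_sign {#v#} n) * coeff f n)"
      using f by (intro fls_ge_mult fls_ge_of_int) auto
    then show ?thesis by (simp add: m coeff_svar_mult wdeg_def algebra_simps)
  qed (simp add: coeff_svar_mult)
qed

text \<open>A term in the monomial \<open>m\<close> with a negative power of \<hbar> has weight
  below \<open>2 * size m\<close>, so this one value of \<open>N\<close> decides the
  coefficient.\<close>

lemma integ_all:
  assumes "\<And>N. integ N f"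
  shows "fls_ge 0 (coeff f m)"
proof -
  have "fls_ge (min 0 (wdeg (2 * int (size m)) m)) (coeff f m)" using assms by (simp add: integ_def)
  then show ?thesis by (simp add: wdeg_def)
qed

lift_definition at_zero :: "fvar set \<Rightarrow> sfun \<Rightarrow> sfun" is
  "\<lambda>V f m. if set_mset m \<inter> V = {} then f m else 0"
  by simp

lemma coeff_at_zero: "coeff (at_zero V f) m = (if set_mset m \<inter> V = {} then coeff f m else 0)"
  by (simp add: at_zero.rep_eq)

lemma finlin_at_zero: "finlin (at_zero V)"
  by (rule finlin_diagonal[of _ "\<lambda>m. if set_mset m \<inter> V = {} then 1 else 0"]) (simp add: coeff_at_zero)

lemma at_zero_svar_mult: "v \<in> V \<Longrightarrow> at_zero V (svar v * f) = 0"
  by (rule sfun_eqI) (auto simp: coeff_at_zero coeff_svar_mult)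

lemma at_zero_Fun_mult:
  assumes "f \<in> Fun (- V)"
  shows "at_zero V (f * g) = f * at_zero V g"
proof (rule sfun_eqI)
  fix m
  have "(if set_mset m \<inter> V = {} then coeff f a * coeff g b else 0) = coeff f a * coeff (at_zero V g) b"
    if "a + b = m" for a b
  proof (cases "coeff f a = 0")
    case False
    then have "set_mset a \<inter> V = {}" using assms by (auto simp: Fun_def)
    then have "set_mset m \<inter> V = {} \<longleftrightarrow> set_mset b \<inter> V = {}" using that by auto
    then show ?thesis by (simp add: coeff_at_zero)
  qed simp
  note * = this
  have "(if set_mset m \<inter> V = {} then of_int (mono_sign a b) * coeff f a * coeff g b else 0)
      = of_int (mono_sign a b) * coeff f a * coeff (at_zero V g) b"
    if "a + b = m" for a b
  proof -
    have "(if set_mset m \<inter> V = {} then of_int (mono_sign a b) * coeff f a * coeff g b else 0)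
      = of_int (mono_sign a b) * (if set_mset m \<inter> V = {} then coeff f a * coeff g b else 0)"
      by (simp add: mult.assoc)
    then show ?thesis unfolding *[OF that] by (simp only: mult.assoc)
  qed
  then have "(\<Sum>(a, b)\<in>splits m. if set_mset m \<inter> V = {} then of_int (mono_sign a b) * coeff f a * coeff g b else 0)
     = coeff (f * at_zero V g) m"
    unfolding coeff_mult by (intro sum.cong) auto
  then show "coeff (at_zero V (f * g)) m = coeff (f * at_zero V g) m"
    by (cases "set_mset m \<inter> V = {}") (simp_all add: coeff_at_zero coeff_mult case_prod_beta)
qed

section \<open>Wick's formula as a convergent series\<close>

definition bnd :: "sfun \<Rightarrow> bool" where
  "bnd f \<longleftrightarrow> (\<exists>N. wt N f)"

lemma ssums_SucI:
  assumes "ssums (\<lambda>n. x (Suc n)) s" "x 0 = 0"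
  shows "ssums x s"
  unfolding ssums_def sums_def
proof
  fix m
  have "(\<lambda>n. \<Sum>i<n. coeff (x (Suc i)) m) \<longlonglongrightarrow> coeff s m"
    using assms(1) by (simp add: ssums_def sums_def)
  then have "(\<lambda>n. \<Sum>i<Suc n. coeff (x i) m) \<longlonglongrightarrow> coeff s m"
    by (simp add: sum.lessThan_Suc_shift assms(2) del: sum.lessThan_Suc)
  then show "(\<lambda>n. \<Sum>i<n. coeff (x i) m) \<longlonglongrightarrow> coeff s m"
    by (rule LIMSEQ_imp_Suc)
qed

text \<open>All that the calculus uses of the Gaussian: the inverse Hessian is real, hence free of
  \<hbar>, and it connects coordinates of opposite ghost number, hence of equal parity.\<close>

locale propagator =
  fixes V :: "fvar set" and Q :: sfun and r :: "fvar \<Rightarrow> fvar \<Rightarrow> real"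
  assumes finite_V: "finite V"
    and inverse_hessian: "inverse_hessian V Q = (\<lambda>x y. fls_const (r x y))"
    and r_ghost: "\<And>x y. r x y \<noteq> 0 \<Longrightarrow> ghost x + ghost y = 0"
begin

abbreviation "wk \<equiv> wick V Q"
abbreviation "gm \<equiv> gauss_mean V Q"

lemma r_odd: "r x y \<noteq> 0 \<Longrightarrow> odd_var x \<longleftrightarrow> odd_var y"
  using r_ghost by (metis even_add even_zero)

lemma wick_eq: "wk P = (- 1 / 2) *\<^sub>R (hbar * (\<Sum>x\<in>V. \<Sum>y\<in>V. r x y *\<^sub>R deriv_at y (deriv_at x P)))"
  by (simp add: wick_def inverse_hessian sconst_fls_const)

lemma finlin_wick: "finlin wk"
  unfolding wick_eq[abs_def]
  by (intro finlin_compose[OF finlin_scaleR] finlin_compose[OF finlin_mult_left] finlin_sum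
      finlin_compose[OF finlin_deriv_at] finlin_deriv_at)

lemma finlin_wick_pow: "finlin (wk ^^ n)"
  by (induction n) (auto simp: finlin_id o_def id_def intro: finlin_compose[OF finlin_wick])

definition wick_term :: "nat \<Rightarrow> sfun \<Rightarrow> sfun" where
  "wick_term n P = (1 / fact n) *\<^sub>R (wk ^^ n) P"

lemma finlin_wick_term: "finlin (wick_term n)"
  unfolding wick_term_def[abs_def] by (intro finlin_compose[OF finlin_scaleR] finlin_wick_pow)

lemma wt_wick: "wt N P \<Longrightarrow> wt (N + 1) (wk P)"
proof -
  assume P: "wt N P"
  have "wt (N - 2 - 2 + 5) (wk P)"
    unfolding wick_eq by (intro wt_scaleR wt_hbar_mult wt_sum wt_deriv_at P)
  then show ?thesis by (rule wt_mono) simp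
qed

lemma wt_wick_term: "wt N P \<Longrightarrow> wt (N + int n) (wick_term n P)"
proof -
  assume P: "wt N P"
  have "wt (N + int n) ((wk ^^ n) P)"
  proof (induction n)
    case (Suc n)
    from wt_wick[OF this] show ?case by (simp add: algebra_simps)
  qed (use P in simp)
  then show ?thesis by (simp add: wick_term_def wt_scaleR)
qed

lemma gauss_meanI:
  assumes "ssums (\<lambda>n. at_zero V (wick_term n P)) z"
  shows "gm P = z"
proof (rule sfun_eqI)
  fix m
  have z: "(\<lambda>n. coeff (at_zero V (wick_term n P)) m) sums coeff z m" using assms by (simp add: ssums_def)
  show "coeff (gm P) m = coeff z m"
  proof (cases "set_mset m \<inter> V = {}")
    case True
    then have "(\<lambda>n. coeff ((1 / fact n) *\<^sub>R (wk ^^ n) P) m) sums coeff z m"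
      using z by (simp add: coeff_at_zero wick_term_def)
    then show ?thesis using True by (simp add: gauss_mean.rep_eq sums_iff)
  next
    case False
    then have "coeff z m = 0" using z sums_unique2[OF sums_zero] by (simp add: coeff_at_zero)
    then show ?thesis using False by (simp add: gauss_mean.rep_eq)
  qed
qed

text \<open>The \<open>n\<close>-th Wick term has weight at least \<open>N + n\<close>. In a fixed
  monomial this forces its order in \<hbar> to infinity.\<close>

lemma gauss_ssums:
  assumes "bnd P"
  shows "ssums (\<lambda>n. at_zero V (wick_term n P)) (gm P)"
proof -
  obtain N where N: "wt N P" using assms by (auto simp: bnd_def)
  have null: "fls_null (\<lambda>n. coeff (at_zero V (wick_term n P)) m)" for m
    unfolding fls_null_def
  proof
    fix k
    have "fls_ge k (coeff (at_zero V (wick_term n P)) m)" if "n \<ge> nat (5 * k + 2 * int (size m) - N)" for n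
    proof -
      have "fls_ge (wdeg (N + int n) m) (coeff (wick_term n P) m)" using wt_wick_term[OF N] by (simp add: wt_def)
      moreover have "k \<le> wdeg (N + int n) m" using that by (simp add: wdeg_def)
      ultimately show ?thesis by (auto simp: coeff_at_zero intro: fls_ge_mono)
    qed
    then show "\<exists>n0. \<forall>n\<ge>n0. fls_ge k (coeff (at_zero V (wick_term n P)) m)" by blast
  qed
  define z where "z = Abs_sfun (\<lambda>m. suminf (\<lambda>n. coeff (at_zero V (wick_term n P)) m))"
  have "coeff z m = suminf (\<lambda>n. coeff (at_zero V (wick_term n P)) m)" for m
    unfolding z_def by (subst Abs_sfun_inverse) (auto simp: coeff_not_admissible)
  then have "ssums (\<lambda>n. at_zero V (wick_term n P)) z"
    by (simp add: ssums_def fls_null_imp_suminf null)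
  then show ?thesis using gauss_meanI by metis
qed

lemma gauss_add: "bnd P \<Longrightarrow> bnd P' \<Longrightarrow> gm (P + P') = gm P + gm P'"
  by (rule gauss_meanI)
     (simp add: finlin_map_add[OF finlin_wick_term] finlin_map_add[OF finlin_at_zero] ssums_add gauss_ssums)

text \<open>Scalars, factors independent of \<open>V\<close> and colour rotations all pass through
  the mean for the same reason: they commute with the Wick operator and with the restriction to
  \<open>V = 0\<close>.\<close>

lemma gauss_commute:
  assumes "bnd P" "finlin T" "\<And>P. wk (U P) = U (wk P)" "\<And>r P. U (r *\<^sub>R P) = r *\<^sub>R U P"
    "\<And>P. at_zero V (U P) = T (at_zero V P)"
  shows "gm (U P) = T (gm P)"
proof (rule gauss_meanI)
  have "(wk ^^ n) (U P) = U ((wk ^^ n) P)" for n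
    by (induction n) (auto simp: assms(3))
  then have "at_zero V (wick_term n (U P)) = T (at_zero V (wick_term n P))" for n
    by (simp add: wick_term_def assms(5) flip: assms(4))
  then show "ssums (\<lambda>n. at_zero V (wick_term n (U P))) (T (gm P))"
    using ssums_finlin[OF assms(2) gauss_ssums[OF assms(1)]] by simp
qed

lemma gauss_scaleR: "bnd P \<Longrightarrow> gm (c *\<^sub>R P) = c *\<^sub>R gm P"
  by (rule gauss_commute)
     (auto simp: finlin_scaleR finlin_map_scaleR[OF finlin_wick] finlin_map_scaleR[OF finlin_at_zero])

lemma gauss_hbar: "bnd P \<Longrightarrow> gm (hbar * P) = hbar * gm P"
  by (rule gauss_commute)
     (auto simp: finlin_mult_left finlin_map_hbar[OF finlin_wick] finlin_map_hbar[OF finlin_at_zero])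

text \<open>Propagators connect coordinates of equal parity, so the signs of the two derivatives
  passing \<open>f\<close> cancel, whatever the parity of \<open>f\<close>.\<close>

lemma wick_Fun_mult:
  assumes "f \<in> Fun (- V)"
  shows "wk (f * P) = f * wk P"
proof -
  have d: "deriv_at x (twist y f) = 0" "deriv_at x f = 0" if "x \<in> V" for x y
    using deriv_at_eq_0[OF assms, of x] that by (simp_all add: deriv_at_twist) (simp_all add: twist_def)
  have "r x y *\<^sub>R deriv_at y (deriv_at x (f * P)) = f * (r x y *\<^sub>R deriv_at y (deriv_at x P))"
    if "x \<in> V" "y \<in> V" for x y
  proof (cases "r x y = 0")
    case False
    then have "twist y (twist x f) = f" using r_odd by (auto simp: twist_def)
    then show ?thesis using that by (simp add: deriv_at_mult d)
  qed simp
  then have "(\<Sum>x\<in>V. \<Sum>y\<in>V. r x y *\<^sub>R deriv_at y (deriv_at x (f * P)))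
      = f * (\<Sum>x\<in>V. \<Sum>y\<in>V. r x y *\<^sub>R deriv_at y (deriv_at x P))"
    unfolding sum_distrib_left by (intro sum.cong refl)
  then show ?thesis by (simp add: wick_eq hbar_left_commute)
qed

lemma gauss_Fun_mult: "f \<in> Fun (- V) \<Longrightarrow> bnd P \<Longrightarrow> gm (f * P) = f * gm P"
  by (rule gauss_commute) (simp_all add: finlin_mult_left wick_Fun_mult at_zero_Fun_mult)

lemma wt_gauss: "wt N P \<Longrightarrow> wt N (gm P)"
proof (rule wt_ssums[OF gauss_ssums])
  fix n assume "wt N P"
  then have "wt N (wick_term n P)" by (rule wt_mono[OF wt_wick_term]) simp
  then show "wt N (at_zero V (wick_term n P))" by (auto simp: wt_def coeff_at_zero)
qed (auto simp: bnd_def)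

lemma gauss_1: "gm 1 = 1"
proof (rule gauss_meanI)
  have "wk 1 = 0" by (simp add: wick_eq)
  then have "(wk ^^ n) 1 = (if n = 0 then 1 else 0)" for n
    by (induction n) (auto simp: finlin_map_0[OF finlin_wick])
  moreover have "at_zero V 1 = 1"
    by (rule sfun_eqI) (simp add: coeff_at_zero coeff_1)
  ultimately have "at_zero V (wick_term n 1) = (if n = 0 then 1 else 0)" for n
    by (simp add: wick_term_def finlin_map_0[OF finlin_at_zero])
  then show "ssums (\<lambda>n. at_zero V (wick_term n 1)) 1" using ssums_single[of 1] by simp
qed

text \<open>The Wick operator only removes pairs of coordinates of opposite ghost number, so a set
  of monomials closed under such removals is preserved. This yields conservation of ghost
  number.\<close>

lemma supp_gauss:
  assumes "P \<in> supp S" "bnd P"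
    "\<And>x y m. x \<in> V \<Longrightarrow> y \<in> V \<Longrightarrow> ghost x + ghost y = 0 \<Longrightarrow> add_mset x (add_mset y m) \<in> S \<Longrightarrow> m \<in> S"
  shows "gm P \<in> supp (S \<inter> {m. set_mset m \<inter> V = {}})"
proof (rule supp_ssums[OF gauss_ssums[OF assms(2)]])
  have "wk P' \<in> supp S" if "P' \<in> supp S" for P'
  proof -
    have "r x y *\<^sub>R deriv_at y (deriv_at x P') \<in> supp S" if "x \<in> V" "y \<in> V" for x y
    proof (cases "r x y = 0")
      case False
      have "deriv_at x P' \<in> supp {m. add_mset x m \<in> S}"
        by (rule supp_deriv_at[OF \<open>P' \<in> supp S\<close>]) simp
      then have "deriv_at y (deriv_at x P') \<in> supp S"
        by (rule supp_deriv_at) (use assms(3)[OF that r_ghost[OF False]] in simp)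
      then show ?thesis by (rule supp_scaleR)
    qed simp
    then show ?thesis unfolding wick_eq hbar_def
      by (intro supp_scaleR supp_sconst_mult, intro supp_sum)
  qed
  then have "(wk ^^ n) P \<in> supp S" for n by (induction n) (auto simp: assms(1))
  then have "wick_term n P \<in> supp S" for n by (simp add: wick_term_def supp_scaleR)
  then show "at_zero V (wick_term n P) \<in> supp (S \<inter> {m. set_mset m \<inter> V = {}})" for n
    by (auto simp: supp_def coeff_at_zero)
qed

text \<open>The commutator of the Wick operator with multiplication by \<open>svar z\<close>. Both
  \<open>r z y\<close> and \<open>r y z\<close> appear because the Wick sum runs over ordered pairs
  and \<open>r\<close> is not assumed to be symmetric.\<close>

definition contract :: "fvar \<Rightarrow> sfun \<Rightarrow> sfun" where
  "contract z P = (- 1 / 2) *\<^sub>R (hbar * (\<Sum>y\<in>V. (r z y + vsgn y z * r y z) *\<^sub>R deriv_at y P))"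

lemma wick_svar_mult:
  assumes "z \<in> V"
  shows "wk (svar z * P) = svar z * wk P + contract z P"
proof -
  have "r x y *\<^sub>R deriv_at y (deriv_at x (svar z * P)) =
      (if x = z then r x y *\<^sub>R deriv_at y P else 0) + (if y = z then (vsgn x z * r x y) *\<^sub>R deriv_at x P else 0)
      + svar z * (r x y *\<^sub>R deriv_at y (deriv_at x P))" for x y
  proof (cases "r x y = 0")
    case False
    then have "vsgn x z * vsgn y z = 1" using r_odd by (auto simp: vsgn_def)
    then show ?thesis
      by (cases "x = z"; cases "y = z"; simp add: deriv_at_svar_mult scaleR_add_right mult.commute)
  qed (cases "x = z"; cases "y = z"; simp)
  then have "(\<Sum>x\<in>V. \<Sum>y\<in>V. r x y *\<^sub>R deriv_at y (deriv_at x (svar z * P)))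
    = (\<Sum>y\<in>V. r z y *\<^sub>R deriv_at y P) + (\<Sum>x\<in>V. (vsgn x z * r x z) *\<^sub>R deriv_at x P)
      + svar z * (\<Sum>x\<in>V. \<Sum>y\<in>V. r x y *\<^sub>R deriv_at y (deriv_at x P))"
    using assms finite_V
    by (simp add: sum.distrib sum_distrib_left sum.swap[of "\<lambda>x y. if x = z then _ x y else _ x y"])
  moreover have "contract z P = (- 1 / 2) *\<^sub>R (hbar * ((\<Sum>y\<in>V. r z y *\<^sub>R deriv_at y P)
      + (\<Sum>x\<in>V. (vsgn x z * r x z) *\<^sub>R deriv_at x P)))"
    by (simp add: contract_def scaleR_add_left sum.distrib)
  moreover have "c *\<^sub>R (hbar * (A + svar z * B)) = svar z * (c *\<^sub>R (hbar * B)) + c *\<^sub>R (hbar * A)" for c A B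
    by (simp add: distrib_left scaleR_add_right hbar_left_commute)
  ultimately show ?thesis by (simp only: wick_eq)
qed

lemma wick_deriv_at: "wk (deriv_at w P) = deriv_at w (wk P)"
proof -
  have "r x y *\<^sub>R deriv_at y (deriv_at x (deriv_at w P)) = r x y *\<^sub>R deriv_at w (deriv_at y (deriv_at x P))" for x y
  proof (cases "r x y = 0")
    case False
    then have "vsgn x w * vsgn y w = 1" using r_odd by (auto simp: vsgn_def)
    then show ?thesis by (simp add: deriv_at_commute[of x w] deriv_at_commute[of y w])
  qed simp
  then show ?thesis
    by (simp only: wick_eq finlin_map_hbar[OF finlin_deriv_at] deriv_at_sum deriv_at_scaleR)
qed

lemma wick_contract: "wk (contract z P) = contract z (wk P)"
  unfolding contract_def
  by (simp only: finlin_map_scaleR[OF finlin_wick] finlin_map_hbar[OF finlin_wick]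
      finlin_map_sum[OF finlin_wick] wick_deriv_at)

lemma bnd_contract: "bnd P \<Longrightarrow> bnd (contract z P)"
proof -
  assume "bnd P"
  then obtain N where "wt N P" by (auto simp: bnd_def)
  then have "wt (N - 2 + 5) (contract z P)"
    unfolding contract_def by (intro wt_scaleR wt_hbar_mult wt_sum wt_deriv_at)
  then show ?thesis by (auto simp: bnd_def)
qed

text \<open>\<open>contract z\<close> commutes with the Wick operator, so \<open>n + 1\<close>
  applications to \<open>svar z * P\<close> produce \<open>n + 1\<close> equal contractions plus a
  multiple of \<open>svar z\<close>. The latter vanishes at \<open>V = 0\<close>, and the factor
  \<open>n + 1\<close> shifts the factorial.\<close>

lemma schwinger_dyson:
  assumes "z \<in> V" "bnd P"
  shows "gm (svar z * P) = gm (contract z P)"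
proof (rule gauss_meanI, rule ssums_SucI)
  have pow: "(wk ^^ Suc n) (svar z * P) = svar z * (wk ^^ Suc n) P + real (Suc n) *\<^sub>R (wk ^^ n) (contract z P)" for n
  proof (induction n)
    case 0
    then show ?case by (simp add: wick_svar_mult assms)
  next
    case (Suc n)
    have c: "contract z ((wk ^^ n) P) = (wk ^^ n) (contract z P)" for n
      by (induction n) (auto simp flip: wick_contract)
    have "(wk ^^ Suc (Suc n)) (svar z * P) = wk (svar z * (wk ^^ Suc n) P + real (Suc n) *\<^sub>R (wk ^^ n) (contract z P))"
      using Suc.IH by simp
    also have "\<dots> = svar z * (wk ^^ Suc (Suc n)) P + (wk ^^ Suc n) (contract z P) + real (Suc n) *\<^sub>R (wk ^^ Suc n) (contract z P)"
      unfolding finlin_map_add[OF finlin_wick] finlin_map_scaleR[OF finlin_wick] wick_svar_mult[OF assms(1)]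
        c[symmetric] by (simp add: wick_contract)
    also have "\<dots> = svar z * (wk ^^ Suc (Suc n)) P + (1 + real (Suc n)) *\<^sub>R (wk ^^ Suc n) (contract z P)"
      by (simp only: scaleR_add_left scaleR_one add.assoc)
    also have "1 + real (Suc n) = real (Suc (Suc n))" by simp
    finally show ?case .
  qed
  have "at_zero V (wick_term (Suc n) (svar z * P)) = at_zero V (wick_term n (contract z P))" for n
    unfolding wick_term_def pow finlin_map_scaleR[OF finlin_at_zero] finlin_map_add[OF finlin_at_zero]
      at_zero_svar_mult[OF assms(1)]
    by (simp del: of_nat_Suc)
  then show "ssums (\<lambda>n. at_zero V (wick_term (Suc n) (svar z * P))) (gm (contract z P))"
    using gauss_ssums[OF bnd_contract[OF assms(2)]] by simp
  show "at_zero V (wick_term 0 (svar z * P)) = 0"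
    by (simp add: wick_term_def at_zero_svar_mult[OF assms(1)])
qed

end

section \<open>Dual bases from the Frobenius pairing\<close>

lemma in_span_basis:
  assumes "is_basis n e S" "x \<in> S"
  obtains c where "x = (\<Sum>j<n. c j *\<^sub>R e j)"
proof -
  have "x \<in> span (e ` {..<n})" "inj_on e {..<n}" using assms by (auto simp: is_basis_def)
  then obtain u where "x = (\<Sum>v\<in>e ` {..<n}. u v *\<^sub>R v)" by (auto simp: span_finite)
  then have "x = (\<Sum>j<n. u (e j) *\<^sub>R e j)" using \<open>inj_on e {..<n}\<close> by (simp add: sum.reindex)
  then show ?thesis by (rule that)
qed

lemma basis_in: "is_basis n e S \<Longrightarrow> j < n \<Longrightarrow> e j \<in> S"
  by (auto simp: is_basis_def intro: span_base)

text \<open>Gives the uniqueness needed by the definite description in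
  \<open>inverse_hessian\<close>: once some right inverse exists, every left inverse equals
  it.\<close>

lemma left_right_inverse_eq:
  fixes h :: "'v \<Rightarrow> 'v \<Rightarrow> 'a::comm_ring_1"
  assumes "finite V"
    and "\<And>u w. u \<in> V \<Longrightarrow> w \<in> V \<Longrightarrow> (\<Sum>v\<in>V. p u v * h v w) = (if u = w then 1 else 0)"
    and "\<And>u w. u \<in> V \<Longrightarrow> w \<in> V \<Longrightarrow> (\<Sum>v\<in>V. h u v * R v w) = (if u = w then 1 else 0)"
    and "u \<in> V" "w \<in> V"
  shows "p u w = R u w"
proof -
  have "p u w = (\<Sum>v\<in>V. p u v * (if v = w then 1 else 0))"
    using assms(1,5) by (simp add: if_distrib cong: if_cong)
  also have "\<dots> = (\<Sum>v\<in>V. p u v * (\<Sum>x\<in>V. h v x * R x w))"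
    using assms(3,5) by (intro sum.cong) auto
  also have "\<dots> = (\<Sum>x\<in>V. (\<Sum>v\<in>V. p u v * h v x) * R x w)"
    by (simp only: sum_distrib_left sum_distrib_right mult.assoc) (rule sum.swap)
  also have "\<dots> = (\<Sum>x\<in>V. (if u = x then 1 else 0) * R x w)"
    using assms(2,4) by (intro sum.cong) auto
  also have "\<dots> = R u w"
    using assms(1,4) by (simp add: if_distrib[of "\<lambda>c. c * _"] cong: if_cong)
  finally show ?thesis .
qed

section \<open>Homogeneous components and duality in the Frobenius algebra\<close>

context dg_frobenius_algebra
begin

lemmas pairing_simps [simp] =
  bilinear_ladd[OF bilinear_pairing] bilinear_radd[OF bilinear_pairing]
  bilinear_lmul[OF bilinear_pairing] bilinear_rmul[OF bilinear_pairing]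
  bilinear_lzero[OF bilinear_pairing] bilinear_rzero[OF bilinear_pairing]
  bilinear_lneg[OF bilinear_pairing] bilinear_rneg[OF bilinear_pairing]
  bilinear_lsub[OF bilinear_pairing] bilinear_rsub[OF bilinear_pairing]

lemma linear_pairing: "linear (\<lambda>x. pairing A x b)" "linear (\<lambda>x. pairing A a x)"
  using bilinear_pairing by (auto simp: bilinear_def)

lemma pairing_sum_left: "pairing A (sum f S) b = (\<Sum>i\<in>S. pairing A (f i) b)"
  using linear_sum[OF linear_pairing(1)] .

definition comp :: "nat \<Rightarrow> 'c \<Rightarrow> 'c" where
  "comp k x = (THE y. (\<forall>k. y k \<in> grade A k) \<and> x = (\<Sum>k\<le>3. y k)) k"

lemma comp_grade: "comp k x \<in> grade A k"
  and sum_comp: "(\<Sum>k\<le>3. comp k x) = x"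
  using theI'[OF direct_sum[of x]] by (auto simp: comp_def)

lemma comp_eqI:
  assumes "\<And>k. y k \<in> grade A k" "x = (\<Sum>k\<le>3. y k)"
  shows "comp k x = y k"
  using the1_equality[OF direct_sum, of y x] assms by (auto simp: comp_def)

lemma grade_0: "0 \<in> grade A k"
  using subspace_grade subspace_0 by blast

lemma linear_comp: "linear (comp k)"
proof (rule linearI)
  fix x y c
  show "comp k (x + y) = comp k x + comp k y"
    by (rule comp_eqI[of "\<lambda>k. comp k x + comp k y"])
       (simp_all add: sum.distrib sum_comp subspace_add[OF subspace_grade] comp_grade)
  show "comp k (c *\<^sub>R x) = c *\<^sub>R comp k x"
    by (rule comp_eqI[of "\<lambda>k. c *\<^sub>R comp k x"])
       (simp_all add: sum_comp subspace_scale[OF subspace_grade] comp_grade flip: scaleR_sum_right)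
qed

lemma comp_homogeneous:
  assumes "a \<in> grade A k"
  shows "comp j a = (if j = k then a else 0)"
proof (rule comp_eqI)
  show "(if j = k then a else 0) \<in> grade A j" for j using assms grade_0 by simp
  show "a = (\<Sum>j\<le>3. if j = k then a else 0)"
    using assms grade_gt_3[of k] by (cases "k \<le> 3") auto
qed

lemma grade_unique: "a \<in> grade A j \<Longrightarrow> a \<in> grade A k \<Longrightarrow> a \<noteq> 0 \<Longrightarrow> j = k"
  using comp_homogeneous[of a j j] comp_homogeneous[of a k j] by (auto split: if_splits)

lemma degree_of_eq:
  assumes "a \<in> grade A k" "a \<noteq> 0"
  shows "degree_of A a = int k"
proof -
  have "(LEAST k. a \<in> grade A k) = k"
    using assms grade_unique by (intro Least_equality) auto
  then show ?thesis by (simp add: degree_of_def)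
qed

lemma diff_0 [simp]: "diff A 0 = 0"
  using linear_diff linear_0 by blast

lemma comp_diff: "comp j (diff A x) = (case j of 0 \<Rightarrow> 0 | Suc k \<Rightarrow> diff A (comp k x))"
proof (rule comp_eqI)
  show "(case j of 0 \<Rightarrow> 0 | Suc k \<Rightarrow> diff A (comp k x)) \<in> grade A j" for j
    by (cases j) (auto simp: grade_0 diff_grade comp_grade)
  have "diff A (comp 3 x) \<in> grade A 4" using diff_grade[OF comp_grade[of 3 x]] by simp
  then have "diff A (comp 3 x) = 0" using grade_gt_3[of 4] by simp
  have "diff A x = diff A (\<Sum>k\<le>3. comp k x)" by (simp add: sum_comp)
  also have "\<dots> = (\<Sum>k\<le>3. diff A (comp k x))" by (rule linear_sum[OF linear_diff])
  also have "\<dots> = (\<Sum>k\<le>2. diff A (comp k x))"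
    using \<open>diff A (comp 3 x) = 0\<close> by (simp add: numeral_eq_Suc)
  also have "\<dots> = (\<Sum>j\<le>3. case j of 0 \<Rightarrow> 0 | Suc k \<Rightarrow> diff A (comp k x))"
    using sum.atMost_Suc_shift[of "\<lambda>j. case j of 0 \<Rightarrow> 0 | Suc k \<Rightarrow> diff A (comp k x)" 2]
    by (simp add: eval_nat_numeral del: sum.atMost_Suc)
  finally show "diff A x = (\<Sum>j\<le>3. case j of 0 \<Rightarrow> 0 | Suc k \<Rightarrow> diff A (comp k x))" .
qed

lemma pairing_comp_left: "pairing A x y = (\<Sum>k\<le>3. pairing A (comp k x) y)"
  using pairing_sum_left[of "\<lambda>k. comp k x" "{..3}" y] by (simp add: sum_comp)

lemma pairing_degree_0: "a \<in> grade A j \<Longrightarrow> b \<in> grade A k \<Longrightarrow> j + k \<noteq> 3 \<Longrightarrow> pairing A a b = 0"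
  using pairing_degree by blast

lemma pairing_cocycle_diff:
  assumes "diff A x = 0"
  shows "pairing A x (diff A y) = 0"
proof -
  have "pairing A (comp k x) (diff A y) = 0" for k
  proof -
    have "diff A (comp k x) = 0" using comp_diff[of "Suc k" x] assms
      by (simp add: linear_0[OF linear_comp])
    then show ?thesis using pairing_diff[OF comp_grade[of k x], of y] by simp
  qed
  then show ?thesis by (subst pairing_comp_left) simp
qed

text \<open>Nondegeneracy makes pairing with \<open>z\<close> an injective function of
  \<open>z\<close>; in finite dimension it then reaches every functional.\<close>

lemma riesz:
  fixes g :: "'c \<Rightarrow> real"
  assumes "linear g"
  obtains z where "\<And>b. pairing A z b = g b"
proof -
  obtain B0 where B0: "finite B0" "span B0 = (UNIV :: 'c set)" using finite_dim by blast
  obtain B where B: "B \<subseteq> B0" "independent B" "B0 \<subseteq> span B"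
    by (rule maximal_independent_subset)
  then have span_B: "span B = (UNIV :: 'c set)"
    using span_minimal[OF B(3) subspace_span] B0(2) by auto
  have "finite B" using B B0 finite_subset by blast
  interpret F: finite_dimensional_vector_space "scaleR :: real \<Rightarrow> 'c \<Rightarrow> 'c" B
    by unfold_locales (use B span_B \<open>finite B\<close> in \<open>auto simp: span_raw_def dependent_raw_def\<close>)
  \<comment> \<open>Storing the values of the functional on a basis as a vector turns the map into
    the dual into an endomorphism, for which injectivity implies surjectivity.\<close>
  define T where "T z = (\<Sum>b\<in>B. pairing A z b *\<^sub>R b)" for z
  have lin: "linear T"
    by (rule linearI) (simp_all add: T_def scaleR_add_left sum.distrib scaleR_sum_right)
  have ext: "g1 x = g2 x" if "linear g1" "linear g2" "\<And>b. b \<in> B \<Longrightarrow> g1 b = g2 b" for g1 g2 :: "'c \<Rightarrow> real" and x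
    using linear_eq_on[OF that(1,2), of x B] that(3) span_B by auto
  have "inj T"
    unfolding linear_injective_0[OF lin]
  proof (intro allI impI)
    fix z assume "T z = 0"
    then have "pairing A z b = 0" if "b \<in> B" for b
      using independentD[OF B(2) \<open>finite B\<close> order_refl, of "pairing A z"] that by (simp add: T_def)
    then have "pairing A z b = 0" for b
      using ext[OF linear_pairing(2)[of z] module_hom_zero] by simp
    then show "z = 0" using pairing_nondegenerate by blast
  qed
  then have "surj T" using F.linear_inj_imp_surj lin unfolding linear_def by blast
  then obtain z where z: "T z = (\<Sum>b\<in>B. g b *\<^sub>R b)" by (metis surj_def)
  then have "(\<Sum>b\<in>B. (pairing A z b - g b) *\<^sub>R b) = 0"
    by (simp add: T_def scaleR_diff_left sum_subtractf)
  then have "pairing A z b = g b" if "b \<in> B" for b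
    using independentD[OF B(2) \<open>finite B\<close> order_refl, of "\<lambda>b. pairing A z b - g b"] that by simp
  then have "pairing A z b = g b" for b by (rule ext[OF linear_pairing(2) assms])
  then show ?thesis by (rule that)
qed

lemma pairing_unity: "pairing A (unity A) (prd A x y) = pairing A x y"
  by (simp add: pairing_prd prd_unity)

lemma prd_unity_right: "prd A x (unity A) = x"
proof -
  have "prd A (comp k x) (unity A) = comp k x" for k
    using prd_comm[OF comp_grade[of k x] unity_grade] by (simp add: prd_unity)
  then have "prd A (\<Sum>k\<le>3. comp k x) (unity A) = (\<Sum>k\<le>3. comp k x)"
    using linear_sum[of "\<lambda>x. prd A x (unity A)" "\<lambda>k. comp k x" "{..3}"] bilinear_prd
    by (simp add: bilinear_def)
  then show ?thesis by (simp add: sum_comp)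
qed

lemma diff_unity: "diff A (unity A) = 0"
  using leibniz[OF unity_grade, of "unity A"] by (simp add: prd_unity prd_unity_right)

end

section \<open>Orthogonality relations of the Hodge decomposition\<close>

locale bv_setup = dg_frobenius_algebra A + quadratic_lie_algebra L + induction_data A I + adapted_frame A I E
  for A :: "'c::real_vector dgfa" and L :: "'g::real_vector lie"
    and I :: "('c, 'h::real_vector) induction" and E :: "('c, 'h) frame"
begin

lemma hty_0 [simp]: "hty I 0 = 0"
  using linear_hty linear_0 by blast

lemma comp_hty: "comp k (hty I x) = hty I (comp (Suc k) x)"
proof (rule comp_eqI)
  show "hty I (comp (Suc k) x) \<in> grade A k" for k by (simp add: hty_grade_Suc comp_grade)
  have 4: "comp (Suc 3) x = 0" using comp_grade[of "Suc 3" x] grade_gt_3[of "Suc 3"] by simp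
  have "hty I x = hty I (\<Sum>k\<le>3. comp k x)" by (simp add: sum_comp)
  also have "\<dots> = (\<Sum>k\<le>3. hty I (comp k x))" by (rule linear_sum[OF linear_hty])
  also have "\<dots> = (\<Sum>k\<le>Suc 3. hty I (comp k x))" by (simp only: sum.atMost_Suc 4 hty_0 add_0_right)
  also have "\<dots> = (\<Sum>k\<le>3. hty I (comp (Suc k) x))"
    by (subst sum.atMost_Suc_shift) (simp add: hty_grade_0 comp_grade)
  finally show "hty I x = (\<Sum>k\<le>3. hty I (comp (Suc k) x))" .
qed

text \<open>\<open>K\<close> is self-adjoint up to sign, so its image is orthogonal to its kernel.
  The kernel contains both \<open>im K\<close> and \<open>im \<iota>\<close>.\<close>

lemma pairing_hty_left:
  assumes "hty I y = 0"
  shows "pairing A (hty I x) y = 0"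
proof -
  have "pairing A (hty I (comp k x)) y = 0" for k
    using hty_symm[OF comp_grade[of k x], of y] assms by simp
  then have "pairing A (hty I (\<Sum>k\<le>3. comp k x)) y = 0"
    by (simp only: linear_sum[OF linear_hty] pairing_sum_left sum.neutral_const)
  then show ?thesis by (simp add: sum_comp)
qed

lemma pairing_hty_right:
  assumes "hty I x = 0"
  shows "pairing A x (hty I y) = 0"
proof -
  have "pairing A (comp k x) (hty I y) = 0" for k
  proof (cases k)
    case 0
    have "hty I (comp k x) = 0" using hty_grade_0 comp_grade[of 0] 0 by blast
    then show ?thesis using hty_symm[OF comp_grade[of k x], of y] by simp
  next
    case (Suc j)
    then have "hty I (comp k x) = 0" using comp_hty[of j x] assms by (simp add: linear_0[OF linear_comp])
    then show ?thesis using hty_symm[OF comp_grade[of k x], of y] by simp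
  qed
  then show ?thesis by (subst pairing_comp_left) simp
qed

text \<open>By the homotopy formula every element is a sum of an exact one, a \<open>K\<close>-exact
  one and a representative. A representative is always orthogonal to the first two, so one
  orthogonal to all representatives vanishes. This makes \<open>iotaT\<close> well defined.\<close>

lemma pairing'_nondegenerate:
  assumes "\<And>g. pairing' A I h g = 0"
  shows "h = 0"
proof -
  have "pairing A (iota I h) b = 0" for b
  proof -
    have b: "b = diff A (hty I b) + hty I (diff A b) + iota I (iotaT A I b)"
      using homotopy[of b] by simp
    have "pairing A (iota I h) (diff A (hty I b)) = 0" by (rule pairing_cocycle_diff[OF diff_iota])
    moreover have "pairing A (iota I h) (hty I (diff A b)) = 0" by (rule pairing_hty_right[OF hty_iota])
    moreover have "pairing A (iota I h) (iota I (iotaT A I b)) = 0" using assms by (simp add: pairing'_def)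
    ultimately show ?thesis by (subst b) simp
  qed
  then have "iota I h = 0" using pairing_nondegenerate by blast
  then have "h = cls I 0" using cls_iota[of h] by simp
  then show ?thesis using cls_eq_0[of 0] by (metis diff_0 rangeI)
qed

text \<open>For \<open>y\<close> in \<open>im K\<close> the homotopy formula reduces to
  \<open>K d y = y\<close>: \<open>K y = 0\<close> because \<open>K\<close> squares to 0, and
  \<open>iotaT\<close> kills \<open>y\<close> because \<open>y\<close> is orthogonal to
  \<open>im \<iota>\<close>.\<close>

lemma hty_diff:
  assumes "y \<in> range (hty I)"
  shows "hty I (diff A y) = y"
proof -
  obtain a where y: "y = hty I a" using assms by blast
  have "iotaT A I y = (THE h. \<forall>g. pairing' A I h g = 0)"
    unfolding iotaT_def y by (simp add: pairing_hty_left hty_iota)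
  also have "\<dots> = 0"
  proof (rule the_equality)
    show "\<forall>g. pairing' A I 0 g = 0" by (simp add: pairing'_def linear_0[OF linear_iota])
  qed (use pairing'_nondegenerate in blast)
  finally show ?thesis using homotopy[of y] by (simp add: y hty_hty linear_0[OF linear_iota])
qed

text \<open>Moving \<open>K\<close> and then \<open>d\<close> to the other side of the pairing gives
  two signs that cancel. Hence projecting by \<open>K d\<close> onto \<open>im K\<close> does not
  change the pairing with \<open>d y\<close>.\<close>

lemma pairing_hty_diff:
  assumes "y \<in> range (hty I)"
  shows "pairing A (hty I (diff A z)) (diff A y) = pairing A z (diff A y)"
proof -
  have "pairing A (hty I (diff A (comp k z))) (diff A y) = pairing A (comp k z) (diff A y)" for k
  proof -
    have "pairing A (hty I (diff A (comp k z))) (diff A y) = - ((-1) ^ k) * pairing A (diff A (comp k z)) y"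
      using hty_symm[OF diff_grade[OF comp_grade[of k z]], of "diff A y"] by (simp add: hty_diff[OF assms])
    also have "pairing A (diff A (comp k z)) y = - ((-1) ^ k) * pairing A (comp k z) (diff A y)"
      using pairing_diff[OF comp_grade[of k z], of y] by simp
    finally show ?thesis by (simp flip: mult.assoc)
  qed
  then have "pairing A (hty I (diff A (\<Sum>k\<le>3. comp k z))) (diff A y) = pairing A (\<Sum>k\<le>3. comp k z) (diff A y)"
    by (simp only: linear_sum[OF linear_hty] linear_sum[OF linear_diff] pairing_sum_left)
  then show ?thesis by (simp add: sum_comp)
qed

lemma fK_range: "j < nK E k \<Longrightarrow> fK E k j \<in> range (hty I)"
  and fK_grade: "j < nK E k \<Longrightarrow> fK E k j \<in> grade A k"
  using basis_in[OF fK] by auto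

text \<open>Provides one row of a left inverse of the Gram matrix of \<pi>(y, dy') on
  \<open>im K\<close>. The functional reading off the \<open>j\<close>-th coordinate of degree
  \<open>k\<close> is represented by some \<open>z\<close>, and \<open>z\<close> is then projected
  into \<open>im K\<close>.\<close>

lemma dual_vector:
  assumes "k < 3" "j < nK E k"
  obtains c where "\<And>k' j'. k' < 3 \<Longrightarrow> j' < nK E k' \<Longrightarrow>
    (\<Sum>i<nK E (2 - k). c i * pairing A (fK E (2 - k) i) (diff A (fK E k' j'))) = (if k = k' \<and> j = j' then 1 else 0)"
proof -
  have basis: "inj_on (fK E k) {..<nK E k}" "independent (fK E k ` {..<nK E k})"
    using fK[of k] by (auto simp: is_basis_def)
  obtain g0 :: "'c \<Rightarrow> real" where g0: "linear g0"
    "\<And>x. x \<in> fK E k ` {..<nK E k} \<Longrightarrow> g0 x = (if x = fK E k j then 1 else 0)"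
    using linear_independent_extend[OF basis(2), of "\<lambda>x. if x = fK E k j then 1 else 0"] by blast
  have g0': "g0 (fK E k j') = (if j = j' then 1 else 0)" if "j' < nK E k" for j'
    using g0(2) that assms inj_onD[OF basis(1), of j' j] by auto
  have "linear (\<lambda>b. g0 (comp k (hty I b)))"
    using linear_compose[OF linear_compose[OF linear_hty linear_comp[of k]] g0(1)] by (simp add: o_def)
  then obtain z where z: "\<And>b. pairing A z b = g0 (comp k (hty I b))" using riesz by blast
  \<comment> \<open>\<open>K d z\<close> pairs with \<open>d y\<close> as \<open>z\<close> does for
    \<open>y\<close> in \<open>im K\<close>. Its component of degree \<open>2 - k\<close> is the
    only one that pairs with \<open>d y\<close> for \<open>y\<close> of degree \<open>k\<close>, as
    degrees must add up to 3.\<close>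
  define x where "x = comp (2 - k) (hty I (diff A z))"
  have "x \<in> range (hty I) \<inter> grade A (2 - k)"
    unfolding x_def using comp_grade comp_hty by (metis IntI rangeI)
  then obtain c where c: "x = (\<Sum>i<nK E (2 - k). c i *\<^sub>R fK E (2 - k) i)"
    using in_span_basis[OF fK] by blast
  have "pairing A x (diff A (fK E k' j')) = (if k = k' \<and> j = j' then 1 else 0)"
    if k': "k' < 3" "j' < nK E k'" for k' j'
  proof -
    let ?f = "fK E k' j'"
    have df: "diff A ?f \<in> grade A (Suc k')" by (rule diff_grade[OF fK_grade[OF k'(2)]])
    show ?thesis
    proof (cases "k' = k")
      case True
      have *: "pairing A (comp i (hty I (diff A z))) (diff A ?f) = (if i = 2 - k then pairing A x (diff A ?f) else 0)"
        for i
        using pairing_degree_0[OF comp_grade df, of i "hty I (diff A z)"] assms(1) True by (auto simp: x_def)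
      have "pairing A (hty I (diff A z)) (diff A ?f) = pairing A x (diff A ?f)"
        by (subst pairing_comp_left) (simp add: *)
      then have "pairing A x (diff A ?f) = g0 (comp k (hty I (diff A ?f)))"
        using pairing_hty_diff[OF fK_range[OF k'(2)]] z by simp
      also have "hty I (diff A ?f) = ?f" by (rule hty_diff[OF fK_range[OF k'(2)]])
      also have "comp k ?f = ?f" using comp_homogeneous[OF fK_grade[OF k'(2)]] True by simp
      finally show ?thesis using g0' k' True by simp
    next
      case False
      have "x \<in> grade A (2 - k)" by (simp add: x_def comp_grade)
      then show ?thesis using pairing_degree_0[OF _ df] False assms(1) by auto
    qed
  qed
  then have "(\<Sum>i<nK E (2 - k). c i * pairing A (fK E (2 - k) i) (diff A (fK E k' j'))) = (if k = k' \<and> j = j' then 1 else 0)"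
    if "k' < 3" "j' < nK E k'" for k' j'
    using that by (simp add: c pairing_sum_left)
  then show ?thesis by (rule that)
qed

end

section \<open>The propagator\<close>

text \<open>The right inverse \<open>R\<close> is only a witness for uniqueness; nothing is asked of
  it outside \<open>V\<close>.\<close>

lemma inverse_hessian_eq:
  assumes "finite V"
    and "\<And>u w. u \<notin> V \<or> w \<notin> V \<Longrightarrow> p u w = 0"
    and "\<And>u w. u \<in> V \<Longrightarrow> w \<in> V \<Longrightarrow> (\<Sum>v\<in>V. p u v * hessian Q v w) = (if u = w then 1 else 0)"
    and "\<And>u w. u \<in> V \<Longrightarrow> w \<in> V \<Longrightarrow> (\<Sum>v\<in>V. hessian Q u v * R v w) = (if u = w then 1 else 0)"
  shows "inverse_hessian V Q = p"
  unfolding inverse_hessian_def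
proof (rule the_equality)
  fix p'
  assume p': "(\<forall>u w. u \<notin> V \<or> w \<notin> V \<longrightarrow> p' u w = 0) \<and>
     (\<forall>u\<in>V. \<forall>w\<in>V. (\<Sum>v\<in>V. p' u v * hessian Q v w) = (if u = w then 1 else 0))"
  show "p' = p"
  proof (intro ext)
    fix u w
    show "p' u w = p u w"
    proof (cases "u \<in> V \<and> w \<in> V")
      case True
      then have "p' u w = R u w" "p u w = R u w"
        using left_right_inverse_eq[OF assms(1) _ assms(4), of p' u w]
          left_right_inverse_eq[OF assms(1) assms(3,4), of u w] p' by auto
      then show ?thesis by simp
    next
      case False
      then show ?thesis using p' assms(2) by auto
    qed
  qed
qed (use assms in auto)

lemma deriv_at_quadratic:
  assumes "finite X" "v \<in> X"
  shows "deriv_at v (\<Sum>x\<in>X. \<Sum>y\<in>X. q x y *\<^sub>R (svar x * svar y))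
    = (\<Sum>w\<in>X. (q v w + vsgn v w * q w v) *\<^sub>R svar w)"
proof -
  have "deriv_at v (\<Sum>x\<in>X. \<Sum>y\<in>X. q x y *\<^sub>R (svar x * svar y))
    = (\<Sum>x\<in>X. \<Sum>y\<in>X. (if x = v then q v y *\<^sub>R svar y else 0) + (if y = v then (vsgn v x * q x v) *\<^sub>R svar x else 0))"
    unfolding deriv_at_sum
    by (intro sum.cong refl) (auto simp: deriv_at_svar_mult deriv_at_svar scaleR_add_right mult.commute)
  also have "\<dots> = (\<Sum>y\<in>X. q v y *\<^sub>R svar y) + (\<Sum>x\<in>X. (vsgn v x * q x v) *\<^sub>R svar x)"
  proof -
    have "(\<Sum>x\<in>X. \<Sum>y\<in>X. if x = v then q v y *\<^sub>R svar y else 0) = (\<Sum>x\<in>X. if x = v then \<Sum>y\<in>X. q v y *\<^sub>R svar y else 0)"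
      by (rule sum.cong) auto
    then show ?thesis using assms by (simp add: sum.distrib)
  qed
  finally show ?thesis by (simp add: scaleR_add_left sum.distrib)
qed

lemma hessian_quadratic:
  assumes "finite X" "v \<in> X" "w \<in> X"
  shows "hessian ((1 / 2) *\<^sub>R (\<Sum>x\<in>X. \<Sum>y\<in>X. q x y *\<^sub>R (svar x * svar y))) v w
    = fls_const ((q v w + vsgn v w * q w v) / 2)"
proof -
  have "hessian ((1 / 2) *\<^sub>R (\<Sum>x\<in>X. \<Sum>y\<in>X. q x y *\<^sub>R (svar x * svar y))) v w
    = fls_const (1 / 2) * (\<Sum>x\<in>X. if w = x then fls_const (q v x + vsgn v x * q x v) else 0)"
    unfolding hessian_def deriv_at_scaleR deriv_at_quadratic[OF assms(1,2)]
    unfolding deriv_at_sum deriv_at_scaleR deriv_at_svar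
    by (simp add: if_distrib if_distribR coeff_1 cong: if_cong)
  also have "\<dots> = fls_const ((q v w + vsgn v w * q w v) / 2)"
    using assms by (simp add: fls_const_mult_const)
  finally show ?thesis .
qed

lemma varsK_eq: "varsK L E = (\<lambda>(k, j, a). Om k j a) ` (SIGMA k:{..<3}. {..<nK E k} \<times> {..<ldim L})"
  by (auto simp: varsK_def image_iff)

lemma finite_varsK [simp]: "finite (varsK L E)"
  unfolding varsK_eq by auto

lemma sum_varsK: "(\<Sum>v\<in>varsK L E. f v) = (\<Sum>k<3. \<Sum>j<nK E k. \<Sum>a<ldim L. f (Om k j a))"
proof -
  have "(\<Sum>v\<in>varsK L E. f v) = (\<Sum>(k, j, a)\<in>(SIGMA k:{..<3}. {..<nK E k} \<times> {..<ldim L}). f (Om k j a))"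
    unfolding varsK_eq by (subst sum.reindex) (auto simp: inj_on_def case_prod_beta o_def)
  also have "\<dots> = (\<Sum>k<3. \<Sum>(j, a)\<in>{..<nK E k} \<times> {..<ldim L}. f (Om k j a))"
    using sum.Sigma[of "{..<3::nat}" "\<lambda>k. {..<nK E k} \<times> {..<ldim L}" "\<lambda>k p. f (Om k (fst p) (snd p))"]
    by (simp add: case_prod_beta)
  also have "\<dots> = (\<Sum>k<3. \<Sum>j<nK E k. \<Sum>a<ldim L. f (Om k j a))"
    by (simp add: sum.cartesian_product)
  finally show ?thesis .
qed

lemma vars1_eq: "vars1 L E = (\<lambda>(i, a). A1 i a) ` ({..<b1 E} \<times> {..<ldim L})"
  by (auto simp: vars1_def image_iff)

lemma finite_vars1 [simp]: "finite (vars1 L E)"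
  unfolding vars1_eq by auto

lemma finite_varsF' [simp]: "finite (varsF' L E)"
proof -
  have "{A2 i a |i a. i < b1 E \<and> a < ldim L} = (\<lambda>(i, a). A2 i a) ` ({..<b1 E} \<times> {..<ldim L})"
    by (auto simp: image_iff)
  then have "finite {A2 i a |i a. i < b1 E \<and> a < ldim L}" by simp
  moreover have "{A0 a |a. a < ldim L} = A0 ` {..<ldim L}" "{A3 a |a. a < ldim L} = A3 ` {..<ldim L}" by auto
  ultimately show ?thesis by (simp add: varsF'_def)
qed

lemma finite_vars [simp]: "finite (vars L E)"
  by (simp add: vars_def)

lemma Om_in_vars [simp]: "Om k j a \<in> vars L E \<longleftrightarrow> k < 3 \<and> j < nK E k \<and> a < ldim L"
  and Om_in_varsK [simp]: "Om k j a \<in> varsK L E \<longleftrightarrow> k < 3 \<and> j < nK E k \<and> a < ldim L"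
  by (auto simp: vars_def varsF'_def vars1_def varsK_def)

lemma in_varsK_cases:
  assumes "v \<in> varsK L E"
  obtains k j a where "v = Om k j a" "k < 3" "j < nK E k" "a < ldim L"
  using assms by (auto simp: varsK_def)

lemma varsK_subset: "varsK L E \<subseteq> vars L E"
  by (simp add: vars_def)

text \<open>The condition \<open>k + k' = 2\<close> says that the ghost numbers cancel and also
  forces \<open>k\<close> and \<open>k'\<close> below 3, so the matrix vanishes off
  \<open>varsK\<close> as \<open>inverse_hessian\<close> demands.\<close>

definition colour_diagonal ::
    "'g lie \<Rightarrow> ('c, 'h) frame \<Rightarrow> (nat \<Rightarrow> nat \<Rightarrow> nat \<Rightarrow> real) \<Rightarrow> fvar \<Rightarrow> fvar \<Rightarrow> real" where
  "colour_diagonal L E \<rho> u v = (case u of Om k j a \<Rightarrow> (case v of Om k' j' b \<Rightarrow>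
       if k + k' = 2 \<and> j < nK E k \<and> j' < nK E k' \<and> a < ldim L \<and> a = b then \<rho> k j j' else 0
     | _ \<Rightarrow> 0) | _ \<Rightarrow> 0)"

context bv_setup
begin

definition gram :: "nat \<Rightarrow> nat \<Rightarrow> nat \<Rightarrow> nat \<Rightarrow> real" where
  "gram k j k' j' = pairing A (fK E k j) (diff A (fK E k' j'))"

text \<open>The Koszul sign of the coordinate of ghost number \<open>1 - k\<close> passing an
  element of degree \<open>k' + 1\<close>, for \<open>k + k' = 2\<close>. The same sign governs the
  symmetry of \<open>gram\<close>.\<close>

definition sg :: "nat \<Rightarrow> real" where
  "sg k = (if k = 1 then 1 else - 1)"

lemma gram_0: "j < nK E k \<Longrightarrow> j' < nK E k' \<Longrightarrow> k + k' \<noteq> 2 \<Longrightarrow> gram k j k' j' = 0"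
  unfolding gram_def by (rule pairing_degree_0[OF fK_grade diff_grade[OF fK_grade]]) auto

lemma gram_symm:
  assumes "j < nK E k" "j' < nK E k'"
  shows "gram k' j' k j = sg k * gram k j k' j'"
proof (cases "k + k' = 2")
  case True
  have "gram k' j' k j = (-1) ^ (k' * Suc k) * pairing A (diff A (fK E k j)) (fK E k' j')"
    unfolding gram_def by (rule pairing_symm[OF fK_grade diff_grade[OF fK_grade]]) (use assms in auto)
  also have "pairing A (diff A (fK E k j)) (fK E k' j') = - ((-1) ^ k) * gram k j k' j'"
    using pairing_diff[OF fK_grade[OF assms(1)], of "fK E k' j'"] by (simp add: gram_def)
  finally have *: "gram k' j' k j = (-1) ^ (k' * Suc k) * (- ((-1) ^ k) * gram k j k' j')" .
  have "k = 0 \<and> k' = 2 \<or> k = 1 \<and> k' = 1 \<or> k = 2 \<and> k' = 0" using True by auto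
  then show ?thesis unfolding * by (auto simp: sg_def)
next
  case False
  then have "k' + k \<noteq> 2" by simp
  then show ?thesis using False gram_0 assms by simp
qed

lemma hessian_free_action:
  assumes "Om k j a \<in> varsK L E" "Om k' j' b \<in> varsK L E"
  shows "hessian (free_action A L E) (Om k j a) (Om k' j' b) = fls_const (if a = b then sg k * gram k j k' j' else 0)"
proof -
  define q where "q v w = koszul (ghost v) (degree_of A (diff A (omega'' E w)))
       * form L (lbasis L (colour v)) (lbasis L (colour w)) * pairing A (omega'' E v) (diff A (omega'' E w))" for v w
  have q: "q (Om k j a) (Om k' j' b) = (if a = b then sg k * gram k j k' j' else 0)"
    if "Om k j a \<in> varsK L E" "Om k' j' b \<in> varsK L E" for k j a k' j' b
  proof (cases "gram k j k' j' = 0")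
    case False
    then have "diff A (fK E k' j') \<noteq> 0" by (auto simp: gram_def)
    then have deg: "degree_of A (diff A (fK E k' j')) = int (Suc k')"
      using that by (intro degree_of_eq diff_grade[OF fK_grade]) auto
    have "k + k' = 2" using False gram_0[of j k j' k'] that by auto
    then have "k = 0 \<and> k' = 2 \<or> k = 1 \<and> k' = 1 \<or> k = 2 \<and> k' = 0" by auto
    then have "koszul (1 - int k) (int (Suc k')) = sg k" by (auto simp: koszul_def sg_def)
    moreover have "form L (lbasis L a) (lbasis L b) = (if a = b then 1 else 0)"
      using that orthonormal by auto
    ultimately show ?thesis using deg unfolding q_def gram_def by simp
  next
    case True
    then show ?thesis unfolding q_def gram_def by simp
  qed
  have Q: "free_action A L E = (1 / 2) *\<^sub>R (\<Sum>x\<in>vars L E. \<Sum>y\<in>vars L E. q x y *\<^sub>R (svar x * svar y))"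
    by (simp add: free_action_def spair_def q_def o_def)
  \<comment> \<open>The two orders of a pair of coordinates contribute equally, so the factor 1/2 of
    the action drops out of the Hessian.\<close>
  have "vsgn (Om k j a) (Om k' j' b) * (sg k' * gram k' j' k j) = sg k * gram k j k' j'"
  proof (cases "k + k' = 2")
    case True
    then have "k = 0 \<and> k' = 2 \<or> k = 1 \<and> k' = 1 \<or> k = 2 \<and> k' = 0" by auto
    moreover have "gram k' j' k j = sg k * gram k j k' j'" using gram_symm[of j k j' k'] assms by simp
    ultimately show ?thesis by (auto simp: vsgn_def sg_def)
  next
    case False
    then have "k' + k \<noteq> 2" by simp
    then show ?thesis using False gram_0[of j k j' k'] gram_0[of j' k' j k] assms by simp
  qed
  note symm = this
  have "(q (Om k j a) (Om k' j' b) + vsgn (Om k j a) (Om k' j' b) * q (Om k' j' b) (Om k j a)) / 2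
    = (if a = b then sg k * gram k j k' j' else 0)"
  proof (cases "a = b")
    case True
    then show ?thesis unfolding q[OF assms] q[OF assms(2,1)] using symm by simp
  next
    case False
    then show ?thesis unfolding q[OF assms] q[OF assms(2,1)] by simp
  qed
  moreover have "Om k j a \<in> vars L E" "Om k' j' b \<in> vars L E" using assms by auto
  ultimately show ?thesis unfolding Q by (simp only: hessian_quadratic[OF finite_vars])
qed

lemma inverse_hessian_exists:
  obtains \<rho> where "inverse_hessian (varsK L E) (free_action A L E) = (\<lambda>x y. fls_const (colour_diagonal L E \<rho> x y))"
proof -
  let ?dual = "\<lambda>k j c. \<forall>k' j'. k' < 3 \<longrightarrow> j' < nK E k' \<longrightarrow>
    (\<Sum>i<nK E (2 - k). c i * gram (2 - k) i k' j') = (if k = k' \<and> j = j' then 1 else 0)"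
  define c where "c k j = (SOME c. ?dual k j c)" for k j
  have "?dual k j (c k j)" if kj: "k < 3" "j < nK E k" for k j
  proof -
    obtain c' where "?dual k j c'"
      by (rule dual_vector[OF kj]) (auto simp: gram_def)
    then show ?thesis unfolding c_def by (rule someI[of "?dual k j"])
  qed
  then have c: "(\<Sum>i<nK E (2 - k). c k j i * gram (2 - k) i k' j') = (if k = k' \<and> j = j' then 1 else 0)"
    if "k < 3" "j < nK E k" "k' < 3" "j' < nK E k'" for k j k' j'
    using that by blast
  \<comment> \<open>The factor \<open>sg (2 - k)\<close> cancels the sign that the Hessian carries
    in its rows of degree \<open>2 - k\<close>.\<close>
  define \<rho> where "\<rho> k j i = sg (2 - k) * c k j i" for k j i
  let ?r = "colour_diagonal L E \<rho>" and ?Q = "free_action A L E" and ?V = "varsK L E"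
  have r: "?r (Om k j a) (Om k' j' b) = (if k' = 2 - k then if b = a then \<rho> k j j' else 0 else 0)"
    if "k < 3" "j < nK E k" "a < ldim L" "j' < nK E k'" "k' < 3" for k j a k' j' b
    using that by (auto simp: colour_diagonal_def)
  have left: "(\<Sum>v\<in>?V. fls_const (?r u v) * hessian ?Q v w) = (if u = w then 1 else 0)"
    if u: "u \<in> ?V" and w: "w \<in> ?V" for u w
  proof -
    obtain k j a where ukja: "u = Om k j a" "k < 3" "j < nK E k" "a < ldim L" using u by (rule in_varsK_cases)
    obtain k'' j'' b where wkjb: "w = Om k'' j'' b" "k'' < 3" "j'' < nK E k''" "b < ldim L" using w by (rule in_varsK_cases)
    have "(\<Sum>v\<in>?V. fls_const (?r u v) * hessian ?Q v w) =
      (\<Sum>k'<3. \<Sum>j'<nK E k'. \<Sum>a'<ldim L. if k' = 2 - k then if a' = a then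
         fls_const (if a' = b then \<rho> k j j' * (sg k' * gram k' j' k'' j'') else 0) else 0 else 0)"
      unfolding sum_varsK
    proof (intro sum.cong refl, goal_cases)
      case (1 k' j' a')
      then have "hessian ?Q (Om k' j' a') w = fls_const (if a' = b then sg k' * gram k' j' k'' j'' else 0)"
        unfolding wkjb(1) using w wkjb by (intro hessian_free_action) auto
      then show ?case using r[OF ukja(2-4), of j' k' a'] 1 by (auto simp: ukja(1) fls_const_mult_const)
    qed
    also have "\<dots> = (\<Sum>k'<3. if k' = 2 - k then \<Sum>j'<nK E k'. \<Sum>a'<ldim L. if a' = a then
         fls_const (if a' = b then \<rho> k j j' * (sg k' * gram k' j' k'' j'') else 0) else 0 else 0)"
      by (intro sum.cong refl) auto
    also have "\<dots> = (\<Sum>j'<nK E (2 - k). \<Sum>a'<ldim L. if a' = a then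
         fls_const (if a' = b then \<rho> k j j' * (sg (2 - k) * gram (2 - k) j' k'' j'') else 0) else 0)"
      by (subst sum.delta) auto
    also have "\<dots> = (\<Sum>j'<nK E (2 - k). fls_const (if a = b then \<rho> k j j' * (sg (2 - k) * gram (2 - k) j' k'' j'') else 0))"
      using ukja by simp
    also have "\<dots> = fls_const (if a = b then \<Sum>j'<nK E (2 - k). c k j j' * gram (2 - k) j' k'' j'' else 0)"
    proof -
      have *: "\<rho> k j j' * (sg (2 - k) * gram (2 - k) j' k'' j'') = c k j j' * gram (2 - k) j' k'' j''" for j'
        by (auto simp: \<rho>_def sg_def)
      have "(\<Sum>i\<in>S. fls_const (f i)) = fls_const (sum f S)" for f :: "nat \<Rightarrow> real" and S
        by (induction S rule: infinite_finite_induct) (auto simp: fls_plus_const)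
      then show ?thesis unfolding * by (cases "a = b") simp_all
    qed
    also have "\<dots> = (if u = w then 1 else 0)"
      using c[OF ukja(2,3) wkjb(2,3)] ukja wkjb by auto
    finally show ?thesis .
  qed
  have "inverse_hessian ?V ?Q = (\<lambda>x y. fls_const (?r x y))"
  proof (rule inverse_hessian_eq[OF finite_varsK])
    fix u w assume "u \<notin> ?V \<or> w \<notin> ?V"
    then show "fls_const (?r u w) = 0"
      by (auto simp: colour_diagonal_def split: fvar.split)
  next
    \<comment> \<open>The Hessian is symmetric up to the sign \<open>?e\<close>, so the transpose of
      the left inverse, corrected by \<open>?e\<close>, is a right inverse.\<close>
    let ?e = "\<lambda>v. if odd_var v then - 1 else 1 :: real fls"
    fix u w assume uw: "u \<in> ?V" "w \<in> ?V"
    have "hessian ?Q u v * (?e v * fls_const (?r w v)) = fls_const (?r w v) * hessian ?Q v u" if v: "v \<in> ?V" for v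
    proof -
      obtain k j a where v1: "v = Om k j a" "k < 3" "j < nK E k" "a < ldim L" using v by (rule in_varsK_cases)
      obtain k' j' b where u1: "u = Om k' j' b" "k' < 3" "j' < nK E k'" "b < ldim L" using uw(1) by (rule in_varsK_cases)
      have "hessian ?Q u v = fls_const (if b = a then sg k' * gram k' j' k j else 0)"
        unfolding v1(1) u1(1) by (rule hessian_free_action) (use v1 u1 in auto)
      moreover have "hessian ?Q v u = fls_const (if a = b then sg k * gram k j k' j' else 0)"
        unfolding v1(1) u1(1) by (rule hessian_free_action) (use v1 u1 in auto)
      moreover have "sg k' * gram k' j' k j = (if odd_var v then - 1 else 1) * (sg k * gram k j k' j')"
      proof (cases "k + k' = 2")
        case True
        then have "k = 0 \<and> k' = 2 \<or> k = 1 \<and> k' = 1 \<or> k = 2 \<and> k' = 0" by auto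
        moreover have "gram k' j' k j = sg k * gram k j k' j'" using gram_symm[of j k j' k'] v1 u1 by simp
        ultimately show ?thesis by (auto simp: sg_def v1(1))
      next
        case False
        then have "k' + k \<noteq> 2" by simp
        then show ?thesis using False gram_0[of j k j' k'] gram_0[of j' k' j k] v1 u1 by simp
      qed
      ultimately have "hessian ?Q u v = ?e v * hessian ?Q v u" by auto
      then show ?thesis by simp
    qed
    then have "(\<Sum>v\<in>?V. hessian ?Q u v * (?e v * fls_const (?r w v))) = (\<Sum>v\<in>?V. fls_const (?r w v) * hessian ?Q v u)"
      by (rule sum.cong[OF refl])
    then show "(\<Sum>v\<in>?V. hessian ?Q u v * (\<lambda>v w. ?e v * fls_const (?r w v)) v w) = (if u = w then 1 else 0)"
      using left[OF uw(2,1)] by auto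
  qed (rule left)
  then show ?thesis by (rule that)
qed

end

section \<open>Colour rotations\<close>

fun recol :: "fvar \<Rightarrow> nat \<Rightarrow> fvar" where
  "recol (A0 a) c = A0 c"
| "recol (A1 i a) c = A1 i c"
| "recol (A2 i a) c = A2 i c"
| "recol (A3 a) c = A3 c"
| "recol (Om k j a) c = Om k j c"

lemma recol_simps [simp]:
  "recol (recol v a) b = recol v b" "recol v (colour v) = v" "colour (recol v a) = a"
  "ghost (recol v a) = ghost v"
  by (cases v; simp)+

lemma recol_eq_iff: "recol v c = w \<longleftrightarrow> recol v 0 = recol w 0 \<and> c = colour w"
proof
  assume "recol v 0 = recol w 0 \<and> c = colour w"
  then have "recol (recol v 0) c = recol (recol w 0) (colour w)" by simp
  then show "recol v c = w" by simp
qed auto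

definition recolourable :: "nat \<Rightarrow> fvar set \<Rightarrow> bool" where
  "recolourable n V \<longleftrightarrow> finite V \<and> (\<forall>v\<in>V. colour v < n) \<and> (\<forall>v\<in>V. \<forall>a<n. recol v a \<in> V)"

text \<open>Colour 0 names the class of coordinates that differ only in colour. Sums over
  \<open>V\<close> become sums over classes and colours, on which a rotation acts by colour
  alone.\<close>

definition uncoloured :: "fvar set \<Rightarrow> fvar set" where
  "uncoloured V = (\<lambda>v. recol v 0) ` V"

lemma sum_recolourable:
  assumes "recolourable n V"
  shows "sum f V = (\<Sum>t\<in>uncoloured V. \<Sum>a<n. f (recol t a))"
proof -
  have "sum f V = (\<Sum>(t, a)\<in>uncoloured V \<times> {..<n}. f (recol t a))"
    by (rule sum.reindex_bij_witness[where i = "\<lambda>(t, a). recol t a" and j = "\<lambda>v. (recol v 0, colour v)"])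
       (use assms in \<open>auto simp: recolourable_def uncoloured_def\<close>)
  then show ?thesis by (simp add: sum.cartesian_product)
qed

lemma recolourable_uncoloured: "recolourable n V \<Longrightarrow> t \<in> uncoloured V \<Longrightarrow> a < n \<Longrightarrow> recol t a \<in> V"
  by (auto simp: recolourable_def uncoloured_def)

lemma finite_uncoloured: "recolourable n V \<Longrightarrow> finite (uncoloured V)"
  by (auto simp: recolourable_def uncoloured_def)

lemma sum_swap_first_third:
  "(\<Sum>a\<in>S. \<Sum>b\<in>T. \<Sum>c\<in>S. g a b c) = (\<Sum>a\<in>S. \<Sum>b\<in>T. \<Sum>c\<in>S. g c b a)"
proof -
  have "(\<Sum>a\<in>S. \<Sum>b\<in>T. \<Sum>c\<in>S. g a b c) = (\<Sum>b\<in>T. \<Sum>a\<in>S. \<Sum>c\<in>S. g a b c)" by (rule sum.swap)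
  also have "\<dots> = (\<Sum>b\<in>T. \<Sum>a\<in>S. \<Sum>c\<in>S. g c b a)" by (rule sum.cong[OF refl]) (rule sum.swap)
  also have "\<dots> = (\<Sum>a\<in>S. \<Sum>b\<in>T. \<Sum>c\<in>S. g c b a)" by (rule sum.swap)
  finally show ?thesis .
qed

lemma sum_swap_first_fourth:
  "(\<Sum>a\<in>S. \<Sum>b\<in>T. \<Sum>c\<in>U. \<Sum>d\<in>S. g a b c d) = (\<Sum>a\<in>S. \<Sum>b\<in>T. \<Sum>c\<in>U. \<Sum>d\<in>S. g d b c a)"
proof -
  have "(\<Sum>a\<in>S. \<Sum>b\<in>T. \<Sum>c\<in>U. \<Sum>d\<in>S. g a b c d) = (\<Sum>b\<in>T. \<Sum>a\<in>S. \<Sum>c\<in>U. \<Sum>d\<in>S. g a b c d)"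
    by (rule sum.swap)
  also have "\<dots> = (\<Sum>b\<in>T. \<Sum>a\<in>S. \<Sum>c\<in>U. \<Sum>d\<in>S. g d b c a)"
    by (rule sum.cong[OF refl]) (rule sum_swap_first_third)
  also have "\<dots> = (\<Sum>a\<in>S. \<Sum>b\<in>T. \<Sum>c\<in>U. \<Sum>d\<in>S. g d b c a)" by (rule sum.swap)
  finally show ?thesis .
qed

lemma antisymmetric_sum_eq_0:
  fixes B :: "nat \<Rightarrow> nat \<Rightarrow> 'a::real_vector"
  assumes "\<And>a c. a < n \<Longrightarrow> c < n \<Longrightarrow> X a c = - X c a"
  shows "(\<Sum>a<n. \<Sum>c<n. X a c *\<^sub>R (B c a + B a c)) = 0"
proof -
  have "(\<Sum>a<n. \<Sum>c<n. X a c *\<^sub>R B c a) = (\<Sum>c<n. \<Sum>a<n. X a c *\<^sub>R B c a)" by (rule sum.swap)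
  also have "\<dots> = (\<Sum>c<n. \<Sum>a<n. - (X c a *\<^sub>R B c a))"
  proof (intro sum.cong refl)
    fix a c assume "a \<in> {..<n}" "c \<in> {..<n}"
    then have "X a c = - X c a" using assms by blast
    then show "X a c *\<^sub>R B c a = - (X c a *\<^sub>R B c a)" by simp
  qed
  finally show ?thesis by (simp add: scaleR_add_right sum.distrib sum_negf)
qed

text \<open>The linear vector field by which the matrix \<open>X\<close> acts on colour indices. For
  \<open>X = adm Y\<close> it sends the components of a superfield \<alpha> to those of
  \<open>[Y, \<alpha>]\<close>.\<close>

definition rot :: "fvar set \<Rightarrow> nat \<Rightarrow> (nat \<Rightarrow> nat \<Rightarrow> real) \<Rightarrow> sfun \<Rightarrow> sfun" where
  "rot V n X f = (\<Sum>v\<in>V. \<Sum>c<n. X (colour v) c *\<^sub>R (svar (recol v c) * deriv_at v f))"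

locale rotation =
  fixes V :: "fvar set" and n :: nat and X :: "nat \<Rightarrow> nat \<Rightarrow> real"
  assumes recolourable: "recolourable n V"
    and antisymmetric: "\<And>a c. a < n \<Longrightarrow> c < n \<Longrightarrow> X a c = - X c a"
begin

abbreviation "D \<equiv> rot V n X"

lemma finlin_rot: "finlin D"
  unfolding rot_def[abs_def]
  by (intro finlin_sum finlin_compose[OF finlin_scaleR] finlin_compose[OF finlin_mult_left] finlin_deriv_at)

text \<open>An even derivation: the sign of \<open>deriv_at v\<close> passing \<open>f\<close> is
  undone when the coordinate \<open>recol v c\<close>, of the same parity, passes back.\<close>

lemma rot_mult: "D (f * g) = D f * g + f * D g"
proof -
  have "svar (recol v c) * deriv_at v (f * g) = svar (recol v c) * deriv_at v f * g + f * (svar (recol v c) * deriv_at v g)" for v c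
  proof -
    have "svar (recol v c) * twist v f = f * svar (recol v c)"
      by (simp add: svar_commute[of "recol v c"] twist_def)
    then have "svar (recol v c) * twist v f * deriv_at v g = f * svar (recol v c) * deriv_at v g" by simp
    then show ?thesis by (simp add: deriv_at_mult distrib_left mult.assoc)
  qed
  then show ?thesis
    by (simp add: rot_def scaleR_add_right sum.distrib sum_distrib_left sum_distrib_right)
qed

lemma rot_1: "D 1 = 0"
  by (simp add: rot_def)

lemma rot_svar: "v \<in> V \<Longrightarrow> D (svar v) = (\<Sum>c<n. X (colour v) c *\<^sub>R svar (recol v c))"
proof -
  assume "v \<in> V"
  have "D (svar v) = (\<Sum>w\<in>V. if w = v then \<Sum>c<n. X (colour w) c *\<^sub>R svar (recol w c) else 0)"
    unfolding rot_def by (intro sum.cong refl) (auto simp: deriv_at_svar)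
  then show ?thesis using \<open>v \<in> V\<close> recolourable by (simp add: recolourable_def)
qed

text \<open>Derivatives transform contragrediently: the extra sum arises where
  \<open>deriv_at w\<close> hits the coefficient \<open>svar (recol v c)\<close>, i.e. for
  \<open>v\<close> a recolouring of \<open>w\<close> and \<open>c = colour w\<close>.\<close>

lemma deriv_at_rot:
  assumes "w \<in> V"
  shows "deriv_at w (D f) = D (deriv_at w f) + (\<Sum>a<n. X a (colour w) *\<^sub>R deriv_at (recol w a) f)"
proof -
  have cw: "colour w < n" using assms recolourable by (auto simp: recolourable_def)
  have "deriv_at w (svar (recol v c) * deriv_at v f) =
      (if recol v c = w then deriv_at v f else 0) + svar (recol v c) * deriv_at v (deriv_at w f)" for v c
    using vsgn_square[of w v]
    by (simp add: deriv_at_svar_mult deriv_at_commute[of w v] vsgn_def)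
  then have "deriv_at w (D f) = D (deriv_at w f)
      + (\<Sum>v\<in>V. \<Sum>c<n. X (colour v) c *\<^sub>R (if recol v c = w then deriv_at v f else 0))"
    by (simp add: rot_def deriv_at_sum scaleR_add_right sum.distrib)
  also have "(\<Sum>v\<in>V. \<Sum>c<n. X (colour v) c *\<^sub>R (if recol v c = w then deriv_at v f else 0))
    = (\<Sum>v\<in>V. if recol v 0 = recol w 0 then X (colour v) (colour w) *\<^sub>R deriv_at v f else 0)"
  proof (rule sum.cong[OF refl])
    fix v
    have "(\<Sum>c<n. X (colour v) c *\<^sub>R (if recol v c = w then deriv_at v f else 0))
      = (\<Sum>c<n. if c = colour w then if recol v 0 = recol w 0 then X (colour v) c *\<^sub>R deriv_at v f else 0 else 0)"
      by (rule sum.cong) (auto simp: recol_eq_iff[of v _ w])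
    then show "(\<Sum>c<n. X (colour v) c *\<^sub>R (if recol v c = w then deriv_at v f else 0))
      = (if recol v 0 = recol w 0 then X (colour v) (colour w) *\<^sub>R deriv_at v f else 0)"
      using cw by simp
  qed
  also have "\<dots> = (\<Sum>t\<in>uncoloured V. if t = recol w 0 then \<Sum>a<n. X a (colour w) *\<^sub>R deriv_at (recol t a) f else 0)"
    unfolding sum_recolourable[OF recolourable]
    by (intro sum.cong refl) (auto simp: uncoloured_def)
  also have "\<dots> = (\<Sum>a<n. X a (colour w) *\<^sub>R deriv_at (recol w a) f)"
    using assms finite_uncoloured[OF recolourable] by (auto simp: uncoloured_def)
  finally show ?thesis .
qed

lemma at_zero_rot:
  assumes "\<And>v c. v \<in> V \<Longrightarrow> c < n \<Longrightarrow> recol v c \<in> U \<longleftrightarrow> v \<in> U"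
  shows "at_zero U (D f) = D (at_zero U f)"
proof -
  have "at_zero U (svar (recol v c) * deriv_at v f) = svar (recol v c) * deriv_at v (at_zero U f)"
    if "v \<in> V" "c < n" for v c
  proof (cases "v \<in> U")
    case True
    have "at_zero U f \<in> Fun (- U)" by (auto simp: Fun_def coeff_at_zero split: if_splits)
    then have "deriv_at v (at_zero U f) = 0" using True by (intro deriv_at_eq_0) auto
    then show ?thesis using True assms[OF that] by (simp add: at_zero_svar_mult)
  next
    case False
    have "svar (recol v c) \<in> Fun (- U)"
      using False assms[OF that] by (auto simp: Fun_def coeff_svar split: if_splits)
    moreover have "at_zero U (deriv_at v f) = deriv_at v (at_zero U f)"
      using False by (intro sfun_eqI) (auto simp: coeff_at_zero coeff_deriv_at)
    ultimately show ?thesis by (simp add: at_zero_Fun_mult)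
  qed
  then show ?thesis
    unfolding rot_def finlin_map_sum[OF finlin_at_zero] finlin_map_scaleR[OF finlin_at_zero]
    by (intro sum.cong refl arg_cong[of _ _ "\<lambda>x. _ *\<^sub>R x"]) auto
qed

lemma rot_quadratic:
  assumes "\<And>v w a b. \<kappa> (recol v a) (recol w b) = \<kappa> v w"
  shows "D (\<Sum>v\<in>V. \<Sum>w\<in>V. (if colour v = colour w then \<kappa> v w else 0) *\<^sub>R (svar v * svar w)) = 0"
proof -
  have "(\<Sum>v\<in>V. \<Sum>w\<in>V. (if colour v = colour w then \<kappa> v w else 0) *\<^sub>R (svar v * svar w))
     = (\<Sum>t\<in>uncoloured V. \<Sum>a<n. \<Sum>s\<in>uncoloured V. \<kappa> t s *\<^sub>R (svar (recol t a) * svar (recol s a)))"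
    unfolding sum_recolourable[OF recolourable]
    by (intro sum.cong refl) (simp add: assms if_distrib if_distribR cong: if_cong)
  also have "\<dots> = (\<Sum>t\<in>uncoloured V. \<Sum>s\<in>uncoloured V. \<kappa> t s *\<^sub>R (\<Sum>a<n. svar (recol t a) * svar (recol s a)))"
    by (simp add: scaleR_sum_right) (rule sum.cong[OF refl], rule sum.swap)
  finally have *: "(\<Sum>v\<in>V. \<Sum>w\<in>V. (if colour v = colour w then \<kappa> v w else 0) *\<^sub>R (svar v * svar w)) = \<dots>" .
  have "D (\<Sum>a<n. svar (recol t a) * svar (recol s a)) = 0" if "t \<in> uncoloured V" "s \<in> uncoloured V" for t s
  proof -
    have "D (\<Sum>a<n. svar (recol t a) * svar (recol s a)) =
      (\<Sum>a<n. \<Sum>c<n. X a c *\<^sub>R (svar (recol t c) * svar (recol s a) + svar (recol t a) * svar (recol s c)))"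
      unfolding finlin_map_sum[OF finlin_rot] rot_mult
      using that recolourable_uncoloured[OF recolourable]
      by (intro sum.cong refl)
         (simp add: rot_svar sum_distrib_left sum_distrib_right scaleR_add_right sum.distrib)
    also have "\<dots> = 0"
      using antisymmetric_sum_eq_0[of n X "\<lambda>c a. svar (recol t c) * svar (recol s a)"] antisymmetric by blast
    finally show ?thesis .
  qed
  then show ?thesis
    unfolding * finlin_map_sum[OF finlin_rot] finlin_map_scaleR[OF finlin_rot]
    by (intro sum.neutral ballI) simp
qed

text \<open>A rotation replaces one factor by another of the same parity in the same position, so no
  signs arise. Renaming colours moves the three resulting sums onto \<open>f\<close>, where they add
  up to the infinitesimal invariance of the tensor \<open>f\<close>.\<close>

lemma rot_cubic:
  assumes \<kappa>: "\<And>u v w a b c. \<kappa> (recol u a) (recol v b) (recol w c) = \<kappa> u v w"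
    and f: "\<And>a b c. a < n \<Longrightarrow> b < n \<Longrightarrow> c < n \<Longrightarrow>
      (\<Sum>d<n. X d a * f d b c + X d b * f a d c + X d c * f a b d) = 0"
  shows "D (\<Sum>u\<in>V. \<Sum>v\<in>V. \<Sum>w\<in>V. (\<kappa> u v w * f (colour u) (colour v) (colour w)) *\<^sub>R (svar u * svar v * svar w)) = 0"
proof -
  let ?T = "uncoloured V"
  let ?m = "\<lambda>s t r a b c. svar (recol s a) * svar (recol t b) * svar (recol r c)"
  have "(\<Sum>u\<in>V. \<Sum>v\<in>V. \<Sum>w\<in>V. (\<kappa> u v w * f (colour u) (colour v) (colour w)) *\<^sub>R (svar u * svar v * svar w))
    = (\<Sum>s\<in>?T. \<Sum>a<n. \<Sum>t\<in>?T. \<Sum>b<n. \<Sum>r\<in>?T. \<Sum>c<n. (\<kappa> s t r * f a b c) *\<^sub>R ?m s t r a b c)"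
    unfolding sum_recolourable[OF recolourable] by (simp add: \<kappa>)
  also have "\<dots> = (\<Sum>s\<in>?T. \<Sum>t\<in>?T. \<Sum>a<n. \<Sum>r\<in>?T. \<Sum>b<n. \<Sum>c<n. (\<kappa> s t r * f a b c) *\<^sub>R ?m s t r a b c)"
    by (rule sum.cong[OF refl], rule trans[OF sum.swap],
        rule sum.cong[OF refl], rule sum.cong[OF refl], rule sum.swap)
  also have "\<dots> = (\<Sum>s\<in>?T. \<Sum>t\<in>?T. \<Sum>r\<in>?T. \<kappa> s t r *\<^sub>R (\<Sum>a<n. \<Sum>b<n. \<Sum>c<n. f a b c *\<^sub>R ?m s t r a b c))"
    by (rule sum.cong[OF refl], rule sum.cong[OF refl], rule trans[OF sum.swap]) (simp add: scaleR_sum_right)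
  finally have *: "(\<Sum>u\<in>V. \<Sum>v\<in>V. \<Sum>w\<in>V. (\<kappa> u v w * f (colour u) (colour v) (colour w)) *\<^sub>R (svar u * svar v * svar w)) = \<dots>" .
  have "D (\<Sum>a<n. \<Sum>b<n. \<Sum>c<n. f a b c *\<^sub>R ?m s t r a b c) = 0" if "s \<in> ?T" "t \<in> ?T" "r \<in> ?T" for s t r
  proof -
    have D: "D (svar (recol s a)) = (\<Sum>d<n. X a d *\<^sub>R svar (recol s d))" if "s \<in> ?T" "a < n" for s a
      using that recolourable_uncoloured[OF recolourable] by (simp add: rot_svar)
    have "D (\<Sum>a<n. \<Sum>b<n. \<Sum>c<n. f a b c *\<^sub>R ?m s t r a b c) =
      (\<Sum>a<n. \<Sum>b<n. \<Sum>c<n. (\<Sum>d<n. (f a b c * X a d) *\<^sub>R ?m s t r d b c)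
        + (\<Sum>d<n. (f a b c * X b d) *\<^sub>R ?m s t r a d c) + (\<Sum>d<n. (f a b c * X c d) *\<^sub>R ?m s t r a b d))"
      unfolding finlin_map_sum[OF finlin_rot] finlin_map_scaleR[OF finlin_rot] rot_mult
      using that
      by (intro sum.cong refl)
         (simp add: D sum_distrib_left sum_distrib_right distrib_right scaleR_add_right scaleR_sum_right)
    also have "\<dots> = (\<Sum>a<n. \<Sum>b<n. \<Sum>c<n. \<Sum>d<n. (f a b c * X a d) *\<^sub>R ?m s t r d b c)
        + (\<Sum>a<n. \<Sum>b<n. \<Sum>c<n. \<Sum>d<n. (f a b c * X b d) *\<^sub>R ?m s t r a d c)
        + (\<Sum>a<n. \<Sum>b<n. \<Sum>c<n. \<Sum>d<n. (f a b c * X c d) *\<^sub>R ?m s t r a b d)"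
      by (simp add: sum.distrib)
    also have "(\<Sum>a<n. \<Sum>b<n. \<Sum>c<n. \<Sum>d<n. (f a b c * X a d) *\<^sub>R ?m s t r d b c)
      = (\<Sum>a<n. \<Sum>b<n. \<Sum>c<n. \<Sum>d<n. (f d b c * X d a) *\<^sub>R ?m s t r a b c)"
      by (rule sum_swap_first_fourth)
    also have "(\<Sum>a<n. \<Sum>b<n. \<Sum>c<n. \<Sum>d<n. (f a b c * X b d) *\<^sub>R ?m s t r a d c)
      = (\<Sum>a<n. \<Sum>b<n. \<Sum>c<n. \<Sum>d<n. (f a d c * X d b) *\<^sub>R ?m s t r a b c)"
      by (rule sum.cong[OF refl]) (rule sum_swap_first_third)
    also have "(\<Sum>a<n. \<Sum>b<n. \<Sum>c<n. \<Sum>d<n. (f a b c * X c d) *\<^sub>R ?m s t r a b d)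
      = (\<Sum>a<n. \<Sum>b<n. \<Sum>c<n. \<Sum>d<n. (f a b d * X d c) *\<^sub>R ?m s t r a b c)"
      by (rule sum.cong[OF refl], rule sum.cong[OF refl], rule sum.swap)
    also have "(\<Sum>a<n. \<Sum>b<n. \<Sum>c<n. \<Sum>d<n. (f d b c * X d a) *\<^sub>R ?m s t r a b c)
        + (\<Sum>a<n. \<Sum>b<n. \<Sum>c<n. \<Sum>d<n. (f a d c * X d b) *\<^sub>R ?m s t r a b c)
        + (\<Sum>a<n. \<Sum>b<n. \<Sum>c<n. \<Sum>d<n. (f a b d * X d c) *\<^sub>R ?m s t r a b c)
      = (\<Sum>a<n. \<Sum>b<n. \<Sum>c<n. (\<Sum>d<n. X d a * f d b c + X d b * f a d c + X d c * f a b d) *\<^sub>R ?m s t r a b c)"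
      by (simp add: sum.distrib scaleR_sum_left scaleR_add_left mult.commute)
    also have "\<dots> = 0" using f by (intro sum.neutral ballI) simp
    finally show ?thesis .
  qed
  then show ?thesis
    unfolding * finlin_map_sum[OF finlin_rot] finlin_map_scaleR[OF finlin_rot]
    by (intro sum.neutral ballI) simp
qed

end

text \<open>The propagator is diagonal in colour. Commuting both derivatives of a contracted pair
  past the rotation leaves a sum symmetric in the two colours against an antisymmetric
  matrix.\<close>

lemma (in propagator) wick_rot:
  assumes "rotation U n X" "recolourable n V" "V \<subseteq> U"
    and r: "\<And>x y. x \<in> V \<Longrightarrow> y \<in> V \<Longrightarrow> r x y = (if colour x = colour y then \<kappa> x y else 0)"
    and \<kappa>: "\<And>v w a b. \<kappa> (recol v a) (recol w b) = \<kappa> v w"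
  shows "wk (rot U n X f) = rot U n X (wk f)"
proof -
  interpret rotation U n X by fact
  let ?T = "uncoloured V"
  have K: "(\<Sum>x\<in>V. \<Sum>y\<in>V. r x y *\<^sub>R deriv_at y (deriv_at x g))
      = (\<Sum>t\<in>?T. \<Sum>s\<in>?T. \<kappa> t s *\<^sub>R (\<Sum>a<n. deriv_at (recol s a) (deriv_at (recol t a) g)))" for g
  proof -
    have "(\<Sum>x\<in>V. \<Sum>y\<in>V. r x y *\<^sub>R deriv_at y (deriv_at x g))
       = (\<Sum>x\<in>V. \<Sum>y\<in>V. (if colour x = colour y then \<kappa> x y else 0) *\<^sub>R deriv_at y (deriv_at x g))"
      using r by (intro sum.cong refl) simp
    also have "\<dots> = (\<Sum>t\<in>?T. \<Sum>a<n. \<Sum>s\<in>?T. \<kappa> t s *\<^sub>R deriv_at (recol s a) (deriv_at (recol t a) g))"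
      unfolding sum_recolourable[OF assms(2)]
      by (intro sum.cong refl) (simp add: \<kappa> if_distrib if_distribR cong: if_cong)
    also have "\<dots> = (\<Sum>t\<in>?T. \<Sum>s\<in>?T. \<kappa> t s *\<^sub>R (\<Sum>a<n. deriv_at (recol s a) (deriv_at (recol t a) g)))"
      by (simp add: scaleR_sum_right) (rule sum.cong[OF refl], rule sum.swap)
    finally show ?thesis .
  qed
  have "(\<Sum>a<n. deriv_at (recol s a) (deriv_at (recol t a) (D f))) = D (\<Sum>a<n. deriv_at (recol s a) (deriv_at (recol t a) f))"
    if "t \<in> ?T" "s \<in> ?T" for t s
  proof -
    have U: "recol t a \<in> U" "recol s a \<in> U" if "a < n" for a
      using recolourable_uncoloured[OF assms(2)] that \<open>t \<in> ?T\<close> \<open>s \<in> ?T\<close> assms(3) by blast+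
    have "(\<Sum>a<n. deriv_at (recol s a) (deriv_at (recol t a) (D f)))
      = (\<Sum>a<n. D (deriv_at (recol s a) (deriv_at (recol t a) f))
          + (\<Sum>c<n. X c a *\<^sub>R (deriv_at (recol s c) (deriv_at (recol t a) f) + deriv_at (recol s a) (deriv_at (recol t c) f))))"
      by (intro sum.cong refl)
         (simp add: U deriv_at_rot deriv_at_sum scaleR_add_right sum.distrib add_ac)
    also have "\<dots> = D (\<Sum>a<n. deriv_at (recol s a) (deriv_at (recol t a) f))
      + (\<Sum>c<n. \<Sum>a<n. X c a *\<^sub>R (deriv_at (recol s a) (deriv_at (recol t c) f) + deriv_at (recol s c) (deriv_at (recol t a) f)))"
      unfolding finlin_map_sum[OF finlin_rot] sum.distrib
      by (intro arg_cong2[of _ _ _ _ "(+)"] refl, rule trans[OF sum.swap]) (simp add: add.commute)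
    also have "(\<Sum>c<n. \<Sum>a<n. X c a *\<^sub>R (deriv_at (recol s a) (deriv_at (recol t c) f) + deriv_at (recol s c) (deriv_at (recol t a) f))) = 0"
      using antisymmetric_sum_eq_0[of n X "\<lambda>a c. deriv_at (recol s a) (deriv_at (recol t c) f)"] antisymmetric by blast
    finally show ?thesis by simp
  qed
  then have "(\<Sum>t\<in>?T. \<Sum>s\<in>?T. \<kappa> t s *\<^sub>R (\<Sum>a<n. deriv_at (recol s a) (deriv_at (recol t a) (D f))))
    = D (\<Sum>t\<in>?T. \<Sum>s\<in>?T. \<kappa> t s *\<^sub>R (\<Sum>a<n. deriv_at (recol s a) (deriv_at (recol t a) f)))"
    by (simp add: finlin_map_sum[OF finlin_rot] finlin_map_scaleR[OF finlin_rot] cong: sum.cong)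
  then show ?thesis
    unfolding wick_eq K by (simp only: finlin_map_scaleR[OF finlin_rot] finlin_map_hbar[OF finlin_rot])
qed

section \<open>The adjoint action in the orthonormal basis\<close>

context quadratic_lie_algebra
begin

lemmas form_simps [simp] =
  bilinear_ladd[OF bilinear_form] bilinear_radd[OF bilinear_form]
  bilinear_lmul[OF bilinear_form] bilinear_rmul[OF bilinear_form]
  bilinear_lneg[OF bilinear_form] bilinear_rneg[OF bilinear_form]

lemma bracket_antisym: "bracket L X Y = - bracket L Y X"
proof -
  have "bracket L (X + Y) (X + Y) = 0" by (rule bracket_self)
  then have "bracket L X Y + bracket L Y X = 0"
    unfolding bilinear_ladd[OF bilinear_bracket] bilinear_radd[OF bilinear_bracket]
    by (simp add: bracket_self add.commute)
  then show ?thesis by (simp add: eq_neg_iff_add_eq_0)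
qed

lemma expand: "(\<Sum>a<ldim L. form L (lbasis L a) Y *\<^sub>R lbasis L a) = Y"
proof -
  obtain c where c: "Y = (\<Sum>j<ldim L. c j *\<^sub>R lbasis L j)" using in_span_basis[OF lbasis] by blast
  have "form L (lbasis L a) Y = c a" if "a < ldim L" for a
  proof -
    have "form L (lbasis L a) Y = (\<Sum>j<ldim L. c j * form L (lbasis L a) (lbasis L j))"
    proof -
      have lin: "linear (form L (lbasis L a))" using bilinear_form by (simp add: bilinear_def)
      show ?thesis unfolding c by (simp add: linear_sum[OF lin])
    qed
    also have "\<dots> = (\<Sum>j<ldim L. if a = j then c j else 0)"
      using that by (intro sum.cong) (auto simp: orthonormal)
    finally show ?thesis using that by simp
  qed
  then show ?thesis by (subst (2) c) (intro sum.cong, auto)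
qed

definition adm :: "'g \<Rightarrow> nat \<Rightarrow> nat \<Rightarrow> real" where
  "adm X a c = form L (lbasis L a) (bracket L X (lbasis L c))"

lemma adm_antisym: "adm X a c = - adm X c a"
proof -
  have "adm X a c = form L (bracket L (lbasis L a) X) (lbasis L c)"
    by (simp add: adm_def form_invariant)
  also have "\<dots> = - form L (lbasis L c) (bracket L X (lbasis L a))"
    by (subst bracket_antisym) (simp add: form_symm)
  finally show ?thesis by (simp add: adm_def)
qed

definition strc :: "nat \<Rightarrow> nat \<Rightarrow> nat \<Rightarrow> real" where
  "strc a b c = form L (lbasis L a) (bracket L (lbasis L b) (lbasis L c))"

text \<open>The Jacobi identity makes \<open>bracket L X\<close> a derivation of the bracket, and
  invariance of the form moves it off the first slot with a minus sign.\<close>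

lemma strc_invariant:
  "(\<Sum>d<ldim L. adm X d a * strc d b c + adm X d b * strc a d c + adm X d c * strc a b d) = 0"
proof -
  let ?T = "lbasis L" and ?n = "ldim L"
  \<comment> \<open>Contracting with a column of the matrix of \<open>bracket L X\<close> evaluates
    a linear functional at the rotated basis vector, so each of the three sums becomes a single
    bracket expression.\<close>
  have ex: "(\<Sum>d<?n. adm X d a * g (?T d)) = g (bracket L X (?T a))" if "linear g" for g :: "'g \<Rightarrow> real" and a
  proof -
    have "g (bracket L X (?T a)) = g (\<Sum>d<?n. adm X d a *\<^sub>R ?T d)"
      using expand[of "bracket L X (?T a)"] by (simp add: adm_def)
    also have "\<dots> = (\<Sum>d<?n. adm X d a * g (?T d))"
      by (simp add: linear_sum[OF that] linear_cmul[OF that])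
    finally show ?thesis by simp
  qed
  have lin: "linear (\<lambda>Y. form L Y Z)" "linear (\<lambda>Y. form L Z (bracket L Y Z'))" "linear (\<lambda>Y. form L Z (bracket L Z' Y))" for Z Z'
    by (rule linearI; simp add: bilinear_ladd[OF bilinear_bracket] bilinear_radd[OF bilinear_bracket]
        bilinear_lmul[OF bilinear_bracket] bilinear_rmul[OF bilinear_bracket])+
  have "(\<Sum>d<?n. adm X d a * strc d b c + adm X d b * strc a d c + adm X d c * strc a b d)
    = form L (bracket L X (?T a)) (bracket L (?T b) (?T c)) + form L (?T a) (bracket L (bracket L X (?T b)) (?T c))
      + form L (?T a) (bracket L (?T b) (bracket L X (?T c)))"
    unfolding strc_def sum.distrib
    by (simp add: ex[OF lin(1)] ex[OF lin(2)] ex[OF lin(3)])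
  also have "form L (bracket L X (?T a)) (bracket L (?T b) (?T c)) = - form L (?T a) (bracket L X (bracket L (?T b) (?T c)))"
    by (subst bracket_antisym) (simp add: form_invariant)
  also have "bracket L X (bracket L (?T b) (?T c)) = bracket L (bracket L X (?T b)) (?T c) + bracket L (?T b) (bracket L X (?T c))"
  proof -
    have "bracket L X (bracket L (?T b) (?T c)) = - bracket L (?T b) (bracket L (?T c) X) - bracket L (?T c) (bracket L X (?T b))"
      using jacobi[of X "?T b" "?T c"] by (simp add: algebra_simps eq_neg_iff_add_eq_0)
    also have "bracket L (?T b) (bracket L (?T c) X) = - bracket L (?T b) (bracket L X (?T c))"
      by (subst bracket_antisym[of "?T c"]) (simp add: bilinear_rneg[OF bilinear_bracket])
    also have "bracket L (?T c) (bracket L X (?T b)) = - bracket L (bracket L X (?T b)) (?T c)"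
      by (rule bracket_antisym)
    finally show ?thesis by simp
  qed
  finally show ?thesis by simp
qed

end

section \<open>The cubic interaction\<close>

fun vdeg :: "fvar \<Rightarrow> nat" where
  "vdeg (A0 a) = 0"
| "vdeg (A1 i a) = 1"
| "vdeg (A2 i a) = 2"
| "vdeg (A3 a) = 3"
| "vdeg (Om k j a) = k"

lemma ghost_vdeg: "ghost v = 1 - int (vdeg v)"
  by (cases v) auto

definition varsA0 :: "'g lie \<Rightarrow> fvar set" where "varsA0 L = A0 ` {..<ldim L}"
definition varsA2 :: "'g lie \<Rightarrow> ('c, 'h) frame \<Rightarrow> fvar set" where
  "varsA2 L E = (\<lambda>(i, a). A2 i a) ` ({..<b1 E} \<times> {..<ldim L})"
definition varsA3 :: "'g lie \<Rightarrow> fvar set" where "varsA3 L = A3 ` {..<ldim L}"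

lemma varsF'_eq: "varsF' L E = varsA0 L \<union> vars1 L E \<union> varsA2 L E \<union> varsA3 L"
  by (auto simp: varsF'_def varsA0_def varsA2_def varsA3_def image_iff)

lemma finite_varsA [simp]: "finite (varsA0 L)" "finite (varsA2 L E)" "finite (varsA3 L)"
  by (simp_all add: varsA0_def varsA2_def varsA3_def)

lemma varsF'_cases:
  assumes "v \<in> varsF' L E"
  obtains a where "v = A0 a" "a < ldim L" | i a where "v = A1 i a" "i < b1 E" "a < ldim L"
    | i a where "v = A2 i a" "i < b1 E" "a < ldim L" | a where "v = A3 a" "a < ldim L"
  using assms by (auto simp: varsF'_def vars1_def)

lemma recolourable_vars: "recolourable (ldim L) (vars L E)"
proof -
  have "\<forall>v\<in>vars L E. colour v < ldim L" "\<forall>v\<in>vars L E. \<forall>a<ldim L. recol v a \<in> vars L E"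
    by (auto simp: vars_def varsF'_def vars1_def varsK_def)
  then show ?thesis by (simp add: recolourable_def)
qed

lemma recolourable_varsK: "recolourable (ldim L) (varsK L E)"
  by (auto simp: recolourable_def) (auto simp: varsK_def)

context bv_setup
begin

text \<open>The representative of [1] and the unit differ by an exact element of degree 0, and there
  are none besides 0. Hence \<alpha>(0) multiplies exactly the unit.\<close>

lemma iota_h0: "iota I (h0 A I) = unity A"
proof -
  let ?a = "iota I (h0 A I) + (- 1) *\<^sub>R unity A"
  have h0: "h0 A I \<in> coh A I 0"
    using unity_grade diff_unity by (auto simp: h0_def coh_def)
  have d: "diff A ?a = 0"
    by (simp only: linear_add[OF linear_diff] linear_cmul[OF linear_diff] diff_iota diff_unity) simp
  have d1: "diff A ((- 1) *\<^sub>R unity A) = 0"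
    by (simp only: linear_cmul[OF linear_diff] diff_unity) simp
  have "cls I ?a = h0 A I + (- 1) *\<^sub>R h0 A I"
    unfolding cls_add[OF diff_iota d1] cls_scale[OF diff_unity] cls_iota by (simp add: h0_def)
  then have "?a \<in> range (diff A)" using cls_eq_0[OF d] by simp
  then obtain x where x: "?a = diff A x" by blast
  have "?a \<in> grade A 0"
    by (intro subspace_add[OF subspace_grade] subspace_scale[OF subspace_grade] iota_grade h0 unity_grade)
  then have "?a = comp 0 ?a" by (simp only: comp_homogeneous if_True refl)
  also have "\<dots> = 0" unfolding x comp_diff by simp
  finally show ?thesis by simp
qed

definition phi :: "fvar \<Rightarrow> 'c" where
  "phi v = iota I (alpha A I E v) + omega'' E v"

lemma phi_simps [simp]:
  "phi (A0 a) = unity A" "phi (A1 i a) = iota I (h1 E i)" "phi (A2 i a) = iota I (h2 E i)"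
  "phi (A3 a) = iota I (h3 E)" "phi (Om k j a) = fK E k j"
  by (simp_all add: phi_def iota_h0 linear_0[OF linear_iota])

lemma phi_recol [simp]: "phi (recol v a) = phi v"
  by (cases v) auto

lemma phi_F': "v \<in> varsF' L E \<Longrightarrow> phi v = iota I (alpha A I E v)"
  by (auto simp: varsF'_def vars1_def phi_def)

lemma in_vars_cases: "v \<in> vars L E \<Longrightarrow> v \<in> varsF' L E \<or> v \<in> varsK L E"
  by (auto simp: vars_def)

lemma phi_grade: "v \<in> vars L E \<Longrightarrow> phi v \<in> grade A (vdeg v)"
proof -
  assume "v \<in> vars L E"
  then consider "v \<in> varsF' L E" | "v \<in> varsK L E" using in_vars_cases by blast
  then show ?thesis
  proof cases
    case 1
    then show ?thesis
      using basis_in[OF h1] basis_in[OF h2] h3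
      by (elim varsF'_cases) (auto intro: iota_grade unity_grade)
  next
    case 2
    then show ?thesis by (elim in_varsK_cases) (auto intro: fK_grade)
  qed
qed

lemma hty_phi: "v \<in> vars L E \<Longrightarrow> hty I (phi v) = 0"
proof -
  assume "v \<in> vars L E"
  then consider "v \<in> varsF' L E" | "v \<in> varsK L E" using in_vars_cases by blast
  then show ?thesis
  proof cases
    case 1
    then show ?thesis by (simp add: phi_F' hty_iota)
  next
    case 2
    then obtain k j a where "v = Om k j a" "j < nK E k" by (elim in_varsK_cases) auto
    then show ?thesis using fK_range hty_hty by fastforce
  qed
qed

lemma pairing_phi_varsK:
  assumes "u \<in> vars L E" "v \<in> vars L E" "u \<in> varsK L E \<or> v \<in> varsK L E"
  shows "pairing A (phi u) (phi v) = 0"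
proof -
  have r: "phi x \<in> range (hty I)" if "x \<in> varsK L E" for x
    using that by (elim in_varsK_cases) (auto simp: fK_range)
  show ?thesis
    using assms(3)
  proof
    assume "u \<in> varsK L E"
    then obtain x where "phi u = hty I x" using r by blast
    then show ?thesis using pairing_hty_left[OF hty_phi[OF assms(2)]] by simp
  next
    assume "v \<in> varsK L E"
    then obtain x where "phi v = hty I x" using r by blast
    then show ?thesis using pairing_hty_right[OF hty_phi[OF assms(1)]] by simp
  qed
qed

definition triple :: "fvar \<Rightarrow> fvar \<Rightarrow> fvar \<Rightarrow> real" where
  "triple u v w = pairing A (phi u) (prd A (phi v) (phi w))"

definition ksign :: "fvar \<Rightarrow> fvar \<Rightarrow> fvar \<Rightarrow> real" where
  "ksign u v w = koszul (ghost v) (degree_of A (phi w)) * koszul (ghost u) (degree_of A (phi v) + degree_of A (phi w))"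

definition coupling :: "fvar \<Rightarrow> fvar \<Rightarrow> fvar \<Rightarrow> real" where
  "coupling u v w = ksign u v w * triple u v w * strc (colour u) (colour v) (colour w)"

text \<open>Indexed by an arbitrary set of ordered triples, so that the interaction can be split
  according to which coordinates occur.\<close>

definition cub :: "(fvar \<times> fvar \<times> fvar) set \<Rightarrow> sfun" where
  "cub S = (1 / 6) *\<^sub>R (\<Sum>(u, v, w)\<in>S. coupling u v w *\<^sub>R (svar u * svar v * svar w))"

lemma cub_product:
  "cub (V \<times> V \<times> V) = (1 / 6) *\<^sub>R (\<Sum>u\<in>V. \<Sum>v\<in>V. \<Sum>w\<in>V. coupling u v w *\<^sub>R (svar u * svar v * svar w))"
  by (simp add: cub_def sum.cartesian_product)

lemma triple_nonzero:
  assumes "u \<in> vars L E" "v \<in> vars L E" "w \<in> vars L E" "triple u v w \<noteq> 0"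
  shows "vdeg u + vdeg v + vdeg w = 3" "degree_of A (phi v) = int (vdeg v)"
    "degree_of A (phi w) = int (vdeg w)" "degree_of A (phi u) = int (vdeg u)"
proof -
  have "vdeg u + (vdeg v + vdeg w) = 3"
    by (rule pairing_degree[OF phi_grade prd_grade[OF phi_grade phi_grade]])
       (use assms in \<open>auto simp: triple_def\<close>)
  then show "vdeg u + vdeg v + vdeg w = 3" by simp
  have "phi u \<noteq> 0" "phi v \<noteq> 0" "phi w \<noteq> 0"
    using assms(4) by (auto simp: triple_def bilinear_lzero[OF bilinear_prd] bilinear_rzero[OF bilinear_prd])
  then show "degree_of A (phi v) = int (vdeg v)"
    "degree_of A (phi w) = int (vdeg w)" "degree_of A (phi u) = int (vdeg u)"
    using assms phi_grade degree_of_eq by blast+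
qed

lemma coupling_ghost:
  assumes "u \<in> vars L E" "v \<in> vars L E" "w \<in> vars L E" "coupling u v w \<noteq> 0"
  shows "ghost u + ghost v + ghost w = 0"
  using triple_nonzero(1)[OF assms(1-3)] assms(4) by (auto simp: coupling_def ghost_vdeg)

text \<open>Representatives are closed and orthogonal to exact elements, so the kinetic term does
  not see \<iota>(\<alpha>).\<close>

lemma spair_free:
  "spair A L (vars L E) phi (diff A \<circ> phi) = spair A L (vars L E) (omega'' E) (diff A \<circ> omega'' E)"
proof -
  have "diff A (phi w) = diff A (omega'' E w)" for w
    unfolding phi_def by (simp only: linear_add[OF linear_diff] diff_iota) simp
  moreover have "pairing A (phi v) (diff A y) = pairing A (omega'' E v) (diff A y)" for v y
    by (simp add: phi_def pairing_cocycle_diff[OF diff_iota])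
  ultimately show ?thesis by (simp add: spair_def)
qed

lemma action_minus_free:
  "action A L (vars L E) (\<lambda>v. iota I (alpha A I E v) + omega'' E v) - free_action A L E
    = cub (vars L E \<times> vars L E \<times> vars L E)"
proof -
  have "(\<lambda>v. iota I (alpha A I E v) + omega'' E v) = phi" by (auto simp: phi_def)
  then show ?thesis
    unfolding action_def free_action_def spair_free[symmetric]
    by (simp add: spair_free cub_product spair_l_def coupling_def ksign_def triple_def strc_def mult_ac)
qed

lemma W_prod_eq: "W_prod A L I E = cub (varsF' L E \<times> varsF' L E \<times> varsF' L E)"
  unfolding W_prod_def cub_product spair_l_def
  by (intro arg_cong[of _ _ "\<lambda>x. _ *\<^sub>R x"] sum.cong refl)
     (simp add: coupling_def ksign_def triple_def strc_def phi_F' mult_ac)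

text \<open>The unit turns the triple product into a pairing of the other two factors. One of them
  lies in \<open>im K\<close>, which is orthogonal to \<open>im K\<close> and to
  \<open>im \<iota>\<close>.\<close>

lemma triple_unity:
  assumes "u \<in> vars L E" "v \<in> vars L E" "w \<in> vars L E"
    "u \<in> varsA0 L \<or> v \<in> varsA0 L \<or> w \<in> varsA0 L" "u \<in> varsK L E \<or> v \<in> varsK L E \<or> w \<in> varsK L E"
  shows "triple u v w = 0"
proof -
  have n: "x \<notin> varsK L E" if "x \<in> varsA0 L" for x using that by (auto simp: varsA0_def varsK_def)
  consider "u \<in> varsA0 L" | "v \<in> varsA0 L" | "w \<in> varsA0 L" using assms(4) by blast
  then show ?thesis
  proof cases
    case 1
    then have "triple u v w = pairing A (phi v) (phi w)" by (auto simp: triple_def varsA0_def pairing_unity)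
    then show ?thesis using pairing_phi_varsK assms 1 n by auto
  next
    case 2
    then have "triple u v w = pairing A (phi u) (phi w)" by (auto simp: triple_def varsA0_def prd_unity)
    then show ?thesis using pairing_phi_varsK assms 2 n by auto
  next
    case 3
    then have "triple u v w = pairing A (phi u) (phi v)" by (auto simp: triple_def varsA0_def prd_unity_right)
    then show ?thesis using pairing_phi_varsK assms 3 n by auto
  qed
qed

lemma cub_mono_neutral:
  assumes "finite T" "S \<subseteq> T" "\<And>u v w. (u, v, w) \<in> T \<Longrightarrow> (u, v, w) \<notin> S \<Longrightarrow> coupling u v w = 0"
  shows "cub T = cub S"
  unfolding cub_def by (intro arg_cong[of _ _ "\<lambda>x. _ *\<^sub>R x"] sum.mono_neutral_right) (use assms in auto)

lemma cub_union: "finite S \<Longrightarrow> finite T \<Longrightarrow> S \<inter> T = {} \<Longrightarrow> cub (S \<union> T) = cub S + cub T"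
  by (simp add: cub_def sum.union_disjoint scaleR_add_right)

definition V' :: "fvar set" where "V' = vars L E - varsA0 L"

definition A0_triples :: "(fvar \<times> fvar \<times> fvar) set" where
  "A0_triples = {(u, v, w). u \<in> varsF' L E \<and> v \<in> varsF' L E \<and> w \<in> varsF' L E \<and>
     (u \<in> varsA0 L \<or> v \<in> varsA0 L \<or> w \<in> varsA0 L)}"

lemma varsA0_subset: "varsA0 L \<subseteq> varsF' L E" "varsF' L E \<subseteq> vars L E"
  by (auto simp: varsF'_eq vars_def)

lemma finite_A0_triples: "finite A0_triples"
  by (rule finite_subset[of _ "varsF' L E \<times> varsF' L E \<times> varsF' L E"]) (auto simp: A0_triples_def)

lemma cub_split: "cub (vars L E \<times> vars L E \<times> vars L E) = cub A0_triples + cub (V' \<times> V' \<times> V')"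
proof -
  have "cub (vars L E \<times> vars L E \<times> vars L E) = cub (A0_triples \<union> V' \<times> V' \<times> V')"
  proof (rule cub_mono_neutral)
    fix u v w assume *: "(u, v, w) \<in> vars L E \<times> vars L E \<times> vars L E" "(u, v, w) \<notin> A0_triples \<union> V' \<times> V' \<times> V'"
    then have "u \<in> varsA0 L \<or> v \<in> varsA0 L \<or> w \<in> varsA0 L" by (auto simp: V'_def)
    moreover from this have "u \<in> varsK L E \<or> v \<in> varsK L E \<or> w \<in> varsK L E"
      using * in_vars_cases by (auto simp: A0_triples_def)
    ultimately show "coupling u v w = 0" using triple_unity[of u v w] * by (auto simp: coupling_def)
  qed (use varsA0_subset in \<open>auto simp: A0_triples_def V'_def\<close>)
  also have "\<dots> = cub A0_triples + cub (V' \<times> V' \<times> V')"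
    by (rule cub_union) (auto simp: finite_A0_triples, auto simp: V'_def A0_triples_def)
  finally show ?thesis .
qed

text \<open>Without \<open>A0\<close> every factor has degree at least 1, so total degree 3 forces
  all three to have degree 1.\<close>

lemma W_prod_split: "W_prod A L I E = cub A0_triples + cub (vars1 L E \<times> vars1 L E \<times> vars1 L E)"
proof -
  have "W_prod A L I E = cub (A0_triples \<union> vars1 L E \<times> vars1 L E \<times> vars1 L E)"
    unfolding W_prod_eq
  proof (rule cub_mono_neutral)
    fix u v w assume *: "(u, v, w) \<in> varsF' L E \<times> varsF' L E \<times> varsF' L E"
      "(u, v, w) \<notin> A0_triples \<union> vars1 L E \<times> vars1 L E \<times> vars1 L E"
    have ge: "vdeg x \<ge> 1" "x \<notin> vars1 L E \<Longrightarrow> vdeg x \<ge> 2" if "x \<in> varsF' L E" "x \<notin> varsA0 L" for x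
      using that by (auto simp: varsF'_eq varsA0_def vars1_def varsA2_def varsA3_def)
    have "u \<notin> varsA0 L" "v \<notin> varsA0 L" "w \<notin> varsA0 L" "u \<notin> vars1 L E \<or> v \<notin> vars1 L E \<or> w \<notin> vars1 L E"
      using * by (auto simp: A0_triples_def)
    then have "vdeg u + vdeg v + vdeg w > 3"
      using ge[of u] ge[of v] ge[of w] * by fastforce
    then show "coupling u v w = 0"
      using triple_nonzero(1)[of u v w] * varsA0_subset by (auto simp: coupling_def)
  qed (auto simp: A0_triples_def varsF'_eq)
  also have "\<dots> = cub A0_triples + cub (vars1 L E \<times> vars1 L E \<times> vars1 L E)"
    by (rule cub_union) (auto simp: finite_A0_triples, auto simp: A0_triples_def vars1_def varsA0_def)
  finally show ?thesis .
qed

lemma sum_vars1: "(\<Sum>v\<in>vars1 L E. f v) = (\<Sum>i<b1 E. \<Sum>a<ldim L. f (A1 i a))"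
  unfolding vars1_eq by (subst sum.reindex) (auto simp: inj_on_def sum.cartesian_product case_prod_beta o_def)

lemma W_prod_111_eq: "W_prod_111 A L I E = cub (vars1 L E \<times> vars1 L E \<times> vars1 L E)"
proof -
  let ?f = "\<lambda>i a j b k c. (pairing A (iota I (h1 E i)) (prd A (iota I (h1 E j)) (iota I (h1 E k)))
       * form L (lbasis L a) (bracket L (lbasis L b) (lbasis L c))) *\<^sub>R (svar (A1 i a) * svar (A1 j b) * svar (A1 k c))"
  have "cub (vars1 L E \<times> vars1 L E \<times> vars1 L E) =
     (1 / 6) *\<^sub>R (\<Sum>i<b1 E. \<Sum>a<ldim L. \<Sum>j<b1 E. \<Sum>b<ldim L. \<Sum>k<b1 E. \<Sum>c<ldim L. ?f i a j b k c)"
    unfolding cub_product sum_vars1 by (simp add: coupling_def ksign_def koszul_def triple_def strc_def)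
  also have "(\<Sum>i<b1 E. \<Sum>a<ldim L. \<Sum>j<b1 E. \<Sum>b<ldim L. \<Sum>k<b1 E. \<Sum>c<ldim L. ?f i a j b k c)
    = (\<Sum>i<b1 E. \<Sum>j<b1 E. \<Sum>a<ldim L. \<Sum>k<b1 E. \<Sum>b<ldim L. \<Sum>c<ldim L. ?f i a j b k c)"
    by (rule sum.cong[OF refl], rule trans[OF sum.swap],
        rule sum.cong[OF refl], rule sum.cong[OF refl], rule sum.swap)
  also have "\<dots> = (\<Sum>i<b1 E. \<Sum>j<b1 E. \<Sum>k<b1 E. \<Sum>a<ldim L. \<Sum>b<ldim L. \<Sum>c<ldim L. ?f i a j b k c)"
    by (rule sum.cong[OF refl], rule sum.cong[OF refl], rule sum.swap)
  finally show ?thesis by (simp add: W_prod_111_def)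
qed

section \<open>Symmetry of the cubic couplings\<close>

definition mon3 :: "fvar \<Rightarrow> fvar \<Rightarrow> fvar \<Rightarrow> sfun" where
  "mon3 u v w = coupling u v w *\<^sub>R (svar u * svar v * svar w)"

lemma strc_swap: "strc a c b = - strc a b c" "strc b a c = - strc a b c"
proof -
  show "strc a c b = - strc a b c"
    unfolding strc_def by (subst bracket_antisym) simp
  have "strc b a c = form L (bracket L (lbasis L b) (lbasis L a)) (lbasis L c)"
    by (simp add: strc_def form_invariant)
  also have "\<dots> = - form L (bracket L (lbasis L a) (lbasis L b)) (lbasis L c)"
    by (subst bracket_antisym) simp
  finally show "strc b a c = - strc a b c"
    by (simp add: strc_def form_invariant)
qed

lemma triple_swap:
  assumes "u \<in> vars L E" "v \<in> vars L E" "w \<in> vars L E"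
  shows "triple u w v = (-1) ^ (vdeg v * vdeg w) * triple u v w"
    and "triple v u w = (-1) ^ (vdeg u * vdeg v) * triple u v w"
proof -
  have "prd A (phi w) (phi v) = (-1) ^ (vdeg w * vdeg v) *\<^sub>R prd A (phi v) (phi w)"
    using prd_comm phi_grade assms by blast
  then show "triple u w v = (-1) ^ (vdeg v * vdeg w) * triple u v w"
    by (simp add: triple_def mult.commute)
  have "prd A (phi v) (phi u) = (-1) ^ (vdeg v * vdeg u) *\<^sub>R prd A (phi u) (phi v)"
    using prd_comm phi_grade assms by blast
  then show "triple v u w = (-1) ^ (vdeg u * vdeg v) * triple u v w"
    by (simp add: triple_def pairing_prd mult.commute)
qed

text \<open>Four signs cancel: those of the product, of the bracket, of the coordinates and of the
  Koszul rule, because ghost number is 1 minus degree. A vanishing triple is treated separately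
  since \<open>degree_of\<close> is meaningless at 0.\<close>

lemma mon3_swap_right:
  assumes "u \<in> vars L E" "v \<in> vars L E" "w \<in> vars L E"
  shows "mon3 u w v = mon3 u v w"
proof (cases "triple u v w = 0")
  case True
  then have "triple u w v = 0" using triple_swap(1)[OF assms] by simp
  then show ?thesis using True by (simp add: mon3_def coupling_def)
next
  case False
  have mon: "svar u * svar w * svar v = vsgn w v *\<^sub>R (svar u * svar v * svar w)"
    by (simp add: mult.assoc svar_svar[of w v])
  have "ksign u w v * (-1) ^ (vdeg v * vdeg w) * (-1) * vsgn w v = ksign u v w"
    using triple_nonzero[OF assms False]
    by (cases "even (vdeg u)"; cases "even (vdeg v)"; cases "even (vdeg w)")
       (simp_all add: ksign_def koszul_def vsgn_def ghost_vdeg)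
  then have *: "ksign u v w = ksign u w v * (-1) ^ (vdeg v * vdeg w) * (-1) * vsgn w v" by simp
  show ?thesis
    unfolding mon3_def coupling_def mon triple_swap(1)[OF assms] strc_swap(1)[of "colour u" "colour w" "colour v"] *
    by simp
qed

lemma mon3_swap_left:
  assumes "u \<in> vars L E" "v \<in> vars L E" "w \<in> vars L E"
  shows "mon3 v u w = mon3 u v w"
proof (cases "triple u v w = 0")
  case True
  then have "triple v u w = 0" using triple_swap(2)[OF assms] by simp
  then show ?thesis using True by (simp add: mon3_def coupling_def)
next
  case False
  have mon: "svar v * svar u * svar w = vsgn v u *\<^sub>R (svar u * svar v * svar w)"
    by (simp add: svar_svar[of v u])
  have "ksign v u w * (-1) ^ (vdeg u * vdeg v) * (-1) * vsgn v u = ksign u v w"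
    using triple_nonzero[OF assms False]
    by (cases "even (vdeg u)"; cases "even (vdeg v)"; cases "even (vdeg w)")
       (simp_all add: ksign_def koszul_def vsgn_def ghost_vdeg)
  then have *: "ksign u v w = ksign v u w * (-1) ^ (vdeg u * vdeg v) * (-1) * vsgn v u" by simp
  show ?thesis
    unfolding mon3_def coupling_def mon triple_swap(2)[OF assms] strc_swap(2)[of "colour v" "colour u" "colour w"] *
    by simp
qed

end

text \<open>Homogeneous polynomials of degree \<open>n\<close> with real coefficients. The span is
  over the reals, so no power of \<hbar> is hidden in a coefficient, as the integrality induction
  requires.\<close>

definition polys :: "fvar set \<Rightarrow> nat \<Rightarrow> sfun set" where
  "polys V n = span {prod_list (map svar ys) |ys. length ys = n \<and> set ys \<subseteq> V}"

lemma polys_induct [consumes 1, case_names subspace prod]: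
  assumes "p \<in> polys V n" "subspace {p. P p}"
    and "\<And>ys. length ys = n \<Longrightarrow> set ys \<subseteq> V \<Longrightarrow> P (prod_list (map svar ys))"
  shows "P p"
proof -
  have "polys V n \<subseteq> {p. P p}"
    unfolding polys_def by (rule span_minimal) (use assms in auto)
  then show ?thesis using assms(1) by blast
qed

lemma polys_prod: "length ys = n \<Longrightarrow> set ys \<subseteq> V \<Longrightarrow> prod_list (map svar ys) \<in> polys V n"
  unfolding polys_def by (rule span_base) blast

lemma subspace_polys: "subspace (polys V n)"
  unfolding polys_def by (rule subspace_span)

lemma polys_svar_mult: "p \<in> polys V n \<Longrightarrow> x \<in> V \<Longrightarrow> svar x * p \<in> polys V (Suc n)"
proof (induction rule: polys_induct)
  case subspace
  then show ?case
    using subspace_polys[of V "Suc n"] by (auto simp: subspace_def distrib_left)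
next
  case (prod ys)
  then show ?case using polys_prod[of "x # ys" "Suc n" V] by simp
qed

lemma polys_mult: "p \<in> polys V m \<Longrightarrow> q \<in> polys V n \<Longrightarrow> p * q \<in> polys V (m + n)"
proof (induction rule: polys_induct)
  case subspace
  then show ?case
    using subspace_polys[of V "m + n"] by (auto simp: subspace_def distrib_right)
next
  case (prod ys)
  then show ?case
    by (induction ys arbitrary: m) (auto simp: mult.assoc intro: polys_svar_mult)
qed

text \<open>The truncated \<open>n - 1\<close> is harmless in degree 0, where the derivative
  vanishes.\<close>

lemma polys_deriv_at: "p \<in> polys V n \<Longrightarrow> deriv_at y p \<in> polys V (n - 1)"
proof (induction rule: polys_induct)
  case subspace
  then show ?case
    using subspace_polys[of V "n - 1"] by (auto simp: subspace_def)
next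
  case (prod ys)
  then show ?case
  proof (induction ys arbitrary: n)
    case Nil
    then show ?case using subspace_0[OF subspace_polys] by simp
  next
    case (Cons x ys)
    let ?P = "prod_list (map svar ys)"
    have P: "?P \<in> polys V (n - 1)" using Cons.prems by (intro polys_prod) auto
    have "svar x * deriv_at y ?P \<in> polys V (n - 1)"
    proof (cases ys)
      case Nil
      then show ?thesis using subspace_0[OF subspace_polys] by simp
    next
      case (Cons x' ys')
      have "svar x * deriv_at y ?P \<in> polys V (Suc (length ys - 1))"
        using Cons.prems by (intro polys_svar_mult Cons.IH) auto
      then show ?thesis using Cons.prems Cons by auto
    qed
    then show ?case using P
      by (auto simp: deriv_at_svar_mult intro!: subspace_add[OF subspace_polys] subspace_scale[OF subspace_polys]
          subspace_0[OF subspace_polys])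
  qed
qed

lemma wt_polys: "p \<in> polys V n \<Longrightarrow> wt (2 * int n) p"
proof (induction rule: polys_induct)
  case subspace
  then show ?case by (auto simp: subspace_def wt_add wt_scaleR)
next
  case (prod ys)
  then show ?case
  proof (induction ys arbitrary: n)
    case (Cons x ys)
    have "wt (2 + 2 * int (length ys)) (svar x * prod_list (map svar ys))"
      using Cons by (intro wt_mult wt_svar) auto
    then show ?case using Cons.prems by (auto simp: algebra_simps)
  qed (simp add: wt_1)
qed

lemma integ_1: "integ N 1"
  by (auto simp: integ_def coeff_1 fls_ge_def)

context bv_setup
begin

lemma cub_Fun:
  assumes "\<And>u v w. (u, v, w) \<in> S \<Longrightarrow> u \<in> V \<and> v \<in> V \<and> w \<in> V"
  shows "cub S \<in> Fun V"
  unfolding cub_def Fun_supp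
proof (intro supp_scaleR supp_sum, clarify)
  fix u v w assume "(u, v, w) \<in> S"
  then have "u \<in> V" "v \<in> V" "w \<in> V" using assms by auto
  then show "coupling u v w *\<^sub>R (svar u * svar v * svar w) \<in> supp (over V)"
    by (intro supp_scaleR supp_closed_mult add_closed_over supp_svar) (auto simp: over_def)
qed

lemma cub_gr:
  assumes "S \<subseteq> vars L E \<times> vars L E \<times> vars L E"
  shows "cub S \<in> supp (gr 0)"
  unfolding cub_def
proof (intro supp_scaleR supp_sum, clarify)
  fix u v w assume "(u, v, w) \<in> S"
  then have uvw: "u \<in> vars L E" "v \<in> vars L E" "w \<in> vars L E" using assms by auto
  show "coupling u v w *\<^sub>R (svar u * svar v * svar w) \<in> supp (gr 0)"
  proof (cases "coupling u v w = 0")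
    case False
    then have g: "ghost u + ghost v + ghost w = 0" by (rule coupling_ghost[OF uvw])
    have "svar u * svar v \<in> supp {{#u, v#}}"
      by (rule supp_mult[OF supp_svar[of _ "{{#u#}}"] supp_svar[of _ "{{#v#}}"]]) auto
    then have "svar u * svar v * svar w \<in> supp (gr 0)"
      by (rule supp_mult[OF _ supp_svar[of _ "{{#w#}}"]]) (use g in \<open>auto simp: gr_def\<close>)
    then show ?thesis by (rule supp_scaleR)
  qed simp
qed

lemma wt_cub: "wt 6 (cub S)"
proof -
  have "wt (2 + 2 + 2) (svar u * svar v * svar w)" for u v w by (intro wt_mult wt_svar)
  then have "wt 6 (svar u * svar v * svar w)" for u v w by simp
  then show ?thesis unfolding cub_def by (intro wt_scaleR wt_sum) (auto simp: wt_scaleR)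
qed

lemma coeff_cub_empty: "coeff (cub S) {#} = 0"
  by (simp add: cub_def coeff_mult_empty coeff_svar case_prod_beta)

lemma cub_polys: "cub (vars L E \<times> vars L E \<times> vars L E) \<in> polys (vars L E) 3"
proof -
  have "svar u * svar v * svar w \<in> polys (vars L E) 3" if "u \<in> vars L E" "v \<in> vars L E" "w \<in> vars L E" for u v w
    using polys_prod[of "[u, v, w]" 3 "vars L E"] that by (simp add: mult.assoc)
  then show ?thesis unfolding cub_def
    by (intro subspace_scale[OF subspace_polys] subspace_sum[OF subspace_polys])
       (auto intro!: subspace_scale[OF subspace_polys])
qed

lemma rotation_vars: "rotation (vars L E) (ldim L) (adm X)"
  by unfold_locales (rule recolourable_vars, rule adm_antisym)

lemma rot_cub: "rot (vars L E) (ldim L) (adm X) (cub (vars L E \<times> vars L E \<times> vars L E)) = 0"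
proof -
  interpret rotation "vars L E" "ldim L" "adm X" by (rule rotation_vars)
  have "D (\<Sum>u\<in>vars L E. \<Sum>v\<in>vars L E. \<Sum>w\<in>vars L E. coupling u v w *\<^sub>R (svar u * svar v * svar w)) = 0"
    unfolding coupling_def
    by (rule rot_cubic) (simp_all add: ksign_def triple_def strc_invariant)
  then show ?thesis by (simp add: cub_product finlin_map_scaleR[OF finlin_rot])
qed

section \<open>The part of the interaction that contains \<alpha>(0)\<close>

lemma sum_varsA0: "(\<Sum>v\<in>varsA0 L. f v) = (\<Sum>a<ldim L. f (A0 a))"
  unfolding varsA0_def by (subst sum.reindex) (auto simp: inj_on_def)

lemma sum_varsA2: "(\<Sum>v\<in>varsA2 L E. f v) = (\<Sum>i<b1 E. \<Sum>a<ldim L. f (A2 i a))"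
  unfolding varsA2_def by (subst sum.reindex) (auto simp: inj_on_def sum.cartesian_product case_prod_beta o_def)

definition mon3_sum :: "fvar set \<Rightarrow> fvar set \<Rightarrow> fvar set \<Rightarrow> sfun" where
  "mon3_sum P Q R = (\<Sum>u\<in>P. \<Sum>v\<in>Q. \<Sum>w\<in>R. mon3 u v w)"

lemma mon3_sum_swap:
  assumes "P \<subseteq> vars L E" "Q \<subseteq> vars L E" "R \<subseteq> vars L E"
  shows "mon3_sum P R Q = mon3_sum P Q R" "mon3_sum Q P R = mon3_sum P Q R"
proof -
  have "mon3_sum P R Q = (\<Sum>u\<in>P. \<Sum>v\<in>Q. \<Sum>w\<in>R. mon3 u w v)"
    unfolding mon3_sum_def by (rule sum.cong[OF refl], rule sum.swap)
  also have "\<dots> = mon3_sum P Q R"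
    unfolding mon3_sum_def using assms by (intro sum.cong refl mon3_swap_right) auto
  finally show "mon3_sum P R Q = mon3_sum P Q R" .
  have "mon3_sum Q P R = (\<Sum>u\<in>P. \<Sum>v\<in>Q. \<Sum>w\<in>R. mon3 v u w)"
    unfolding mon3_sum_def by (rule sum.swap)
  also have "\<dots> = mon3_sum P Q R"
    unfolding mon3_sum_def using assms by (intro sum.cong refl mon3_swap_left) auto
  finally show "mon3_sum Q P R = mon3_sum P Q R" .
qed

text \<open>The unit leaves the pairing of dual bases, and the two Koszul signs are both -1.\<close>

lemma coupling_201:
  assumes "i < b1 E" "j < b1 E" "a < ldim L" "b < ldim L" "c < ldim L"
  shows "coupling (A2 i a) (A0 c) (A1 j b) = (if i = j then strc a c b else 0)"
proof -
  have v: "A2 i a \<in> vars L E" "A0 c \<in> vars L E" "A1 j b \<in> vars L E"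
    using assms by (auto simp: vars_def varsF'_def vars1_def)
  have "triple (A2 i a) (A0 c) (A1 j b) = pairing A (iota I (h2 E i)) (iota I (h1 E j))"
    by (simp add: triple_def prd_unity)
  also have "\<dots> = (-1) ^ (2 * 1) * pairing A (iota I (h1 E j)) (iota I (h2 E i))"
    using phi_grade[OF v(1)] phi_grade[OF v(3)] by (intro pairing_symm) auto
  also have "\<dots> = (if i = j then 1 else 0)"
    using h1_h2[OF assms(2,1)] by (auto simp: pairing'_def)
  finally have t: "triple (A2 i a) (A0 c) (A1 j b) = (if i = j then 1 else 0)" .
  show ?thesis
  proof (cases "i = j")
    case True
    then have "triple (A2 i a) (A0 c) (A1 j b) \<noteq> 0" using t by simp
    from triple_nonzero[OF v this] have "ksign (A2 i a) (A0 c) (A1 j b) = 1"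
      by (simp add: ksign_def koszul_def)
    then show ?thesis using t True by (simp add: coupling_def)
  qed (simp add: coupling_def t)
qed

definition A03_triples :: "(fvar \<times> fvar \<times> fvar) set" where
  "A03_triples = A0_triples \<inter> (varsA0 L \<union> varsA3 L) \<times> (varsA0 L \<union> varsA3 L) \<times> (varsA0 L \<union> varsA3 L)"

definition U012 :: sfun where
  "U012 = (\<Sum>i<b1 E. \<Sum>a<ldim L. \<Sum>c<ldim L. \<Sum>b<ldim L. strc a c b *\<^sub>R (svar (A2 i a) * (svar (A0 c) * svar (A1 i b))))"

text \<open>Degrees adding up to 3 with one of them 0 are 0, 1, 2 or 0, 0, 3 in some order. The six
  orders of 0, 1, 2 contribute equally and cancel the factor 1/6. The terms 0, 0, 3 contain neither
  \<open>A1\<close> nor \<open>A2\<close> and need not be computed.\<close>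

lemma cub_A0_triples: "cub A0_triples = U012 + cub A03_triples"
proof -
  let ?X = "varsA0 L" and ?Y = "vars1 L E" and ?Z = "varsA2 L E"
  have sub: "?X \<subseteq> vars L E" "?Y \<subseteq> vars L E" "?Z \<subseteq> vars L E"
    by (auto simp: vars_def varsF'_eq)
  have "cub A0_triples = cub (?Z \<times> ?X \<times> ?Y \<union> ?Z \<times> ?Y \<times> ?X \<union> ?X \<times> ?Z \<times> ?Y \<union> ?X \<times> ?Y \<times> ?Z \<union> ?Y \<times> ?X \<times> ?Z \<union> ?Y \<times> ?Z \<times> ?X \<union> A03_triples)"
  proof (rule cub_mono_neutral[OF finite_A0_triples])
    fix u v w
    assume *: "(u, v, w) \<in> A0_triples" "(u, v, w) \<notin> ?Z \<times> ?X \<times> ?Y \<union> ?Z \<times> ?Y \<times> ?X \<union> ?X \<times> ?Z \<times> ?Y \<union> ?X \<times> ?Y \<times> ?Z \<union> ?Y \<times> ?X \<times> ?Z \<union> ?Y \<times> ?Z \<times> ?X \<union> A03_triples"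
    show "coupling u v w = 0"
    proof (rule ccontr)
      assume "coupling u v w \<noteq> 0"
      then have g: "vdeg u + vdeg v + vdeg w = 3"
        using triple_nonzero(1)[of u v w] *(1) varsA0_subset by (auto simp: coupling_def A0_triples_def)
      have dX: "x \<in> ?X \<longleftrightarrow> vdeg x = 0" and dY: "x \<in> ?Y \<longleftrightarrow> vdeg x = 1" and dZ: "x \<in> ?Z \<longleftrightarrow> vdeg x = 2"
        and dW: "x \<in> varsA3 L \<longleftrightarrow> vdeg x = 3" if "x \<in> varsF' L E" for x
        using that by (auto elim!: varsF'_cases simp: varsA0_def vars1_def varsA2_def varsA3_def image_iff)
      have m: "u \<in> varsF' L E" "v \<in> varsF' L E" "w \<in> varsF' L E" using *(1) by (auto simp: A0_triples_def)
      have "u \<in> ?X \<or> v \<in> ?X \<or> w \<in> ?X" using *(1) by (auto simp: A0_triples_def)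
      then have "vdeg u = 0 \<or> vdeg v = 0 \<or> vdeg w = 0" using m by (simp add: dX)
      then have "vdeg u = 2 \<and> vdeg v = 0 \<and> vdeg w = 1 \<or> vdeg u = 2 \<and> vdeg v = 1 \<and> vdeg w = 0
        \<or> vdeg u = 0 \<and> vdeg v = 2 \<and> vdeg w = 1 \<or> vdeg u = 0 \<and> vdeg v = 1 \<and> vdeg w = 2
        \<or> vdeg u = 1 \<and> vdeg v = 0 \<and> vdeg w = 2 \<or> vdeg u = 1 \<and> vdeg v = 2 \<and> vdeg w = 0
        \<or> vdeg u = 3 \<and> vdeg v = 0 \<and> vdeg w = 0 \<or> vdeg u = 0 \<and> vdeg v = 3 \<and> vdeg w = 0
        \<or> vdeg u = 0 \<and> vdeg v = 0 \<and> vdeg w = 3"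
        using g by presburger
      then show False using *(2)
        by (elim disjE) (simp_all add: A03_triples_def *(1) dX[OF m(1)] dX[OF m(2)] dX[OF m(3)] dY[OF m(1)] dY[OF m(2)] dY[OF m(3)]
            dZ[OF m(1)] dZ[OF m(2)] dZ[OF m(3)] dW[OF m(1)] dW[OF m(2)] dW[OF m(3)])
    qed
  qed (auto simp: A0_triples_def A03_triples_def varsF'_eq)
  also have "\<dots> = cub (?Z \<times> ?X \<times> ?Y) + cub (?Z \<times> ?Y \<times> ?X) + cub (?X \<times> ?Z \<times> ?Y) + cub (?X \<times> ?Y \<times> ?Z)
      + cub (?Y \<times> ?X \<times> ?Z) + cub (?Y \<times> ?Z \<times> ?X) + cub A03_triples"
  proof -
    have d: "?X \<inter> ?Y = {}" "?Y \<inter> ?X = {}" "?X \<inter> ?Z = {}" "?Z \<inter> ?X = {}" "?Y \<inter> ?Z = {}" "?Z \<inter> ?Y = {}"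
      and "?Y \<inter> (?X \<union> varsA3 L) = {}"
      by (auto simp: varsA0_def vars1_def varsA2_def varsA3_def)
    then have "(P \<times> Q \<times> R) \<inter> A03_triples = {}" if "P = ?Y \<or> Q = ?Y \<or> R = ?Y" for P Q R
      using that by (auto simp: A03_triples_def)
    moreover have "finite A03_triples" using finite_A0_triples by (simp add: A03_triples_def)
    ultimately show ?thesis
      by (simp add: cub_union Int_Un_distrib2 Times_Int_Times d)
  qed
  finally have sum: "cub A0_triples = \<dots>" .
  have c: "cub (P \<times> Q \<times> R) = (1 / 6) *\<^sub>R mon3_sum P Q R" for P Q R
    by (simp add: cub_def mon3_sum_def mon3_def sum.cartesian_product)
  have m1: "mon3_sum ?Z ?Y ?X = mon3_sum ?Z ?X ?Y" and m2: "mon3_sum ?X ?Z ?Y = mon3_sum ?Z ?X ?Y"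
    by (rule mon3_sum_swap[OF sub(3,1,2)])+
  have m3: "mon3_sum ?X ?Y ?Z = mon3_sum ?Z ?X ?Y"
    unfolding m2[symmetric] by (rule mon3_sum_swap(1)[OF sub(1,3,2)])
  have m4: "mon3_sum ?Y ?X ?Z = mon3_sum ?Z ?X ?Y"
    unfolding m3[symmetric] by (rule mon3_sum_swap(2)[OF sub(1,2,3)])
  have m5: "mon3_sum ?Y ?Z ?X = mon3_sum ?Z ?X ?Y"
    unfolding m1[symmetric] by (rule mon3_sum_swap(2)[OF sub(3,2,1)])
  have u: "mon3_sum ?Z ?X ?Y = U012"
  proof -
    have "mon3_sum ?Z ?X ?Y = (\<Sum>i<b1 E. \<Sum>a<ldim L. \<Sum>c<ldim L. \<Sum>j<b1 E. \<Sum>b<ldim L. mon3 (A2 i a) (A0 c) (A1 j b))"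
      unfolding mon3_sum_def sum_vars1 sum_varsA0 sum_varsA2 by (rule refl)
    also have "\<dots> = (\<Sum>i<b1 E. \<Sum>a<ldim L. \<Sum>c<ldim L. \<Sum>j<b1 E. if i = j then \<Sum>b<ldim L.
        strc a c b *\<^sub>R (svar (A2 i a) * (svar (A0 c) * svar (A1 i b))) else 0)"
      by (intro sum.cong refl) (simp add: mon3_def coupling_201 mult.assoc)
    also have "\<dots> = U012" by (simp add: U012_def)
    finally show ?thesis .
  qed
  show ?thesis
    unfolding sum c m1 m2 m3 m4 m5 u by (simp flip: scaleR_add_left)
qed

lemma deriv_at_cub_A03_triples: "deriv_at (A1 i a) (cub A03_triples) = 0" "deriv_at (A2 i a) (cub A03_triples) = 0"
  by (rule deriv_at_eq_0[OF cub_Fun[of _ "varsA0 L \<union> varsA3 L"]]; auto simp: A03_triples_def varsA0_def varsA3_def)+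

lemma deriv_at_A2_cub_A0:
  assumes "i < b1 E" "a < ldim L"
  shows "deriv_at (A2 i a) (cub A0_triples) = (\<Sum>c<ldim L. \<Sum>b<ldim L. strc a c b *\<^sub>R (svar (A0 c) * svar (A1 i b)))"
proof -
  have "deriv_at (A2 i a) U012 = (\<Sum>j<b1 E. \<Sum>d<ldim L. if d = a then if j = i then
      \<Sum>c<ldim L. \<Sum>b<ldim L. strc a c b *\<^sub>R (svar (A0 c) * svar (A1 i b)) else 0 else 0)"
    unfolding U012_def deriv_at_sum
    by (rule sum.cong[OF refl], rule sum.cong[OF refl]) (auto simp: deriv_at_svar_mult deriv_at_svar)
  also have "\<dots> = (\<Sum>c<ldim L. \<Sum>b<ldim L. strc a c b *\<^sub>R (svar (A0 c) * svar (A1 i b)))"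
    using assms by simp
  finally show ?thesis by (simp add: cub_A0_triples deriv_at_cub_A03_triples)
qed

lemma deriv_at_A1_cub_A0:
  assumes "i < b1 E" "b < ldim L"
  shows "deriv_at (A1 i b) (cub A0_triples) = (\<Sum>c<ldim L. \<Sum>a<ldim L. strc b c a *\<^sub>R (svar (A0 c) * svar (A2 i a)))"
proof -
  have s: "svar (A2 i a) * svar (A0 c) = - (svar (A0 c) * svar (A2 i a))" for a c
    by (simp add: svar_svar[of "A2 i a"] vsgn_def)
  \<comment> \<open>Exchanging the odd coordinates \<open>A2\<close> and \<open>A0\<close> costs a
    sign, which the antisymmetry of \<open>strc\<close> in its outer indices restores.\<close>
  have anti: "strc a c b = - strc b c a" for a c
    using adm_antisym[of "lbasis L c" a b] by (simp add: adm_def strc_def)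
  have "deriv_at (A1 i b) U012 = (\<Sum>j<b1 E. \<Sum>a<ldim L. \<Sum>c<ldim L. \<Sum>d<ldim L.
      if j = i \<and> d = b then strc a c b *\<^sub>R (svar (A2 i a) * svar (A0 c)) else 0)"
    unfolding U012_def deriv_at_sum
    by (intro sum.cong refl) (auto simp: deriv_at_svar_mult deriv_at_svar vsgn_def)
  also have "\<dots> = (\<Sum>j<b1 E. if j = i then \<Sum>a<ldim L. \<Sum>c<ldim L. \<Sum>d<ldim L.
      if d = b then strc a c b *\<^sub>R (svar (A2 i a) * svar (A0 c)) else 0 else 0)"
    by (intro sum.cong refl) auto
  also have "\<dots> = (\<Sum>a<ldim L. \<Sum>c<ldim L. strc b c a *\<^sub>R (svar (A0 c) * svar (A2 i a)))"
    using assms by (simp add: s anti)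
  also have "\<dots> = (\<Sum>c<ldim L. \<Sum>a<ldim L. strc b c a *\<^sub>R (svar (A0 c) * svar (A2 i a)))"
    by (rule sum.swap)
  finally show ?thesis by (simp add: cub_A0_triples deriv_at_cub_A03_triples)
qed

section \<open>Quadratic functions of the fields\<close>

lemma spair_eq:
  "spair A L (vars L E) \<phi> \<psi> = (\<Sum>v\<in>vars L E. \<Sum>w\<in>vars L E.
    (if colour v = colour w then koszul (ghost v) (degree_of A (\<psi> w)) * pairing A (\<phi> v) (\<psi> w) else 0)
      *\<^sub>R (svar v * svar w))"
proof -
  have "form L (lbasis L (colour v)) (lbasis L (colour w)) = (if colour v = colour w then 1 else 0)"
    if "v \<in> vars L E" "w \<in> vars L E" for v w
    using that recolourable_vars[of L E] orthonormal by (auto simp: recolourable_def)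
  then show ?thesis
    unfolding spair_def by (intro sum.cong refl) auto
qed

lemma rot_spair:
  assumes "\<And>v a. \<phi> (recol v a) = \<phi> v" "\<And>v a. \<psi> (recol v a) = \<psi> v"
  shows "rot (vars L E) (ldim L) (adm X) (spair A L (vars L E) \<phi> \<psi>) = 0"
proof -
  interpret rotation "vars L E" "ldim L" "adm X" by (rule rotation_vars)
  show ?thesis unfolding spair_eq by (rule rot_quadratic) (simp add: assms)
qed

lemma supp_spair:
  assumes "\<And>v w. v \<in> vars L E \<Longrightarrow> w \<in> vars L E \<Longrightarrow> pairing A (\<phi> v) (\<psi> w) \<noteq> 0 \<Longrightarrow> {#v, w#} \<in> S"
  shows "spair A L (vars L E) \<phi> \<psi> \<in> supp S"
  unfolding spair_eq
proof (intro supp_sum)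
  fix v w assume vw: "v \<in> vars L E" "w \<in> vars L E"
  show "(if colour v = colour w then koszul (ghost v) (degree_of A (\<psi> w)) * pairing A (\<phi> v) (\<psi> w) else 0)
      *\<^sub>R (svar v * svar w) \<in> supp S"
  proof (cases "pairing A (\<phi> v) (\<psi> w) = 0")
    case False
    have "svar v * svar w \<in> supp S"
      by (rule supp_mult[OF supp_svar[of _ "{{#v#}}"] supp_svar[of _ "{{#w#}}"]]) (use assms[OF vw False] in \<open>auto simp: add_mset_commute\<close>)
    then show ?thesis by (rule supp_scaleR)
  qed simp
qed

lemma spair_polys: "spair A L (vars L E) \<phi> \<psi> \<in> polys (vars L E) 2"
  unfolding spair_eq
proof (intro subspace_sum[OF subspace_polys] subspace_scale[OF subspace_polys])
  fix v w assume "v \<in> vars L E" "w \<in> vars L E"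
  then show "svar v * svar w \<in> polys (vars L E) 2"
    using polys_prod[of "[v, w]" 2 "vars L E"] by simp
qed

end

section \<open>Fibre integrals\<close>

lemma size_filter_eq_sum_count:
  assumes "finite S"
  shows "size (filter_mset (\<lambda>v. v \<in> S) m) = (\<Sum>v\<in>S. count m v)"
proof (induction m)
  case (add x m)
  have "(\<Sum>v\<in>S. count (add_mset x m) v) = (\<Sum>v\<in>S. count m v + (if v = x then 1 else 0))"
    by (rule sum.cong) auto
  then show ?case using add assms by (simp add: sum.distrib)
qed simp

text \<open>With \<open>A0\<close> excluded no ghost number is positive, so the ghost number of a
  monomial bounds how many factors \<open>A2\<close> and \<open>A3\<close> it can have.\<close>

lemma ghosts_over:
  assumes "set_mset m \<subseteq> vars1 L E \<union> varsA2 L E \<union> varsA3 L"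
  shows "ghosts m = - int (size (filter_mset (\<lambda>v. v \<in> varsA2 L E) m)) - 2 * int (size (filter_mset (\<lambda>v. v \<in> varsA3 L) m))"
  using assms
proof (induction m)
  case (add x m)
  then consider "x \<in> vars1 L E" | "x \<in> varsA2 L E" | "x \<in> varsA3 L" by auto
  then show ?case
    using add by cases (auto simp: vars1_def varsA2_def varsA3_def)
qed simp

lemma coeff_hbar_inv_empty: "coeff f {#} = 0 \<Longrightarrow> coeff (hbar_inv * f) {#} = 0"
  by (simp add: hbar_inv_def coeff_sconst_mult)

lemma supp_hbar: "f \<in> supp S \<Longrightarrow> hbar * f \<in> supp S" "f \<in> supp S \<Longrightarrow> hbar_inv * f \<in> supp S"
  by (simp_all add: hbar_def hbar_inv_def supp_sconst_mult)

lemma (in propagator) gauss_sum: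
  assumes "\<And>i. i \<in> S \<Longrightarrow> bnd (f i)"
  shows "gm (sum f S) = (\<Sum>i\<in>S. gm (f i))" "bnd (sum f S)"
proof -
  have "gm 0 = 0" by (rule gauss_meanI) (simp add: ssums_def finlin_map_0[OF finlin_wick_term] finlin_map_0[OF finlin_at_zero])
  moreover have "bnd 0" by (simp add: bnd_def)
  moreover have "bnd (f + g)" if bnds: "bnd f" "bnd g" for f g
  proof -
    obtain M N where "wt M f" "wt N g" using bnds by (auto simp: bnd_def)
    then have "wt (min M N) (f + g)" by (intro wt_add) (auto intro: wt_mono)
    then show ?thesis by (auto simp: bnd_def)
  qed
  ultimately have "gm (sum f S) = (\<Sum>i\<in>S. gm (f i)) \<and> bnd (sum f S)"
    using assms by (induction S rule: infinite_finite_induct) (auto simp: gauss_add)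
  then show "gm (sum f S) = (\<Sum>i\<in>S. gm (f i))" "bnd (sum f S)" by auto
qed

text \<open>A drop of the integer by at least 1 counts 4 and pays for a rise of the degree by 1.
  Positivity of \<open>x\<close> guards against truncation by \<open>nat\<close>.\<close>

lemma nat_measure_less:
  assumes "0 < x" "y < x" "m \<le> Suc n"
  shows "nat (4 * y) + m < nat (4 * x) + n"
proof -
  have "nat (4 * y) + 4 \<le> nat (4 * x)"
    using assms(1,2) by (cases "0 \<le> y") (simp_all add: le_nat_iff)
  then show ?thesis using assms(3) by linarith
qed

text \<open>The propagator enters as a parameter, so that the Wick calculus is available as a
  sublocale; \<open>inverse_hessian_exists\<close> supplies it in the end.\<close>

locale bv_integral = bv_setup A L I E + induction_change A I d\<iota> dK d\<kappa> dI
  for A :: "'c::real_vector dgfa" and L :: "'g::real_vector lie"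
    and I :: "('c, 'h::real_vector) induction" and E :: "('c, 'h) frame"
    and d\<iota> :: "'h \<Rightarrow> 'c" and dK :: "'c \<Rightarrow> 'c" and d\<kappa> :: "'c \<Rightarrow> 'c" and dI :: "'h \<Rightarrow> 'c" +
  fixes \<rho> :: "nat \<Rightarrow> nat \<Rightarrow> nat \<Rightarrow> real" and W :: sfun
  assumes inverse_hessian_free:
      "inverse_hessian (varsK L E) (free_action A L E) = (\<lambda>x y. fls_const (colour_diagonal L E \<rho> x y))"
    and effective: "effective_action A L I E W"
begin

abbreviation "r \<equiv> colour_diagonal L E \<rho>"

sublocale propagator "varsK L E" "free_action A L E" r
proof
  fix x y assume "r x y \<noteq> 0"
  then show "ghost x + ghost y = 0"
    by (auto simp: colour_diagonal_def split: fvar.splits if_splits)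
qed (auto simp: inverse_hessian_free)

definition U :: sfun where "U = cub (vars L E \<times> vars L E \<times> vars L E)"
definition U1 :: sfun where "U1 = cub (V' \<times> V' \<times> V')"
definition exp_U :: sfun where "exp_U = sexp (hbar_inv * U)"
definition exp_U1 :: sfun where "exp_U1 = sexp (hbar_inv * U1)"
definition exp_U0 :: sfun where "exp_U0 = sexp (hbar_inv * cub A0_triples)"
definition W_hbar :: sfun where "W_hbar = hbar_inv * W"
definition exp_neg_W :: sfun where "exp_neg_W = sexp (- W_hbar)"

definition mons0 :: "fvar multiset set" where "mons0 = gr 0 \<inter> over (varsF' L E - varsA0 L)"
definition mons1 :: "fvar multiset set" where "mons1 = gr (- 1) \<inter> over (varsF' L E - varsA0 L)"

lemma fibre: "fibre_integral A L I E P = gm (exp_U * P)"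
  by (simp add: fibre_integral_def formal_integral_def action_minus_free exp_U_def U_def)

lemma conv: "exp_conv (hbar_inv * cub S)"
  by (intro exp_conv_no_const coeff_hbar_inv_empty coeff_cub_empty)

lemma wt_hbar_inv_cub: "wt 1 (hbar_inv * cub S)"
  using wt_hbar_inv_mult[OF wt_cub[of S]] by simp

lemma wt_sexp_cub: "wt 0 (sexp (hbar_inv * cub S))"
  using wt_mono[OF wt_hbar_inv_cub, of 0] by (intro wt_sexp conv) auto

lemma bnd_cub_mult: "wt N P \<Longrightarrow> bnd (sexp (hbar_inv * cub S) * P)"
  using wt_mult[OF wt_sexp_cub] by (auto simp: bnd_def)

lemma cub_supp: "sexp (hbar_inv * cub S) \<in> supp T" if "add_closed T" "cub S \<in> supp T"
  using that by (intro supp_sexp conv supp_hbar)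

lemma V'_vars: "V' \<subseteq> vars L E"
  by (auto simp: V'_def)

lemma A0_triples_vars: "A0_triples \<subseteq> vars L E \<times> vars L E \<times> vars L E"
  using varsA0_subset by (auto simp: A0_triples_def)

lemma ex_split: "exp_U = exp_U0 * exp_U1"
proof -
  have "parity (hbar_inv * cub A0_triples) = hbar_inv * cub A0_triples"
    by (simp add: parity_hbar gr_0_even[OF cub_gr[OF A0_triples_vars]])
  then have "hbar_inv * cub A0_triples * (hbar_inv * U1) = hbar_inv * U1 * (hbar_inv * cub A0_triples)"
    by (rule even_commute)
  then have "sexp (hbar_inv * cub A0_triples + hbar_inv * U1) = exp_U0 * exp_U1"
    unfolding exp_U0_def exp_U1_def U1_def by (intro sexp_add conv)
  then show ?thesis by (simp add: exp_U_def U_def U1_def cub_split distrib_left)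
qed

lemma parity_exs: "parity exp_U = exp_U" "parity exp_U0 = exp_U0"
  unfolding exp_U_def exp_U0_def U_def
  by (intro gr_0_even cub_supp add_closed_gr cub_gr; use A0_triples_vars in auto)+

lemma ex0_Fun: "exp_U0 \<in> Fun (- varsK L E)"
  unfolding exp_U0_def Fun_supp
proof (intro cub_supp add_closed_over)
  have "cub A0_triples \<in> Fun (- varsK L E)"
    by (rule cub_Fun) (auto simp: A0_triples_def varsF'_def vars1_def varsK_def)
  then show "cub A0_triples \<in> supp (over (- varsK L E))" by (simp add: Fun_supp)
qed

text \<open>Contractions preserve the total ghost number and create no coordinates; restriction to
  zero \<omega>'' then leaves external coordinates other than \<open>A0\<close>.\<close>

lemma gauss_supp_V':
  assumes "P \<in> supp (gr g \<inter> over V')" "bnd P"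
  shows "gm P \<in> supp (gr g \<inter> over (varsF' L E - varsA0 L))"
proof -
  have "gm P \<in> supp ((gr g \<inter> over V') \<inter> {m. set_mset m \<inter> varsK L E = {}})"
    by (rule supp_gauss[OF assms]) (auto simp: gr_def over_def)
  then show ?thesis
    by (rule supp_mono) (auto simp: over_def V'_def vars_def)
qed

lemma ex1_supp: "exp_U1 \<in> supp (gr 0 \<inter> over V')"
proof -
  have "U1 \<in> supp (over V')"
    unfolding U1_def Fun_supp[symmetric] by (rule cub_Fun) auto
  moreover have "U1 \<in> supp (gr 0)"
    unfolding U1_def by (rule cub_gr) (use V'_vars in auto)
  ultimately show ?thesis
    unfolding exp_U1_def U1_def by (intro cub_supp add_closed_Int add_closed_gr add_closed_over supp_Int)
qed

lemma add_closed_mons0: "add_closed mons0"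
  unfolding mons0_def by (intro add_closed_Int add_closed_gr add_closed_over)

text \<open>\<open>A2\<close> and \<open>A3\<close> lower the ghost number and nothing left can
  raise it, so neither occurs.\<close>

lemma mons0_vars1: "mons0 \<subseteq> over (vars1 L E)"
proof
  fix m assume m: "m \<in> mons0"
  then have sub: "set_mset m \<subseteq> vars1 L E \<union> varsA2 L E \<union> varsA3 L"
    by (auto simp: mons0_def over_def varsF'_eq)
  have "ghosts m = 0" using m by (auto simp: mons0_def gr_def)
  then have f: "size (filter_mset (\<lambda>v. v \<in> varsA2 L E) m) = 0" "size (filter_mset (\<lambda>v. v \<in> varsA3 L) m) = 0"
    using ghosts_over[OF sub] by linarith+
  have "v \<notin> varsA2 L E \<and> v \<notin> varsA3 L" if "v \<in># m" for v
  proof (rule ccontr)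
    assume "\<not> (v \<notin> varsA2 L E \<and> v \<notin> varsA3 L)"
    then have "v \<in># filter_mset (\<lambda>v. v \<in> varsA2 L E) m \<or> v \<in># filter_mset (\<lambda>v. v \<in> varsA3 L) m"
      using that by simp
    then show False using f by (simp only: size_eq_0_iff_empty) auto
  qed
  then show "m \<in> over (vars1 L E)"
    using sub unfolding over_def by blast
qed

lemma wt_1_bnd: "bnd exp_U" "bnd exp_U1" "bnd 1"
  unfolding exp_U_def exp_U1_def U_def U1_def bnd_def by (rule exI, rule wt_sexp_cub, rule exI, rule wt_sexp_cub, rule exI, rule wt_1)

lemma gauss_ex: "gm (exp_U * P) = exp_U0 * gm (exp_U1 * P)" if "wt N P"
  unfolding ex_split mult.assoc
  by (rule gauss_Fun_mult[OF ex0_Fun]) (use that in \<open>simp add: exp_U1_def U1_def bnd_cub_mult\<close>)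

lemma exp_sums_W: "exp_sums W_hbar (gm exp_U)"
  using effective by (simp add: effective_action_def fibre W_hbar_def)

lemma gauss_ex1: "gm exp_U1 \<in> supp mons0"
  unfolding mons0_def by (rule gauss_supp_V'[OF ex1_supp wt_1_bnd(2)])

lemma ex0_gr: "exp_U0 \<in> supp (gr 0)"
  unfolding exp_U0_def by (intro cub_supp add_closed_gr cub_gr A0_triples_vars)

lemma gauss_ex_eq: "gm exp_U = exp_U0 * gm exp_U1"
  using gauss_ex[OF wt_1] by simp

lemma gauss_ex_gr: "gm exp_U \<in> supp (gr 0)"
  unfolding gauss_ex_eq
  by (rule supp_closed_mult[OF add_closed_gr ex0_gr supp_mono[OF gauss_ex1]]) (auto simp: mons0_def)

lemma W_hbar_gr: "W_hbar \<in> supp (gr 0)"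
  by (rule supp_log[OF exp_sums_W add_closed_gr gauss_ex_gr])

lemma parity_W_hbar: "parity W_hbar = W_hbar"
  by (rule gr_0_even[OF W_hbar_gr])

lemma conv_W: "exp_conv W_hbar"
  by (rule exp_sums_conv[OF exp_sums_W])

lemma W_eq: "W = hbar * W_hbar"
  by (simp add: W_hbar_def)

lemma parity_W: "parity W = W"
proof -
  have "parity (hbar * W_hbar) = hbar * W_hbar" by (simp add: parity_hbar parity_W_hbar)
  then show ?thesis by (simp only: W_eq[symmetric])
qed

text \<open>Dividing \<open>exp (W/\<hbar>)\<close> by \<open>exp_U0\<close> leaves the mean of
  \<open>exp_U1\<close>, which is supported in \<open>mons0\<close>; \<open>supp_log\<close> carries
  this over to the exponent.\<close>

lemma W_hbar_minus: "W_hbar - hbar_inv * cub A0_triples \<in> supp mons0" "exp_conv (W_hbar - hbar_inv * cub A0_triples)"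
proof -
  let ?u = "hbar_inv * cub A0_triples"
  have "exp_sums (W_hbar + - ?u) (sexp W_hbar * sexp (- ?u))"
    by (intro exp_sums_add conv_W exp_conv_uminus conv even_commute parity_W_hbar)
  moreover have "sexp W_hbar = gm exp_U" using exp_sums_eq[OF exp_sums_W] by simp
  moreover have "gm exp_U * sexp (- ?u) = sexp (- ?u) * gm exp_U"
    by (rule even_commute[OF gr_0_even[OF gauss_ex_gr]])
  moreover have "sexp (- ?u) * gm exp_U = gm exp_U1"
    using sexp_minus_mult[OF conv, of A0_triples] by (simp add: gauss_ex_eq exp_U0_def flip: mult.assoc)
  ultimately have "exp_sums (W_hbar - ?u) (gm exp_U1)" by simp
  then show "W_hbar - ?u \<in> supp mons0" "exp_conv (W_hbar - ?u)"
    by (rule supp_log[OF _ add_closed_mons0 gauss_ex1], rule exp_sums_conv)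
qed

lemma W_minus: "W - cub A0_triples \<in> supp mons0"
proof -
  have "hbar * (W_hbar - hbar_inv * cub A0_triples) \<in> supp mons0" by (rule supp_hbar(1)[OF W_hbar_minus(1)])
  then show ?thesis by (simp add: right_diff_distrib W_eq[symmetric])
qed

lemma exp_neg_W_gauss: "exp_neg_W * gm exp_U = 1"
  using sexp_minus_mult[OF conv_W] exp_sums_eq[OF exp_sums_W] by (simp add: exp_neg_W_def)

lemma exp_neg_W_supp: "exp_neg_W \<in> supp (gr 0)"
  unfolding exp_neg_W_def by (intro supp_sexp exp_conv_uminus conv_W add_closed_gr supp_uminus W_hbar_gr)

lemma parity_exp_neg_W: "parity exp_neg_W = exp_neg_W"
  by (rule gr_0_even[OF exp_neg_W_supp])

lemma wt_gauss_ex: "wt 1 (gm exp_U - 1)"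
proof -
  have "wt 1 (exp_U - 1)"
    unfolding exp_U_def U_def by (rule wt_sexp_minus_1[OF conv wt_hbar_inv_cub])
  then have "wt 1 (gm (exp_U - 1))" "bnd (exp_U - 1)" by (auto intro: wt_gauss simp: bnd_def)
  moreover have "gm ((exp_U - 1) + 1) = gm (exp_U - 1) + gm 1"
    by (rule gauss_add[OF \<open>bnd (exp_U - 1)\<close> wt_1_bnd(3)])
  ultimately show ?thesis by (simp add: gauss_1)
qed

text \<open>Obtained without any weight estimate for \<open>W\<close> itself: the series is inverse
  to a mean that differs from 1 by positive weight.\<close>

lemma wt_exp_neg_W: "wt 0 exp_neg_W"
  by (rule wt_inverse[OF exp_neg_W_gauss wt_gauss_ex])

section \<open>Normalised means and their integrality\<close>

definition mean :: "sfun \<Rightarrow> sfun" where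
  "mean P = exp_neg_W * gm (exp_U * P)"

lemma bnd_ex_mult: "wt N P \<Longrightarrow> bnd (exp_U * P)"
  unfolding exp_U_def U_def by (rule bnd_cub_mult)

lemma wt_mean: "wt N P \<Longrightarrow> wt N (mean P)"
proof -
  assume "wt N P"
  then have "wt (0 + N) (exp_U * P)"
    unfolding exp_U_def U_def by (intro wt_mult wt_sexp_cub)
  then have "wt (0 + (0 + N)) (mean P)"
    unfolding mean_def by (rule wt_mult[OF wt_exp_neg_W wt_gauss])
  then show ?thesis by simp
qed

lemma mean_add: "wt k P \<Longrightarrow> wt N P' \<Longrightarrow> mean (P + P') = mean P + mean P'"
  by (simp add: mean_def distrib_left gauss_add bnd_ex_mult)

lemma mean_scaleR: "wt N P \<Longrightarrow> mean (c *\<^sub>R P) = c *\<^sub>R mean P"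
  by (simp add: mean_def gauss_scaleR bnd_ex_mult)

lemma mean_1: "mean 1 = 1"
  by (simp add: mean_def exp_neg_W_gauss)

lemma mean_svar:
  assumes "z \<notin> varsK L E" "wt N P"
  shows "mean (svar z * P) = svar z * mean P"
proof -
  have z: "svar z \<in> Fun (- varsK L E)"
    using assms(1) by (auto simp: Fun_def coeff_svar split: if_splits)
  have "exp_U * (svar z * P) = svar z * (exp_U * P)"
    using even_commute[OF parity_exs(1), of "svar z"] by (simp flip: mult.assoc)
  then have "mean (svar z * P) = exp_neg_W * (svar z * gm (exp_U * P))"
    by (simp add: mean_def gauss_Fun_mult[OF z bnd_ex_mult[OF assms(2)]])
  also have "\<dots> = svar z * mean P"
    using even_commute[OF parity_exp_neg_W, of "svar z"] by (simp add: mean_def flip: mult.assoc)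
  finally show ?thesis .
qed

text \<open>The factor \<hbar>, which a propagator always carries, cancels the 1/\<hbar> from
  differentiating \<open>exp_U\<close>. No negative power survives.\<close>

lemma deriv_at_ex_mult:
  "hbar * deriv_at y (exp_U * P) = exp_U * (deriv_at y U * P) + hbar * (exp_U * deriv_at y P)"
proof -
  have U: "parity U = U" unfolding U_def by (rule gr_0_even[OF cub_gr]) simp
  have convC: "exp_conv (hbar_inv * U)" unfolding U_def by (rule conv)
  have "deriv_at y exp_U = deriv_at y (hbar_inv * U) * exp_U"
    unfolding exp_U_def
  proof (rule deriv_sexp[OF finlin_deriv_at])
    show "deriv_at y (hbar_inv * U * f) = deriv_at y (hbar_inv * U) * f + hbar_inv * U * deriv_at y f" for f
      unfolding deriv_at_mult[of y "hbar_inv * U"] by (simp add: twist_even parity_hbar U)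
  qed (simp_all add: parity_hbar U convC)
  also have "deriv_at y (hbar_inv * U) * exp_U = hbar_inv * (exp_U * deriv_at y U)"
    using even_commute[OF parity_exs(1), of "deriv_at y U"]
    by (simp add: finlin_map_hbar[OF finlin_deriv_at] mult.assoc)
  finally have "hbar * (deriv_at y exp_U * P) = exp_U * (deriv_at y U * P)"
    by (simp add: mult.assoc)
  then show ?thesis
    by (simp add: deriv_at_mult twist_even parity_exs distrib_left)
qed

text \<open>The recursion behind integrality: \<hbar> appears on the right only with nonnegative
  powers. \<open>gauss_mean\<close> is known to be additive only on \<open>bnd\<close> functions,
  hence the boundedness facts.\<close>

lemma mean_contract:
  assumes "z \<in> varsK L E" "wt N P" "\<And>y. wt k (deriv_at y U * P)"
  shows "mean (svar z * P) = (- 1 / 2) *\<^sub>R (\<Sum>y\<in>varsK L E. (r z y + vsgn y z * r y z) *\<^sub>R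
      (mean (deriv_at y U * P) + hbar * mean (deriv_at y P)))"
proof -
  let ?s = "\<lambda>y. r z y + vsgn y z * r y z"
  have "exp_U * (svar z * P) = svar z * (exp_U * P)"
    using even_commute[OF parity_exs(1), of "svar z"] by (simp flip: mult.assoc)
  then have 1: "gm (exp_U * (svar z * P)) = gm (contract z (exp_U * P))"
    using schwinger_dyson[OF assms(1) bnd_ex_mult[OF assms(2)]] by simp
  have "contract z (exp_U * P) = (- 1 / 2) *\<^sub>R (\<Sum>y\<in>varsK L E. ?s y *\<^sub>R (hbar * deriv_at y (exp_U * P)))"
    unfolding contract_def by (simp add: sum_distrib_left)
  then have 2: "contract z (exp_U * P) = (- 1 / 2) *\<^sub>R (\<Sum>y\<in>varsK L E. ?s y *\<^sub>R
      (exp_U * (deriv_at y U * P) + hbar * (exp_U * deriv_at y P)))"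
    by (simp only: deriv_at_ex_mult)
  have b1: "bnd (exp_U * (deriv_at y U * P))" for y by (rule bnd_ex_mult[OF assms(3)])
  have b2: "bnd (exp_U * deriv_at y P)" for y by (rule bnd_ex_mult[OF wt_deriv_at[OF assms(2)]])
  have bh: "bnd (hbar * f)" if "bnd f" for f using that wt_hbar_mult by (auto simp: bnd_def)
  have bs: "bnd (c *\<^sub>R f)" if "bnd f" for f c using that wt_scaleR by (auto simp: bnd_def)
  have ba: "bnd (f + g)" if "bnd f" "bnd g" for f g
    using gauss_sum(2)[of "{True, False}" "\<lambda>b. if b then f else g"] that by simp
  note b = ba[OF b1 bh[OF b2]]
  have "gm (contract z (exp_U * P)) = (- 1 / 2) *\<^sub>R (\<Sum>y\<in>varsK L E. ?s y *\<^sub>R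
      (gm (exp_U * (deriv_at y U * P)) + hbar * gm (exp_U * deriv_at y P)))"
    unfolding 2
    by (simp only: gauss_scaleR[OF gauss_sum(2)[OF bs[OF b]]] gauss_sum(1)[OF bs[OF b]] gauss_scaleR[OF b]
        gauss_add[OF b1 bh[OF b2]] gauss_hbar[OF b2])
  then show ?thesis
    unfolding mean_def 1
    by (simp add: sum_distrib_left distrib_left hbar_left_commute)
qed

lemma U_polys: "U \<in> polys (vars L E) 3"
  unfolding U_def by (rule cub_polys)

lemma subspace_mean: "subspace {p. wt k p \<and> integ N (mean p)}"
proof -
  have "mean 0 = 0" using mean_scaleR[of 0 0 0] by simp
  then show ?thesis
    by (auto simp: subspace_def wt_add wt_scaleR mean_add mean_scaleR integ_add integ_scaleR)
qed

text \<open>Each application of the Schwinger--Dyson equation to \<open>\<omega>\<^sub>z P\<close> either raises the weight or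
  lowers the degree, without producing negative powers of \<open>\<hbar>\<close>.\<close>

lemma integ_mean: "p \<in> polys (vars L E) n \<Longrightarrow> integ N (mean p)"
\<comment> \<open>\<open>N - 2 * n\<close> is the weight still missing. Replacing
  \<open>svar z * P\<close> by \<open>deriv_at y U * P\<close> lowers it by 2 and raises the degree
  by 1. The term with \<hbar> lowers \<open>N\<close> by 5 and the degree by 2, so the missing
  weight falls by 1. An external coordinate keeps it and lowers the degree.\<close>
proof (induction "nat (4 * (N - 2 * int n)) + n" arbitrary: N n p rule: less_induct)
  case less
  show ?case
  proof (cases "N \<le> 2 * int n")
    \<comment> \<open>Degree \<open>n\<close> already gives weight \<open>2 * n\<close>, and
      \<open>integ N\<close> constrains only terms of weight below \<open>N\<close>.\<close>
    case True
    then have "wt N p" using wt_mono[OF wt_polys[OF less.prems]] by blast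
    then show ?thesis by (intro wt_integ wt_mean)
  next
    case False
    have "wt (2 * int n) p \<and> integ N (mean p)"
      using less.prems
    proof (induction rule: polys_induct)
      case subspace
      show ?case by (rule subspace_mean)
    next
      case (prod ys)
      have "integ N (mean (prod_list (map svar ys)))"
      proof (cases ys)
        case Nil
        then show ?thesis by (simp add: mean_1 integ_1)
      next
        case (Cons z zs)
        let ?P = "prod_list (map svar zs)"
        have n: "n = Suc (length zs)" and z: "z \<in> vars L E" using Cons prod by auto
        have P: "?P \<in> polys (vars L E) (length zs)" using Cons prod by (intro polys_prod) auto
        note wP = wt_polys[OF P]
        show ?thesis
        proof (cases "z \<in> varsK L E")
          case True
          have dC: "deriv_at y U * ?P \<in> polys (vars L E) (Suc n)" for y
            using polys_mult[OF polys_deriv_at[OF U_polys] P, of y] by (simp add: n)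
          have "integ N (mean (deriv_at y U * ?P))" for y
            by (rule less.hyps[OF nat_measure_less dC]) (use False in auto)
          moreover have "integ N (hbar * mean (deriv_at y ?P))" for y
          \<comment> \<open>In degree 0 the truncated \<open>length zs - 1\<close> is not
            \<open>n - 2\<close>; there the derivative vanishes.\<close>
          proof (cases "length zs = 0")
            case True
            then show ?thesis using mean_scaleR[of 0 0 0] by simp
          next
            case l: False
            have "integ (N - 5) (mean (deriv_at y ?P))"
              by (rule less.hyps[OF nat_measure_less polys_deriv_at[OF P]]) (use False n l in auto)
            from integ_hbar[OF this] show ?thesis by simp
          qed
          ultimately show ?thesis
            unfolding Cons by (simp add: mean_contract[OF True wP wt_polys[OF dC]] integ_scaleR integ_sum integ_add del: scaleR_minus_left)
        next
          case zK: False
          have "integ (N - 2) (mean ?P)"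
            by (rule less.hyps[OF _ P]) (simp add: n algebra_simps)
          from integ_svar[OF this] show ?thesis
            by (simp add: Cons mean_svar[OF zK wP])
        qed
      qed
      then show ?case using wt_polys[OF polys_prod] prod by blast
    qed
    then show ?thesis ..
  qed
qed

end

section \<open>The generator\<close>

context bv_integral
begin

definition observable :: sfun where
  "observable = (1 / 2) *\<^sub>R spair A L (vars L E) (omega'' E) (diff A \<circ> d\<kappa> \<circ> diff A \<circ> omega'' E)
      + spair A L (vars L E) (omega'' E) (diff A \<circ> dI \<circ> alpha A I E)"

definition gen :: sfun where "gen = mean observable"

lemma generator_eq: "generator A L I E d\<kappa> dI W = gen"
  by (simp add: generator_def fibre gen_def mean_def exp_neg_W_def W_hbar_def observable_def)

lemma omega''_eq_0: "v \<in> vars L E \<Longrightarrow> v \<notin> varsK L E \<Longrightarrow> omega'' E v = 0"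
  by (auto simp: vars_def varsF'_def vars1_def)

text \<open>The shifts +1, -2, +1 add up to 0. Degree 0 is separate: \<open>diff A a\<close> then
  has degree 1, where \<open>d\<kappa>\<close> vanishes.\<close>

lemma dkappa_grade: "a \<in> grade A k \<Longrightarrow> diff A (d\<kappa> (diff A a)) \<in> grade A k"
proof (cases k)
  case 0
  assume "a \<in> grade A k"
  then have "diff A a \<in> grade A 1" using diff_grade 0 by fastforce
  then have "d\<kappa> (diff A a) = 0" using d\<kappa>_grade_low[of 1] by simp
  then show ?thesis by (simp add: grade_0)
next
  case (Suc j)
  assume "a \<in> grade A k"
  then have "diff A a \<in> grade A (j + 2)" using diff_grade Suc by fastforce
  then show ?thesis using Suc by (simp add: diff_grade d\<kappa>_grade)
qed

text \<open>The shifts -1 and +1 cancel. As \<open>dI\<close> kills the classes of degree 0, the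
  observable does not involve \<open>A0\<close>.\<close>

lemma dI_alpha_grade:
  assumes "v \<in> vars L E"
  shows "diff A (dI (alpha A I E v)) \<in> grade A (vdeg v)"
    and "v \<in> varsA0 L \<Longrightarrow> diff A (dI (alpha A I E v)) = 0"
proof -
  have h0: "h0 A I \<in> coh A I 0"
    using unity_grade diff_unity by (auto simp: h0_def coh_def)
  show 0: "v \<in> varsA0 L \<Longrightarrow> diff A (dI (alpha A I E v)) = 0"
    using dI_grade_0[OF h0] by (auto simp: varsA0_def)
  consider "v \<in> varsF' L E" | "v \<in> varsK L E" using in_vars_cases[OF assms] by blast
  then show "diff A (dI (alpha A I E v)) \<in> grade A (vdeg v)"
  proof cases
    case 1
    then show ?thesis
    proof (cases rule: varsF'_cases)
      case (1 a)
      then show ?thesis using 0 by (simp add: varsA0_def grade_0)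
    next
      case (2 i a)
      then have "dI (h1 E i) \<in> grade A 0" using basis_in[OF h1] by (intro dI_grade_Suc) auto
      then show ?thesis using diff_grade 2 by fastforce
    next
      case (3 i a)
      then have "dI (h2 E i) \<in> grade A 1"
        using basis_in[OF h2] by (intro dI_grade_Suc) (auto simp: numeral_2_eq_2)
      then show ?thesis using diff_grade 3 by (fastforce simp: numeral_2_eq_2)
    next
      case (4 a)
      have "dI (h3 E) \<in> grade A 2" using h3 by (intro dI_grade_Suc) (simp add: numeral_3_eq_3 numeral_2_eq_2)
      then show ?thesis using diff_grade 4 by (fastforce simp: numeral_3_eq_3 numeral_2_eq_2)
    qed
  next
    case 2
    then have "alpha A I E v = 0" by (elim in_varsK_cases) simp
    then show ?thesis by (simp add: linear_0[OF linear_dI] grade_0)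
  qed
qed

text \<open>Two coordinates whose degrees add up to 3 have ghost numbers adding up to 2 - 3 =
  -1.\<close>

lemma supp_observable: "observable \<in> supp (gr (- 1) \<inter> over V')"
  unfolding observable_def
proof (intro supp_add supp_scaleR supp_spair)
  have K: "v \<in> varsK L E" if "v \<in> vars L E" "pairing A (omega'' E v) x \<noteq> 0" for v x
    by (rule ccontr) (use that omega''_eq_0[of v] in simp)
  have V': "v \<in> V'" if "v \<in> varsK L E" for v
    using that varsK_subset by (auto simp: V'_def varsA0_def varsK_def)
  have g: "omega'' E v \<in> grade A (vdeg v)" if "v \<in> varsK L E" for v
    using that by (elim in_varsK_cases) (auto intro: fK_grade)
  have gr: "{#v, w#} \<in> gr (- 1)" if "vdeg v + vdeg w = 3" for v w
    using that by (simp add: gr_def ghost_vdeg)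
  fix v w assume vw: "v \<in> vars L E" "w \<in> vars L E"
  show "{#v, w#} \<in> gr (- 1) \<inter> over V'"
    if nz: "pairing A (omega'' E v) ((diff A \<circ> d\<kappa> \<circ> diff A \<circ> omega'' E) w) \<noteq> 0"
  proof -
    have v: "v \<in> varsK L E" using K[OF vw(1) nz] .
    have "omega'' E w \<noteq> 0"
      using nz by (auto simp: linear_0[OF linear_d\<kappa>])
    then have w: "w \<in> varsK L E" using omega''_eq_0 vw by blast
    have "vdeg v + vdeg w = 3"
      using nz by (intro pairing_degree[OF g[OF v] dkappa_grade[OF g[OF w]]]) simp
    then show ?thesis using gr V' v w by (simp add: over_def)
  qed
  show "{#v, w#} \<in> gr (- 1) \<inter> over V'"
    if nz: "pairing A (omega'' E v) ((diff A \<circ> dI \<circ> alpha A I E) w) \<noteq> 0"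
  proof -
    have v: "v \<in> varsK L E" using K[OF vw(1) nz] .
    have "w \<notin> varsA0 L" using nz dI_alpha_grade(2)[OF vw(2)] by auto
    then have w: "w \<in> V'" using vw by (simp add: V'_def)
    have "vdeg v + vdeg w = 3"
      using nz by (intro pairing_degree[OF g[OF v] dI_alpha_grade(1)[OF vw(2)]]) simp
    then show ?thesis using gr V' v w by (simp add: over_def)
  qed
qed

lemma observable_polys: "observable \<in> polys (vars L E) 2"
  unfolding observable_def
  by (intro subspace_add[OF subspace_polys] subspace_scale[OF subspace_polys] spair_polys)

lemma wt_observable: "wt 4 observable"
  using wt_polys[OF observable_polys] by simp

lemma omega''_recol [simp]: "omega'' E (recol v a) = omega'' E v"
  by (cases v) auto

lemma alpha_recol [simp]: "alpha A I E (recol v a) = alpha A I E v"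
  by (cases v) auto

text \<open>The factor \<open>exp_U0\<close> of the integral combines with \<open>exp_neg_W\<close>
  into the exponential of \<open>- (W_hbar - ?u)\<close>, supported in \<open>mons0\<close>. The
  terms with \<open>A0\<close> thus disappear, and the observable contributes ghost number
  -1.\<close>

lemma gen_supp: "gen \<in> supp mons1"
proof -
  let ?u = "hbar_inv * cub A0_triples"
  have "gm (exp_U1 * observable) \<in> supp mons1"
    unfolding mons1_def
  proof (rule gauss_supp_V')
    show "exp_U1 * observable \<in> supp (gr (- 1) \<inter> over V')"
      by (rule supp_mult[OF ex1_supp supp_observable]) (auto simp: gr_def over_def)
    show "bnd (exp_U1 * observable)" unfolding exp_U1_def U1_def by (rule bnd_cub_mult[OF wt_observable])
  qed
  note 2 = this
  have 1: "sexp (- (W_hbar - ?u)) \<in> supp mons0"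
    by (intro supp_sexp exp_conv_uminus W_hbar_minus add_closed_mons0 supp_uminus)
  have "gen = sexp (- (W_hbar - ?u)) * gm (exp_U1 * observable)"
  proof -
    have "sexp (- W_hbar + ?u) = exp_neg_W * exp_U0"
      unfolding exp_neg_W_def exp_U0_def
      by (intro sexp_add exp_conv_uminus conv_W conv even_commute) (simp add: parity_W_hbar)
    then show ?thesis
      by (simp add: gen_def mean_def gauss_ex[OF wt_observable] mult.assoc)
  qed
  also have "\<dots> \<in> supp mons1"
    by (rule supp_mult[OF 1 2]) (auto simp: mons0_def mons1_def gr_def over_def)
  finally show ?thesis .
qed

text \<open>Each \<open>A2\<close> lowers the ghost number by 1 and each \<open>A3\<close> by 2, so
  -1 leaves exactly one \<open>A2\<close> and no \<open>A3\<close>.\<close>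

lemma mons1_cases:
  assumes "m \<in> mons1"
  shows "(\<Sum>v\<in>varsA2 L E. count m v) = 1" "set_mset m \<subseteq> vars1 L E \<union> varsA2 L E"
proof -
  have sub: "set_mset m \<subseteq> vars1 L E \<union> varsA2 L E \<union> varsA3 L"
    using assms by (auto simp: mons1_def over_def varsF'_eq)
  have "ghosts m = - 1" using assms by (auto simp: mons1_def gr_def)
  then have f2: "size (filter_mset (\<lambda>v. v \<in> varsA3 L) m) = 0"
    using ghosts_over[OF sub] by linarith
  with \<open>ghosts m = - 1\<close> have f: "size (filter_mset (\<lambda>v. v \<in> varsA2 L E) m) = 1"
    using ghosts_over[OF sub] by linarith
  then show "(\<Sum>v\<in>varsA2 L E. count m v) = 1"
    by (simp add: size_filter_eq_sum_count)
  have "v \<notin> varsA3 L" if "v \<in># m" for v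
  proof
    assume "v \<in> varsA3 L"
    then have "v \<in># filter_mset (\<lambda>v. v \<in> varsA3 L) m" using that by simp
    then show False using f2 by (simp only: size_eq_0_iff_empty) auto
  qed
  then show "set_mset m \<subseteq> vars1 L E \<union> varsA2 L E" using sub by blast
qed

definition G :: "nat \<Rightarrow> nat \<Rightarrow> sfun" where "G i a = deriv_at (A2 i a) gen"

text \<open>Euler's identity for a function homogeneous of degree 1 in the coordinates
  \<open>A2\<close>.\<close>

lemma gen_Euler: "gen = (\<Sum>a<ldim L. \<Sum>i<b1 E. svar (A2 i a) * G i a)"
proof (rule sfun_eqI)
  fix m
  have "coeff (\<Sum>a<ldim L. \<Sum>i<b1 E. svar (A2 i a) * G i a) m
     = (\<Sum>a<ldim L. \<Sum>i<b1 E. of_nat (count m (A2 i a)) * coeff gen m)"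
    by (simp add: G_def coeff_svar_deriv_at)
  also have "\<dots> = (\<Sum>i<b1 E. \<Sum>a<ldim L. of_nat (count m (A2 i a)) * coeff gen m)"
    by (rule sum.swap)
  also have "\<dots> = (\<Sum>v\<in>varsA2 L E. of_nat (count m v) * coeff gen m)"
    by (simp add: sum_varsA2)
  also have "\<dots> = of_nat (\<Sum>v\<in>varsA2 L E. count m v) * coeff gen m"
    by (simp add: sum_distrib_right)
  also have "\<dots> = coeff gen m"
    using suppD[OF gen_supp, of m] mons1_cases(1)[of m] by (cases "m \<in> mons1") auto
  finally show "coeff gen m = coeff (\<Sum>a<ldim L. \<Sum>i<b1 E. svar (A2 i a) * G i a) m" by simp
qed

lemma deriv_at_gen_eq_0: "v \<notin> vars1 L E \<Longrightarrow> v \<notin> varsA2 L E \<Longrightarrow> deriv_at v gen = 0"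
proof -
  assume "v \<notin> vars1 L E" "v \<notin> varsA2 L E"
  moreover have "gen \<in> Fun (vars1 L E \<union> varsA2 L E)"
    unfolding Fun_supp by (rule supp_mono[OF gen_supp]) (use mons1_cases(2) in \<open>auto simp: over_def\<close>)
  ultimately show ?thesis by (intro deriv_at_eq_0[of gen "vars1 L E \<union> varsA2 L E"]) auto
qed

lemma G_supp: "G i a \<in> supp mons0"
  unfolding G_def
  by (rule supp_deriv_at[OF gen_supp]) (auto simp: mons0_def mons1_def gr_def over_def)

lemma G_Fun: "G i a \<in> Fun (vars1 L E)"
  unfolding Fun_supp by (rule supp_mono[OF G_supp mons0_vars1])

lemma parity_G: "parity (G i a) = G i a"
  by (rule gr_0_even, rule supp_mono[OF G_supp]) (simp add: mons0_def)

text \<open>\<open>gen\<close> is the mean of a real quadratic polynomial, so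
  \<open>integ_mean\<close> applies for every \<open>N\<close>; differentiation introduces only
  integer factors.\<close>

lemma G_Fun_hbar: "G i a \<in> Fun_hbar (vars1 L E)"
proof -
  have "fls_ge 0 (coeff gen m)" for m
    unfolding gen_def by (intro integ_all integ_mean[OF observable_polys])
  then have "fls_ge (0 + 0 + 0) (coeff (G i a) m)" for m
    unfolding G_def coeff_deriv_at by (intro fls_ge_mult fls_ge_of_int fls_ge_of_nat)
  then have "fls_ge 0 (coeff (G i a) m)" for m by simp
  then show ?thesis using G_Fun by (auto simp: Fun_hbar_def fls_ge_0_iff)
qed

section \<open>The decomposition of the effective action\<close>

definition F :: sfun where "F = W - W_prod A L I E"

lemma W_split: "W_prod_111 A L I E + F = W - cub A0_triples"
  by (simp add: F_def W_prod_split W_prod_111_eq)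

lemma F_Fun: "F \<in> Fun (vars1 L E)"
proof -
  have "W - cub A0_triples \<in> supp (over (vars1 L E))" by (rule supp_mono[OF W_minus mons0_vars1])
  moreover have "W_prod_111 A L I E \<in> Fun (vars1 L E)"
    unfolding W_prod_111_eq by (rule cub_Fun) auto
  moreover have "F = (W - cub A0_triples) - W_prod_111 A L I E" using W_split by (simp add: algebra_simps)
  ultimately show ?thesis unfolding Fun_supp by (simp add: supp_diff)
qed

lemma F_Fun_hbar: "F \<in> Fun_hbar (vars1 L E)"
proof -
  have r: "fls_ge 0 (fls_const c * x)" if "fls_ge 0 x" for c x
    using fls_ge_mult[OF fls_ge_const that] by simp
  have m: "fls_ge 0 (coeff (f * g) m)" if fg: "\<And>m. fls_ge 0 (coeff f m)" "\<And>m. fls_ge 0 (coeff g m)" for f g m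
    unfolding coeff_mult
  proof (rule fls_ge_sum, clarify)
    fix a b
    have "fls_ge (0 + 0 + 0) (of_int (mono_sign a b) * coeff f a * coeff g b)"
      by (intro fls_ge_mult fls_ge_of_int fg)
    then show "fls_ge 0 (of_int (mono_sign a b) * coeff f a * coeff g b)" by simp
  qed
  have v: "fls_ge 0 (coeff (svar v) m)" for v m
    by (simp add: coeff_svar fls_ge_def)
  have "fls_ge 0 (coeff (cub S) m)" for S m
    unfolding cub_def coeff_scaleR coeff_sum
    by (rule r, rule fls_ge_sum, clarify) (simp add: r m v)
  then have "fls_ge 0 (coeff (W_prod A L I E) m)" for m by (simp add: W_prod_eq)
  moreover have "fls_ge 0 (coeff W m)" for m
    using effective by (simp add: effective_action_def Fun_hbar_def fls_ge_0_iff)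
  ultimately have "fls_ge 0 (coeff F m)" for m by (simp add: F_def fls_ge_diff)
  then show ?thesis using F_Fun by (auto simp: Fun_hbar_def fls_ge_0_iff)
qed

text \<open>The propagator, the interaction and the observable contract colours only with the
  orthonormal form and the structure constants, which are ad-invariant.\<close>

lemma rot_gen: "rot (vars L E) (ldim L) (adm X) gen = 0"
proof -
  interpret rotation "vars L E" "ldim L" "adm X" by (rule rotation_vars)
  have gmD: "gm (D P) = D (gm P)" if "bnd P" for P
  proof (rule gauss_commute[OF that finlin_rot])
    show "wk (D P) = D (wk P)" for P
    proof (rule wick_rot[OF rotation_vars recolourable_varsK varsK_subset])
      show "r x y = (if colour x = colour y then r (recol x 0) (recol y 0) else 0)"
        if "x \<in> varsK L E" "y \<in> varsK L E" for x y
        using that by (elim in_varsK_cases) (auto simp: colour_diagonal_def)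
    qed simp
    show "at_zero (varsK L E) (D P) = D (at_zero (varsK L E) P)" for P
      by (rule at_zero_rot) (auto simp: varsK_def elim: recol.elims)
  qed (simp add: finlin_map_scaleR[OF finlin_rot])
  have "D exp_U = D (hbar_inv * U) * exp_U"
    unfolding exp_U_def
    by (rule deriv_sexp[OF finlin_rot rot_1 rot_mult])
       (simp_all add: U_def conv parity_hbar gr_0_even[OF cub_gr])
  then have "D exp_U = 0"
    by (simp add: finlin_map_hbar[OF finlin_rot] U_def rot_cub)
  have "D observable = 0"
    unfolding observable_def by (simp add: finlin_map_add[OF finlin_rot] finlin_map_scaleR[OF finlin_rot] rot_spair)
  then have 1: "D (gm (exp_U * observable)) = 0"
    using gmD[OF bnd_ex_mult[OF wt_observable]] gauss_scaleR[of 0 0] bnd_ex_mult[of 0 0]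
    by (simp add: rot_mult \<open>D exp_U = 0\<close>)
  have 2: "D (gm exp_U) = 0"
    using gmD[OF wt_1_bnd(1)] gauss_scaleR[of 0 0] bnd_ex_mult[of 0 0] by (simp add: \<open>D exp_U = 0\<close>)
  \<comment> \<open>Differentiating the product 1 of \<open>exp_neg_W\<close> with an invariant
    invertible series shows that \<open>exp_neg_W\<close> is invariant, without any statement about
    \<open>W\<close>.\<close>
  have "D (exp_neg_W * gm exp_U) = 0" by (simp add: exp_neg_W_gauss rot_1)
  then have "D exp_neg_W * gm exp_U * exp_neg_W = 0" by (simp add: rot_mult 2)
  moreover have "gm exp_U * exp_neg_W = 1" using even_commute[OF parity_exp_neg_W, of "gm exp_U"] exp_neg_W_gauss by simp
  ultimately have "D exp_neg_W = 0" by (simp add: mult.assoc)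
  then show ?thesis by (simp add: gen_def mean_def rot_mult 1)
qed

text \<open>Apply \<open>deriv_at (A2 i a)\<close> to the invariance of \<open>gen\<close>: the
  commutator with the rotation is the adjoint action on the component index of
  \<open>G\<close>.\<close>

lemma equivariant: "equivariant_vf L E G"
  unfolding equivariant_vf_def
proof (intro allI impI)
  fix X i a assume ia: "i < b1 E" "a < ldim L"
  interpret rotation "vars L E" "ldim L" "adm X" by (rule rotation_vars)
  have mem: "A2 i a \<in> vars L E" using ia by (auto simp: vars_def varsF'_def)
  have "D (G i a) = - (\<Sum>c<ldim L. adm X c a *\<^sub>R G i c)"
    using deriv_at_rot[OF mem, of gen] by (simp add: rot_gen G_def eq_neg_iff_add_eq_0)
  also have "\<dots> = (\<Sum>c<ldim L. adm X a c *\<^sub>R G i c)"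
    unfolding sum_negf[symmetric] by (intro sum.cong refl) (simp add: adm_antisym[of X _ a])
  finally have 1: "D (G i a) = ad L X (G i) a" by (simp add: ad_def adm_def)
  have "D (G i a) = (\<Sum>v\<in>vars1 L E. \<Sum>c<ldim L. adm X (colour v) c *\<^sub>R (svar (recol v c) * deriv_at v (G i a)))"
    unfolding rot_def
    by (rule sum.mono_neutral_right[OF finite_vars]) (use deriv_at_eq_0[OF G_Fun] in \<open>auto simp: vars_def varsF'_def\<close>)
  also have "\<dots> = (\<Sum>j<b1 E. \<Sum>b<ldim L. ad L X (\<lambda>b. svar (A1 j b)) b * deriv_at (A1 j b) (G i a))"
    by (simp add: sum_vars1 ad_def adm_def sum_distrib_right)
  finally have 2: "D (G i a) = \<dots>" .
  show "shift1 L E (\<lambda>j. ad L X (\<lambda>b. svar (A1 j b))) (G i a) = G i a + ad L X (G i) a"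
    unfolding shift1_def 2[symmetric] 1 ..
qed

section \<open>Laplacian and anti-bracket of the generator\<close>

lemma laplacian_gen: "BV_laplacian L E gen = vf_div L E G"
proof -
  have "deriv_at (A3 a) gen = 0" for a
    by (rule deriv_at_gen_eq_0) (auto simp: vars1_def varsA2_def)
  moreover have "(\<Sum>a<ldim L. \<Sum>i<b1 E. deriv_at (A1 i a) (G i a)) = (\<Sum>i<b1 E. \<Sum>a<ldim L. deriv_at (A1 i a) (G i a))"
    by (rule sum.swap)
  ultimately show ?thesis by (simp add: BV_laplacian_def vf_div_def G_def)
qed

text \<open>Second derivatives of a single factor cancel against the subtracted Laplacians. Of the
  mixed terms only those pairing \<open>A1\<close> with \<open>A2\<close> remain, as
  \<open>gen\<close> involves neither \<open>A0\<close> nor \<open>A3\<close>. Evenness of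
  \<open>W\<close> removes the signs.\<close>

lemma antibracket_sum:
  "antibracket L E W gen = (\<Sum>a<ldim L. \<Sum>i<b1 E. deriv_at (A2 i a) W * deriv_at (A1 i a) gen + deriv_at (A1 i a) W * G i a)"
proof -
  have z: "deriv_at (A3 a) gen = 0" "deriv_at (A0 a) gen = 0" for a
    by (rule deriv_at_gen_eq_0; auto simp: vars1_def varsA2_def)+
  have 1: "deriv_at (A0 a) (deriv_at (A3 a) (W * gen)) = deriv_at (A0 a) (deriv_at (A3 a) W) * gen" for a
    by (simp add: deriv_at_mult z)
  have 2: "deriv_at (A1 i a) (deriv_at (A2 i a) (W * gen)) = deriv_at (A1 i a) (deriv_at (A2 i a) W) * gen
      + (deriv_at (A2 i a) W * deriv_at (A1 i a) gen + deriv_at (A1 i a) W * G i a)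
      + W * deriv_at (A1 i a) (deriv_at (A2 i a) gen)" for i a
  proof -
    have t: "twist (A1 i a) f = f" for f by (simp add: twist_def)
    show ?thesis
      by (simp add: deriv_at_mult[of "A2 i a"] twist_even[OF parity_W] deriv_at_mult[of "A1 i a"] t G_def)
  qed
  show ?thesis
    by (simp add: antibracket_def parity_W BV_laplacian_def 1 2 z sum.distrib distrib_right distrib_left
        sum_distrib_left sum_distrib_right)
qed

text \<open>The coefficient of each \<open>svar (A0 c)\<close> is the rotation of \<open>gen\<close>
  by the basis vector \<open>lbasis L c\<close>.\<close>

lemma U012_contribution:
  "(\<Sum>a<ldim L. \<Sum>i<b1 E. deriv_at (A2 i a) (cub A0_triples) * deriv_at (A1 i a) gen + deriv_at (A1 i a) (cub A0_triples) * G i a) = 0"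
proof -
  let ?n = "ldim L"
  \<comment> \<open>The matrix of the adjoint action of \<open>lbasis L c\<close> is
    \<open>strc a c b\<close>, and only the coordinates \<open>A1\<close> and \<open>A2\<close> on
    which \<open>gen\<close> depends contribute.\<close>
  have rotR: "(\<Sum>i<b1 E. \<Sum>a<?n. \<Sum>b<?n. strc a c b *\<^sub>R (svar (A1 i b) * deriv_at (A1 i a) gen))
     + (\<Sum>i<b1 E. \<Sum>a<?n. \<Sum>b<?n. strc a c b *\<^sub>R (svar (A2 i b) * G i a)) = 0" if "c < ?n" for c
  proof -
    let ?f = "\<lambda>v. \<Sum>b<?n. adm (lbasis L c) (colour v) b *\<^sub>R (svar (recol v b) * deriv_at v gen)"
    have "0 = (\<Sum>v\<in>vars L E. ?f v)" using rot_gen[of "lbasis L c"] by (simp add: rot_def)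
    also have "\<dots> = (\<Sum>v\<in>vars1 L E \<union> varsA2 L E. ?f v)"
      by (rule sum.mono_neutral_right[OF finite_vars]) (use deriv_at_gen_eq_0 in \<open>auto simp: vars_def varsF'_eq\<close>)
    also have "\<dots> = (\<Sum>v\<in>vars1 L E. ?f v) + (\<Sum>v\<in>varsA2 L E. ?f v)"
      by (rule sum.union_disjoint[OF finite_vars1 finite_varsA(2)]) (auto simp: vars1_def varsA2_def)
    finally show ?thesis
      by (simp add: sum_vars1 sum_varsA2 adm_def strc_def G_def)
  qed
  have "(\<Sum>a<?n. \<Sum>i<b1 E. deriv_at (A2 i a) (cub A0_triples) * deriv_at (A1 i a) gen + deriv_at (A1 i a) (cub A0_triples) * G i a)
    = (\<Sum>i<b1 E. \<Sum>a<?n. deriv_at (A2 i a) (cub A0_triples) * deriv_at (A1 i a) gen + deriv_at (A1 i a) (cub A0_triples) * G i a)"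
    by (rule sum.swap)
  also have "\<dots> = (\<Sum>i<b1 E. \<Sum>a<?n. \<Sum>c<?n. svar (A0 c) * ((\<Sum>b<?n. strc a c b *\<^sub>R (svar (A1 i b) * deriv_at (A1 i a) gen))
      + (\<Sum>b<?n. strc a c b *\<^sub>R (svar (A2 i b) * G i a))))"
    by (intro sum.cong refl)
       (simp add: deriv_at_A2_cub_A0 deriv_at_A1_cub_A0 sum_distrib_right sum_distrib_left mult.assoc
         sum.distrib distrib_left)
  also have "\<dots> = (\<Sum>i<b1 E. \<Sum>c<?n. \<Sum>a<?n. svar (A0 c) * ((\<Sum>b<?n. strc a c b *\<^sub>R (svar (A1 i b) * deriv_at (A1 i a) gen))
      + (\<Sum>b<?n. strc a c b *\<^sub>R (svar (A2 i b) * G i a))))"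
    by (rule sum.cong[OF refl], rule sum.swap)
  also have "\<dots> = (\<Sum>c<?n. \<Sum>i<b1 E. \<Sum>a<?n. svar (A0 c) * ((\<Sum>b<?n. strc a c b *\<^sub>R (svar (A1 i b) * deriv_at (A1 i a) gen))
      + (\<Sum>b<?n. strc a c b *\<^sub>R (svar (A2 i b) * G i a))))"
    by (rule sum.swap)
  also have "\<dots> = (\<Sum>c<?n. svar (A0 c) * ((\<Sum>i<b1 E. \<Sum>a<?n. \<Sum>b<?n. strc a c b *\<^sub>R (svar (A1 i b) * deriv_at (A1 i a) gen))
     + (\<Sum>i<b1 E. \<Sum>a<?n. \<Sum>b<?n. strc a c b *\<^sub>R (svar (A2 i b) * G i a))))"
    by (simp only: sum.distrib sum_distrib_left distrib_left)
  also have "\<dots> = 0" using rotR by (intro sum.neutral ballI) simp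
  finally show ?thesis .
qed

text \<open>\<open>W\<close> minus its terms with \<open>A0\<close> depends on \<open>A1\<close>
  alone, so it enters only through its \<open>A1\<close> derivatives, which multiply
  \<open>G\<close>. The terms with \<open>A0\<close> cancel by
  \<open>U012_contribution\<close>.\<close>

lemma antibracket_gen: "antibracket L E W gen = vf_apply L E G (W_prod_111 A L I E + F)"
proof -
  let ?H = "W_prod_111 A L I E + F"
  have H: "?H \<in> Fun (vars1 L E)"
    unfolding W_split Fun_supp by (rule supp_mono[OF W_minus mons0_vars1])
  have W: "W = cub A0_triples + ?H" by (simp add: W_split)
  have d2: "deriv_at (A2 i a) W = deriv_at (A2 i a) (cub A0_triples)" for i a
  proof -
    have "deriv_at (A2 i a) ?H = 0" by (rule deriv_at_eq_0[OF H]) (auto simp: vars1_def)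
    then show ?thesis by (subst W) simp
  qed
  have d1: "deriv_at (A1 i a) W = deriv_at (A1 i a) (cub A0_triples) + deriv_at (A1 i a) ?H" for i a
    by (subst W) (rule deriv_at_add)
  have "antibracket L E W gen = (\<Sum>a<ldim L. \<Sum>i<b1 E. (deriv_at (A2 i a) (cub A0_triples) * deriv_at (A1 i a) gen
      + deriv_at (A1 i a) (cub A0_triples) * G i a) + deriv_at (A1 i a) ?H * G i a)"
    unfolding antibracket_sum d1 d2 by (simp only: distrib_right add.assoc)
  also have "\<dots> = (\<Sum>a<ldim L. \<Sum>i<b1 E. deriv_at (A1 i a) ?H * G i a)"
    unfolding sum.distrib using U012_contribution by (simp only: sum.distrib add_0_left)
  also have "\<dots> = (\<Sum>i<b1 E. \<Sum>a<ldim L. deriv_at (A1 i a) ?H * G i a)"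
    by (rule sum.swap)
  also have "\<dots> = vf_apply L E G ?H"
    unfolding vf_apply_def by (intro sum.cong refl even_commute[OF parity_G, symmetric])
  finally show ?thesis .
qed

end

theorem proposition5:
  fixes A :: "'c::real_vector dgfa"
    and L :: "'g::real_vector lie"
    and I :: "('c, 'h::real_vector) induction"
    and E :: "('c, 'h) frame"
    and d\<iota> :: "'h \<Rightarrow> 'c" and dK :: "'c \<Rightarrow> 'c" and d\<kappa> :: "'c \<Rightarrow> 'c" and dI :: "'h \<Rightarrow> 'c"
    and W R' :: sfun
  assumes "dg_frobenius_algebra A"
    and "quadratic_lie_algebra L"
    and "induction_data A I"
    and "dim (coh A I 0) = 1" and "dim (coh A I 3) = 1"
    and "adapted_frame A I E"
    and "induction_change A I d\<iota> dK d\<kappa> dI"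
    and "effective_action A L I E W"
    and "R' = generator A L I E d\<kappa> dI W"
  shows "\<exists>G F.
      (\<forall>i<b1 E. \<forall>a<ldim L. G i a \<in> Fun_hbar (vars1 L E)) \<and>
      R' = (\<Sum>a<ldim L. \<Sum>i<b1 E. svar (A2 i a) * G i a) \<and>
      equivariant_vf L E G \<and>
      F \<in> Fun_hbar (vars1 L E) \<and>
      W = W_prod A L I E + F \<and>
      W + antibracket L E W R' + hbar * BV_laplacian L E R' =
        W_prod A L I E +
          (F + vf_apply L E G (W_prod_111 A L I E + F) + hbar * vf_div L E G)"
proof -
  interpret S: bv_setup A L I E
    using assms by (intro bv_setup.intro)
  obtain \<rho> where \<rho>: "inverse_hessian (varsK L E) (free_action A L E) = (\<lambda>x y. fls_const (colour_diagonal L E \<rho> x y))"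
    by (rule S.inverse_hessian_exists)
  interpret bv_integral A L I E d\<iota> dK d\<kappa> dI \<rho> W
    using S.bv_setup_axioms assms \<rho> by (intro bv_integral.intro bv_integral_axioms.intro)
  have R': "R' = gen" by (simp add: assms generator_eq)
  have W: "W = W_prod A L I E + F" by (simp add: F_def)
  have "W + antibracket L E W R' + hbar * BV_laplacian L E R' =
      W_prod A L I E + (F + vf_apply L E G (W_prod_111 A L I E + F) + hbar * vf_div L E G)"
    unfolding R' antibracket_gen laplacian_gen by (subst W) (simp only: add.assoc)
  then show ?thesis
    using G_Fun_hbar gen_Euler equivariant F_Fun_hbar W unfolding R' by blast
qed

end
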